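(* Fix $r>0$ and let $f\in \mathbf{L}^2(\Omega)$, $g\in L^2(\Omega)$, $u_\Gamma\in\mathbf{H}^{1/2}(\Gamma)$, $r_\Gamma\in H^{-1/2}(\Gamma)$ be such that $$\frac{\tilde\gamma_1}{r}\max\{\tilde\gamma_1\kappa_2 r,1\}\,\big(\|g\|_{0,\Omega}+\|r_\Gamma\|_{-1/2,\Gamma}+\|u_\Gamma\|_{1/2,\Gamma}+\|f\|_{0,\Omega}\big)<1 .$$ Then the operator $\widetilde{\mathcal{J}}$ has a unique fixed point $\underline{d}\in\widetilde{\mathbf{W}}$. Equivalently, the nonlinear problem ($\widetilde{\mathrm P}$) has a unique solution $((\underline{d},\sigma),\underline{u})\in(\widetilde{\mathbf{X}}\times\widetilde{\mathbf{Y}})\times\widetilde{\mathbf{Z}}$ with $\underline{d}\in\widetilde{\mathbf{W}}$. In addition, there is a constant $C>0$, independent of the data $f,g,u_\Gamma,r_\Gamma$ and of the solution, such that $$\|((\underline{d},\sigma),\underline{u})\|\le C\big(\|g\|_{0,\Omega}+\|r_\Gamma\|_{-1/2,\Gamma}+\|u_\Gamma\|_{1/2,\Gamma}+\|f\|_{0,\Omega}\big).$$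
   Context: Setting. $\Omega\subset\mathbb{R}^n$, $n\in\{2,3\}$, is an open bounded domain with Lipschitz boundary $\Gamma$ and unit outward normal $\boldsymbol{n}$. Bold spaces $\mathbf{L}^2,\mathbf{H}^m$ are vector-valued, blackboard ones $\mathbb{L}^2,\mathbb{H}^m$ tensor-valued ($n\times n$); $\|\cdot\|_{m,\Omega}$ is the $H^m(\Omega)$ norm ($H^0=L^2$). $\mathbb{I}$ is the identity tensor; $\mathbf{div}$ of a tensor is the row-wise divergence; $\langle\cdot,\cdot\rangle_\Gamma$ is the duality between $H^{-1/2}(\Gamma)$ and $H^{1/2}(\Gamma)$ (also vector-valued). Parameters: constants $\lambda,\mu>0$, $0\le\alpha\le1$, $c_0>0$; $\mathcal{C}d:=\lambda(\operatorname{tr}d)\mathbb{I}+2\mu d$. Spaces: $\widetilde{\mathbf{X}}:=\mathbb{L}^2(\Omega)\times H^1(\Omega)$, $\widetilde{\mathbf{Y}}:=\{\tau\in\mathbb{L}^2(\Omega):\mathbf{div}\,\tau\in\mathbf{L}^2(\Omega)\}$, $\widetilde{\mathbf{Z}}:=\mathbf{L}^2(\Omega)\times\mathbb{L}^2_{\rm skew}(\Omega)$, where $\mathbb{L}^2_{\rm skew}(\Omega)=\{\eta\in\mathbb{L}^2(\Omega):\eta=-\eta^{t}\}$. Elements are written $\underline{d}=(d,p)$, $\underline{e}=(e,q)$, $\underline{w}=(w,s)\in\widetilde{\mathbf{X}}$ and $\underline{u}=(u,\gamma)$, $\underline{v}=(v,\eta)\in\widetilde{\mathbf{Z}}$. Norms: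 $\|\underline{e}\|_{\widetilde{\mathbf{X}}}^2=\|e\|_{0,\Omega}^2+\|q\|_{1,\Omega}^2$, $\|\tau\|_{\widetilde{\mathbf{Y}}}^2=\|\tau\|_{0,\Omega}^2+\|\mathbf{div}\,\tau\|_{0,\Omega}^2$, $\|\underline{v}\|_{\widetilde{\mathbf{Z}}}^2=\|v\|_{0,\Omega}^2+\|\eta\|_{0,\Omega}^2$; product spaces carry the Euclidean combination of norms, so $\|((\underline{e},\tau),\underline{v})\|^2=\|\underline{e}\|_{\widetilde{\mathbf{X}}}^2+\|\tau\|_{\widetilde{\mathbf{Y}}}^2+\|\underline{v}\|_{\widetilde{\mathbf{Z}}}^2$. Permeability: $\kappa$ assigns to each $(d,p)$ an $n\times n$ tensor $\kappa(d,p)\in\mathbb{L}^\infty(\Omega)$, and there are constants $\kappa_1,\kappa_2>0$ with $\kappa_1|v|^2\le v^{t}\kappa(\cdot,\cdot)v$ for all $v\in\mathbb{R}^n\setminus\{0\}$ (for all arguments, a.e. in $\Omega$) and $\|\kappa(\cdot,p_1)-\kappa(\cdot,p_2)\|_{\mathbb{L}^\infty(\Omega)}\le\kappa_2\|p_1-p_2\|_{1,\Omega}$ for all $p_1,p_2\in H^1(\Omega)$, where each dot stands for an arbitrary (possibly different) first argument. Forms: for $\underline{w}\in\widetilde{\mathbf{X}}$, $$\tilde a_{\underline{w}}(\underline{d},\underline{e}):=\int_\Omega\mathcal{C}d:e+\int_\Omega\kappa(\underline{w})\nabla p\cdot\nabla q+c_0\int_\Omega pq+\alpha\int_\Omega q\operatorname{tr}d-\alpha\int_\Omega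 p\operatorname{tr}e,$$ $\tilde a(\underline{d},\underline{e}):=\tilde a_{\underline{d}}(\underline{d},\underline{e})$, $\tilde b_1(\underline{e},\tau):=-\int_\Omega\tau:e$, $\tilde b_2((\underline{e},\tau),\underline{v}):=-\int_\Omega v\cdot\mathbf{div}\,\tau-\int_\Omega\tau:\eta$. Functionals: $\widetilde G(\underline{e}):=\int_\Omega gq+\langle r_\Gamma,q\rangle_\Gamma$, $\widetilde H(\tau):=-\langle\tau\boldsymbol{n},u_\Gamma\rangle_\Gamma$, $\widetilde F(\underline{v}):=\int_\Omega f\cdot v$. Problem ($\widetilde{\mathrm P}$): find $((\underline{d},\sigma),\underline{u})\in(\widetilde{\mathbf{X}}\times\widetilde{\mathbf{Y}})\times\widetilde{\mathbf{Z}}$ such that for all $((\underline{e},\tau),\underline{v})\in(\widetilde{\mathbf{X}}\times\widetilde{\mathbf{Y}})\times\widetilde{\mathbf{Z}}$: $\tilde a(\underline{d},\underline{e})+\tilde b_1(\underline{e},\sigma)=\widetilde G(\underline{e})$, $\;\tilde b_1(\underline{d},\tau)+\tilde b_2((\underline{e},\tau),\underline{u})=\widetilde H(\tau)$, $\;\tilde b_2((\underline{d},\sigma),\underline{v})=\widetilde F(\underline{v})$. Linearised problem ($\widetilde{\mathrm P}_{\underline{w}}$): the same with $\tilde a$ replaced by $\tilde a_{\underline{w}}$. $\widetilde{\mathbf{W}}:=\{\underline{w}\in\widetilde{\mathbf{X}}:\|\underline{w}\|_{\widetilde{\mathbf{X}}}\le r\}$, and $\widetilde{\mathcal{J}}:\widetilde{\mathbf{W}}\to\widetilde{\mathbf{X}}$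 maps $\underline{w}$ to the first component $\underline{d}$ of the solution $((\underline{d},\sigma),\underline{u})$ of ($\widetilde{\mathrm P}_{\underline{w}}$). Constants: $\tilde\beta_2>0$ is a constant such that $\sup_{0\ne(\underline{e},\tau)\in\widetilde{\mathbf{X}}\times\widetilde{\mathbf{Y}}}\frac{\tilde b_2((\underline{e},\tau),\underline{v})}{\|(\underline{e},\tau)\|_{\widetilde{\mathbf{X}}\times\widetilde{\mathbf{Y}}}}\ge\tilde\beta_2\|\underline{v}\|_{\widetilde{\mathbf{Z}}}$ for all $\underline{v}\in\widetilde{\mathbf{Z}}$; $C_a:=\max\{2\mu+n\lambda,c_0,n\alpha,\kappa_2r\}$, $c_a:=\min\{\kappa_1,2\mu,c_0\}$, $$\gamma_2:=\frac{(C_a+2)(c_a+1+C_a)}{c_a},\qquad\tilde\gamma_1:=\frac{(C_a+1+\tilde\beta_2+\gamma_2)^2}{\tilde\beta_2^2\gamma_2}.$$ *)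

theory Defs
  imports "HOL-Analysis.Analysis" "HOL-Probability.Essential_Supremum"
begin

text \<open>
  Elements of Lebesgue and Sobolev spaces over an open set \<open>\<Omega>\<close> are represented by functions on the
  whole of \<open>real ^ 'n\<close>, of which only the values on \<open>\<Omega>\<close> matter; two representatives denote the same
  element iff they agree almost everywhere on \<open>\<Omega>\<close>.  Uniqueness is therefore always meant up
  to this relation.
\<close>

type_synonym 'n scalar_fld = "real ^ 'n \<Rightarrow> real"
type_synonym 'n vector_fld = "real ^ 'n \<Rightarrow> real ^ 'n"
type_synonym 'n tensor_fld = "real ^ 'n \<Rightarrow> real ^ 'n ^ 'n"


section \<open>Lipschitz domains\<close>

text \<open>
  Near each boundary point \<open>\<Omega>\<close> lies strictly below the graph of a Lipschitz function \<open>\<phi>\<close> defined on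
  the hyperplane orthogonal to a unit vector \<open>\<nu>\<close>.
\<close>

definition lipschitz_boundary :: "(real ^ 'n) set \<Rightarrow> bool" where
  "lipschitz_boundary \<Omega> \<longleftrightarrow>
     (\<forall>x0 \<in> frontier \<Omega>. \<exists>\<nu> \<phi> L \<rho>. norm \<nu> = 1 \<and> \<rho> > 0 \<and> L-lipschitz_on {y. y \<bullet> \<nu> = 0} \<phi> \<and>
        (\<forall>x \<in> ball x0 \<rho>. x \<in> \<Omega> \<longleftrightarrow> x \<bullet> \<nu> < (\<phi> (x - (x \<bullet> \<nu>) *\<^sub>R \<nu>) :: real)))"

definition lipschitz_domain :: "(real ^ 'n) set \<Rightarrow> bool" where
  "lipschitz_domain \<Omega> \<longleftrightarrow>
     open \<Omega> \<and> connected \<Omega> \<and> \<Omega> \<noteq> {} \<and> bounded \<Omega> \<and> lipschitz_boundary \<Omega>"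


section \<open>Lebesgue spaces\<close>

definition ae_eq :: "(real ^ 'n) set \<Rightarrow> (real ^ 'n \<Rightarrow> 'b) \<Rightarrow> (real ^ 'n \<Rightarrow> 'b) \<Rightarrow> bool" where
  "ae_eq \<Omega> f g \<longleftrightarrow> (AE x in lebesgue_on \<Omega>. f x = g x)"

definition L2 :: "(real ^ 'n) set \<Rightarrow> (real ^ 'n \<Rightarrow> 'b::euclidean_space) set" where
  "L2 \<Omega> = {f. f \<in> borel_measurable (lebesgue_on \<Omega>) \<and>
             integrable (lebesgue_on \<Omega>) (\<lambda>x. (norm (f x))\<^sup>2)}"

definition L2_norm :: "(real ^ 'n) set \<Rightarrow> (real ^ 'n \<Rightarrow> 'b::euclidean_space) \<Rightarrow> real" where
  "L2_norm \<Omega> f = sqrt (LINT x|lebesgue_on \<Omega>. (norm (f x))\<^sup>2)"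

definition L2_skew :: "(real ^ 'n) set \<Rightarrow> 'n tensor_fld set" where
  "L2_skew \<Omega> = {\<eta> \<in> L2 \<Omega>. AE x in lebesgue_on \<Omega>. \<eta> x = - transpose (\<eta> x)}"

text \<open>On tensors the pointwise norm is the Frobenius norm and \<open>\<bullet>\<close> is the product \<open>\<sigma> : \<tau>\<close>.\<close>

definition Linf_norm :: "(real ^ 'n) set \<Rightarrow> (real ^ 'n \<Rightarrow> 'b::euclidean_space) \<Rightarrow> real" where
  "Linf_norm \<Omega> f = real_of_ereal (esssup (lebesgue_on \<Omega>) (\<lambda>x. ereal (norm (f x))))"

definition Linf :: "(real ^ 'n) set \<Rightarrow> (real ^ 'n \<Rightarrow> 'b::euclidean_space) set" where
  "Linf \<Omega> = {f. f \<in> borel_measurable (lebesgue_on \<Omega>) \<and>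
               (\<exists>c. AE x in lebesgue_on \<Omega>. norm (f x) \<le> c)}"


section \<open>Weak derivatives\<close>

definition partial :: "'n \<Rightarrow> 'n::finite scalar_fld \<Rightarrow> 'n scalar_fld" where
  "partial j f x = frechet_derivative f (at x) (axis j 1)"

primrec times_cont_diff :: "nat \<Rightarrow> 'n::finite scalar_fld \<Rightarrow> bool" where
  "times_cont_diff 0 f \<longleftrightarrow> continuous_on UNIV f"
| "times_cont_diff (Suc k) f \<longleftrightarrow>
     (\<forall>x. f differentiable (at x)) \<and> (\<forall>j. times_cont_diff k (partial j f))"

definition test_functions :: "(real ^ 'n) set \<Rightarrow> 'n::finite scalar_fld set" where
  "test_functions \<Omega> =
     {\<phi>. (\<forall>k. times_cont_diff k \<phi>) \<and>
          compact (closure {x. \<phi> x \<noteq> 0}) \<and> closure {x. \<phi> x \<noteq> 0} \<subseteq> \<Omega>}"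

definition has_weak_grad :: "(real ^ 'n) set \<Rightarrow> 'n::finite scalar_fld \<Rightarrow> 'n vector_fld \<Rightarrow> bool" where
  "has_weak_grad \<Omega> q G \<longleftrightarrow>
     (\<forall>\<phi> \<in> test_functions \<Omega>. \<forall>j.
        (LINT x|lebesgue_on \<Omega>. q x * partial j \<phi> x) = - (LINT x|lebesgue_on \<Omega>. G x $ j * \<phi> x))"

definition H1 :: "(real ^ 'n) set \<Rightarrow> 'n::finite scalar_fld set" where
  "H1 \<Omega> = {q \<in> L2 \<Omega>. \<exists>G \<in> L2 \<Omega>. has_weak_grad \<Omega> q G}"

text \<open>Weak gradients and divergences are unique only almost everywhere; a representative is chosen.\<close>

definition grad :: "(real ^ 'n) set \<Rightarrow> 'n::finite scalar_fld \<Rightarrow> 'n vector_fld" where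
  "grad \<Omega> q = (SOME G. G \<in> L2 \<Omega> \<and> has_weak_grad \<Omega> q G)"

definition H1_norm :: "(real ^ 'n) set \<Rightarrow> 'n::finite scalar_fld \<Rightarrow> real" where
  "H1_norm \<Omega> q = sqrt ((L2_norm \<Omega> q)\<^sup>2 + (L2_norm \<Omega> (grad \<Omega> q))\<^sup>2)"

definition H1_vec :: "(real ^ 'n) set \<Rightarrow> 'n::finite vector_fld set" where
  "H1_vec \<Omega> = {v. \<forall>i. (\<lambda>x. v x $ i) \<in> H1 \<Omega>}"

definition grad_vec :: "(real ^ 'n) set \<Rightarrow> 'n::finite vector_fld \<Rightarrow> 'n tensor_fld" where
  "grad_vec \<Omega> v = (\<lambda>x. \<chi> i. grad \<Omega> (\<lambda>y. v y $ i) x)"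

definition H1_vec_norm :: "(real ^ 'n) set \<Rightarrow> 'n::finite vector_fld \<Rightarrow> real" where
  "H1_vec_norm \<Omega> v = sqrt ((L2_norm \<Omega> v)\<^sup>2 + (L2_norm \<Omega> (grad_vec \<Omega> v))\<^sup>2)"

definition has_weak_div :: "(real ^ 'n) set \<Rightarrow> 'n::finite tensor_fld \<Rightarrow> 'n vector_fld \<Rightarrow> bool" where
  "has_weak_div \<Omega> \<tau> D \<longleftrightarrow>
     (\<forall>\<phi> \<in> test_functions \<Omega>. \<forall>i.
        (LINT x|lebesgue_on \<Omega>. (\<Sum>j\<in>UNIV. \<tau> x $ i $ j * partial j \<phi> x))
          = - (LINT x|lebesgue_on \<Omega>. D x $ i * \<phi> x))"

definition tensor_div :: "(real ^ 'n) set \<Rightarrow> 'n::finite tensor_fld \<Rightarrow> 'n vector_fld" where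
  "tensor_div \<Omega> \<tau> = (SOME D. D \<in> L2 \<Omega> \<and> has_weak_div \<Omega> \<tau> D)"


section \<open>Trace spaces\<close>

text \<open>
  \<open>H\<^sup>1\<^sup>/\<^sup>2(\<Gamma>)\<close> is the trace space of \<open>H\<^sup>1(\<Omega>)\<close> with the norm of minimal lifting.  As the kernel of the
  trace operator of a Lipschitz domain is \<open>H\<^sup>1\<^sub>0(\<Omega>)\<close>, the closure of the test functions, the trace of
  \<open>v\<close> is represented by the set of all \<open>H\<^sup>1(\<Omega>)\<close> functions with the same boundary values, i.e. by
  the coset of \<open>v\<close> modulo \<open>H\<^sup>1\<^sub>0(\<Omega>)\<close>.
\<close>

definition H10 :: "(real ^ 'n) set \<Rightarrow> 'n::finite scalar_fld set" where
  "H10 \<Omega> = {v \<in> H1 \<Omega>. \<forall>\<epsilon>>0. \<exists>\<phi> \<in> test_functions \<Omega>. H1_norm \<Omega> (\<lambda>x. v x - \<phi> x) < \<epsilon>}"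

definition bdry_trace :: "(real ^ 'n) set \<Rightarrow> 'n::finite scalar_fld \<Rightarrow> 'n scalar_fld set" where
  "bdry_trace \<Omega> v = {w \<in> H1 \<Omega>. (\<lambda>x. w x - v x) \<in> H10 \<Omega>}"

definition H_half :: "(real ^ 'n) set \<Rightarrow> 'n::finite scalar_fld set set" where
  "H_half \<Omega> = bdry_trace \<Omega> ` H1 \<Omega>"

definition H_half_norm :: "(real ^ 'n) set \<Rightarrow> 'n::finite scalar_fld set \<Rightarrow> real" where
  "H_half_norm \<Omega> \<Phi> = Inf (H1_norm \<Omega> ` \<Phi>)"

definition bdry_trace_vec :: "(real ^ 'n) set \<Rightarrow> 'n::finite vector_fld \<Rightarrow> 'n vector_fld set" where
  "bdry_trace_vec \<Omega> v = {w \<in> H1_vec \<Omega>. \<forall>i. (\<lambda>x. w x $ i - v x $ i) \<in> H10 \<Omega>}"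

definition H_half_vec :: "(real ^ 'n) set \<Rightarrow> 'n::finite vector_fld set set" where
  "H_half_vec \<Omega> = bdry_trace_vec \<Omega> ` H1_vec \<Omega>"

definition H_half_vec_norm :: "(real ^ 'n) set \<Rightarrow> 'n::finite vector_fld set \<Rightarrow> real" where
  "H_half_vec_norm \<Omega> \<Phi> = Inf (H1_vec_norm \<Omega> ` \<Phi>)"

text \<open>
  \<open>H\<^sup>-\<^sup>1\<^sup>/\<^sup>2(\<Gamma>)\<close> is the dual of \<open>H\<^sup>1\<^sup>/\<^sup>2(\<Gamma>)\<close>, with the dual norm; the duality
  \<open>\<langle>r, q\<rangle>\<^sub>\<Gamma>\<close> with \<open>q \<in> H\<^sup>1(\<Omega>)\<close> is \<open>r (bdry_trace \<Omega> q)\<close>.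
\<close>

definition H_mhalf :: "(real ^ 'n) set \<Rightarrow> ('n::finite scalar_fld set \<Rightarrow> real) set" where
  "H_mhalf \<Omega> =
     {r. (\<forall>v \<in> H1 \<Omega>. \<forall>w \<in> H1 \<Omega>. \<forall>a.
            r (bdry_trace \<Omega> (\<lambda>x. a * v x + w x)) = a * r (bdry_trace \<Omega> v) + r (bdry_trace \<Omega> w)) \<and>
         (\<exists>c. \<forall>\<Phi> \<in> H_half \<Omega>. \<bar>r \<Phi>\<bar> \<le> c * H_half_norm \<Omega> \<Phi>)}"

definition H_mhalf_norm :: "(real ^ 'n) set \<Rightarrow> ('n::finite scalar_fld set \<Rightarrow> real) \<Rightarrow> real" where
  "H_mhalf_norm \<Omega> r = Sup {\<bar>r \<Phi>\<bar> | \<Phi>. \<Phi> \<in> H_half \<Omega> \<and> H_half_norm \<Omega> \<Phi> \<le> 1}"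

text \<open>
  The normal trace \<open>\<tau>n\<close> of a tensor with square integrable divergence is the functional on
  \<open>H\<^sup>1\<^sup>/\<^sup>2(\<Gamma>)\<close> given by Green's formula; the value does not depend on the lifting \<open>v\<close>.
\<close>

definition normal_trace ::
    "(real ^ 'n) set \<Rightarrow> 'n::finite tensor_fld \<Rightarrow> 'n vector_fld set \<Rightarrow> real" where
  "normal_trace \<Omega> \<tau> \<Phi> =
     (let v = (SOME v. v \<in> \<Phi>) in
        (LINT x|lebesgue_on \<Omega>. \<tau> x \<bullet> grad_vec \<Omega> v x)
          + (LINT x|lebesgue_on \<Omega>. v x \<bullet> tensor_div \<Omega> \<tau> x))"


section \<open>The product spaces\<close>

type_synonym 'n X_elem = "'n tensor_fld \<times> 'n scalar_fld"
type_synonym 'n Z_elem = "'n vector_fld \<times> 'n tensor_fld"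

definition pair_ae_eq ::
    "(real ^ 'n) set \<Rightarrow> (real ^ 'n \<Rightarrow> 'b) \<times> (real ^ 'n \<Rightarrow> 'c) \<Rightarrow>
      (real ^ 'n \<Rightarrow> 'b) \<times> (real ^ 'n \<Rightarrow> 'c) \<Rightarrow> bool" where
  "pair_ae_eq \<Omega> a b \<longleftrightarrow> ae_eq \<Omega> (fst a) (fst b) \<and> ae_eq \<Omega> (snd a) (snd b)"

definition X_space :: "(real ^ 'n) set \<Rightarrow> 'n::finite X_elem set" where
  "X_space \<Omega> = L2 \<Omega> \<times> H1 \<Omega>"

definition Y_space :: "(real ^ 'n) set \<Rightarrow> 'n::finite tensor_fld set" where
  "Y_space \<Omega> = {\<tau> \<in> L2 \<Omega>. \<exists>D \<in> L2 \<Omega>. has_weak_div \<Omega> \<tau> D}"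

definition Z_space :: "(real ^ 'n) set \<Rightarrow> 'n::finite Z_elem set" where
  "Z_space \<Omega> = L2 \<Omega> \<times> L2_skew \<Omega>"

fun X_norm :: "(real ^ 'n) set \<Rightarrow> 'n::finite X_elem \<Rightarrow> real" where
  "X_norm \<Omega> (e, q) = sqrt ((L2_norm \<Omega> e)\<^sup>2 + (H1_norm \<Omega> q)\<^sup>2)"

definition Y_norm :: "(real ^ 'n) set \<Rightarrow> 'n::finite tensor_fld \<Rightarrow> real" where
  "Y_norm \<Omega> \<tau> = sqrt ((L2_norm \<Omega> \<tau>)\<^sup>2 + (L2_norm \<Omega> (tensor_div \<Omega> \<tau>))\<^sup>2)"

fun Z_norm :: "(real ^ 'n) set \<Rightarrow> 'n::finite Z_elem \<Rightarrow> real" where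
  "Z_norm \<Omega> (v, \<eta>) = sqrt ((L2_norm \<Omega> v)\<^sup>2 + (L2_norm \<Omega> \<eta>)\<^sup>2)"

definition XY_norm :: "(real ^ 'n) set \<Rightarrow> 'n::finite X_elem \<times> 'n tensor_fld \<Rightarrow> real" where
  "XY_norm \<Omega> et = sqrt ((X_norm \<Omega> (fst et))\<^sup>2 + (Y_norm \<Omega> (snd et))\<^sup>2)"

definition XYZ_norm ::
    "(real ^ 'n) set \<Rightarrow> ('n::finite X_elem \<times> 'n tensor_fld) \<times> 'n Z_elem \<Rightarrow> real" where
  "XYZ_norm \<Omega> s = sqrt ((XY_norm \<Omega> (fst s))\<^sup>2 + (Z_norm \<Omega> (snd s))\<^sup>2)"

definition W_ball :: "(real ^ 'n) set \<Rightarrow> real \<Rightarrow> 'n::finite X_elem set" where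
  "W_ball \<Omega> r = {w \<in> X_space \<Omega>. X_norm \<Omega> w \<le> r}"


section \<open>Forms and functionals\<close>

definition hooke :: "real \<Rightarrow> real \<Rightarrow> real ^ 'n ^ 'n \<Rightarrow> real ^ 'n ^ 'n::finite" where
  "hooke lam \<mu> d = (lam * trace d) *\<^sub>R mat 1 + (2 * \<mu>) *\<^sub>R d"

definition permeability ::
    "(real ^ 'n) set \<Rightarrow> real \<Rightarrow> real \<Rightarrow> ('n::finite X_elem \<Rightarrow> 'n tensor_fld) \<Rightarrow> bool" where
  "permeability \<Omega> \<kappa>1 \<kappa>2 \<kappa> \<longleftrightarrow>
     (\<forall>w \<in> X_space \<Omega>. \<kappa> w \<in> Linf \<Omega>) \<and>
     (\<forall>w \<in> X_space \<Omega>. AE x in lebesgue_on \<Omega>. \<forall>v. \<kappa>1 * (norm v)\<^sup>2 \<le> v \<bullet> (\<kappa> w x *v v)) \<and>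
     (\<forall>d1 \<in> L2 \<Omega>. \<forall>d2 \<in> L2 \<Omega>. \<forall>p1 \<in> H1 \<Omega>. \<forall>p2 \<in> H1 \<Omega>.
        Linf_norm \<Omega> (\<lambda>x. \<kappa> (d1, p1) x - \<kappa> (d2, p2) x) \<le> \<kappa>2 * H1_norm \<Omega> (\<lambda>x. p1 x - p2 x))"

fun a_form :: "(real ^ 'n) set \<Rightarrow> real \<Rightarrow> real \<Rightarrow> real \<Rightarrow> real \<Rightarrow> ('n::finite X_elem \<Rightarrow> 'n tensor_fld) \<Rightarrow>
    'n X_elem \<Rightarrow> 'n X_elem \<Rightarrow> 'n X_elem \<Rightarrow> real" where
  "a_form \<Omega> lam \<mu> \<alpha> c0 \<kappa> w (d, p) (e, q) =
     (LINT x|lebesgue_on \<Omega>. hooke lam \<mu> (d x) \<bullet> e x)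
     + (LINT x|lebesgue_on \<Omega>. (\<kappa> w x *v grad \<Omega> p x) \<bullet> grad \<Omega> q x)
     + c0 * (LINT x|lebesgue_on \<Omega>. p x * q x)
     + \<alpha> * (LINT x|lebesgue_on \<Omega>. q x * trace (d x))
     - \<alpha> * (LINT x|lebesgue_on \<Omega>. p x * trace (e x))"

definition b1_form :: "(real ^ 'n) set \<Rightarrow> 'n::finite X_elem \<Rightarrow> 'n tensor_fld \<Rightarrow> real" where
  "b1_form \<Omega> e \<tau> = - (LINT x|lebesgue_on \<Omega>. \<tau> x \<bullet> fst e x)"

definition b2_form :: "(real ^ 'n) set \<Rightarrow> 'n::finite X_elem \<times> 'n tensor_fld \<Rightarrow> 'n Z_elem \<Rightarrow> real" where
  "b2_form \<Omega> et v =
     - (LINT x|lebesgue_on \<Omega>. fst v x \<bullet> tensor_div \<Omega> (snd et) x)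
     - (LINT x|lebesgue_on \<Omega>. snd et x \<bullet> snd v x)"

definition G_fun :: "(real ^ 'n) set \<Rightarrow> 'n::finite scalar_fld \<Rightarrow> ('n scalar_fld set \<Rightarrow> real) \<Rightarrow>
    'n X_elem \<Rightarrow> real" where
  "G_fun \<Omega> g r\<^sub>\<Gamma> e = (LINT x|lebesgue_on \<Omega>. g x * snd e x) + r\<^sub>\<Gamma> (bdry_trace \<Omega> (snd e))"

definition H_fun :: "(real ^ 'n) set \<Rightarrow> 'n::finite vector_fld set \<Rightarrow> 'n tensor_fld \<Rightarrow> real" where
  "H_fun \<Omega> u\<^sub>\<Gamma> \<tau> = - normal_trace \<Omega> \<tau> u\<^sub>\<Gamma>"

definition F_fun :: "(real ^ 'n) set \<Rightarrow> 'n::finite vector_fld \<Rightarrow> 'n Z_elem \<Rightarrow> real" where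
  "F_fun \<Omega> f v = (LINT x|lebesgue_on \<Omega>. f x \<bullet> fst v x)"


section \<open>The nonlinear and the linearised problem\<close>

definition saddle_point_solution ::
    "(real ^ 'n) set \<Rightarrow> ('n::finite X_elem \<Rightarrow> 'n X_elem \<Rightarrow> real) \<Rightarrow> ('n X_elem \<Rightarrow> real) \<Rightarrow>
      ('n tensor_fld \<Rightarrow> real) \<Rightarrow> ('n Z_elem \<Rightarrow> real) \<Rightarrow>
      'n X_elem \<Rightarrow> 'n tensor_fld \<Rightarrow> 'n Z_elem \<Rightarrow> bool" where
  "saddle_point_solution \<Omega> a G H F d \<sigma> u \<longleftrightarrow>
     d \<in> X_space \<Omega> \<and> \<sigma> \<in> Y_space \<Omega> \<and> u \<in> Z_space \<Omega> \<and>
     (\<forall>e \<in> X_space \<Omega>. \<forall>\<tau> \<in> Y_space \<Omega>. \<forall>v \<in> Z_space \<Omega>.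
        a d e + b1_form \<Omega> e \<sigma> = G e \<and>
        b1_form \<Omega> d \<tau> + b2_form \<Omega> (e, \<tau>) u = H \<tau> \<and>
        b2_form \<Omega> (d, \<sigma>) v = F v)"

definition lin_solution where
  "lin_solution \<Omega> lam \<mu> \<alpha> c0 \<kappa> f g u\<^sub>\<Gamma> r\<^sub>\<Gamma> w =
     saddle_point_solution \<Omega> (\<lambda>d e. a_form \<Omega> lam \<mu> \<alpha> c0 \<kappa> w d e)
       (G_fun \<Omega> g r\<^sub>\<Gamma>) (H_fun \<Omega> u\<^sub>\<Gamma>) (F_fun \<Omega> f)"

definition nonlin_solution where
  "nonlin_solution \<Omega> lam \<mu> \<alpha> c0 \<kappa> f g u\<^sub>\<Gamma> r\<^sub>\<Gamma> =
     saddle_point_solution \<Omega> (\<lambda>d e. a_form \<Omega> lam \<mu> \<alpha> c0 \<kappa> d d e)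
       (G_fun \<Omega> g r\<^sub>\<Gamma>) (H_fun \<Omega> u\<^sub>\<Gamma>) (F_fun \<Omega> f)"

definition J_op where
  "J_op \<Omega> lam \<mu> \<alpha> c0 \<kappa> f g u\<^sub>\<Gamma> r\<^sub>\<Gamma> w =
     (SOME d. \<exists>\<sigma> u. lin_solution \<Omega> lam \<mu> \<alpha> c0 \<kappa> f g u\<^sub>\<Gamma> r\<^sub>\<Gamma> w d \<sigma> u)"

definition J_fixed_point where
  "J_fixed_point \<Omega> lam \<mu> \<alpha> c0 \<kappa> f g u\<^sub>\<Gamma> r\<^sub>\<Gamma> r d \<longleftrightarrow>
     d \<in> W_ball \<Omega> r \<and> pair_ae_eq \<Omega> (J_op \<Omega> lam \<mu> \<alpha> c0 \<kappa> f g u\<^sub>\<Gamma> r\<^sub>\<Gamma> d) d"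

definition sol_ae_eq ::
    "(real ^ 'n) set \<Rightarrow> 'n::finite X_elem \<times> 'n tensor_fld \<times> 'n Z_elem \<Rightarrow>
      'n X_elem \<times> 'n tensor_fld \<times> 'n Z_elem \<Rightarrow> bool" where
  "sol_ae_eq \<Omega> s t \<longleftrightarrow>
     (case s of (d, \<sigma>, u) \<Rightarrow> case t of (d', \<sigma>', u') \<Rightarrow>
        pair_ae_eq \<Omega> d d' \<and> ae_eq \<Omega> \<sigma> \<sigma>' \<and> pair_ae_eq \<Omega> u u')"

definition unique_upto :: "('a \<Rightarrow> 'a \<Rightarrow> bool) \<Rightarrow> ('a \<Rightarrow> bool) \<Rightarrow> bool" where
  "unique_upto R P \<longleftrightarrow> (\<exists>x. P x) \<and> (\<forall>x y. P x \<longrightarrow> P y \<longrightarrow> R x y)"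


section \<open>Constants\<close>

definition inf_sup_b2 :: "(real ^ 'n::finite) set \<Rightarrow> real \<Rightarrow> bool" where
  "inf_sup_b2 \<Omega> \<beta>2 \<longleftrightarrow>
     (\<forall>v \<in> Z_space \<Omega>.
        (SUP et \<in> {et \<in> X_space \<Omega> \<times> Y_space \<Omega>. XY_norm \<Omega> et \<noteq> 0}.
            b2_form \<Omega> et v / XY_norm \<Omega> et) \<ge> \<beta>2 * Z_norm \<Omega> v)"

definition Ca_const :: "nat \<Rightarrow> real \<Rightarrow> real \<Rightarrow> real \<Rightarrow> real \<Rightarrow> real \<Rightarrow> real \<Rightarrow> real" where
  "Ca_const n lam \<mu> \<alpha> c0 \<kappa>2 r = Max {2 * \<mu> + real n * lam, c0, real n * \<alpha>, \<kappa>2 * r}"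

definition ca_const :: "real \<Rightarrow> real \<Rightarrow> real \<Rightarrow> real" where
  "ca_const \<mu> c0 \<kappa>1 = Min {\<kappa>1, 2 * \<mu>, c0}"

definition gamma2 :: "real \<Rightarrow> real \<Rightarrow> real" where
  "gamma2 Ca ca = (Ca + 2) * (ca + 1 + Ca) / ca"

definition gamma1 :: "real \<Rightarrow> real \<Rightarrow> real \<Rightarrow> real" where
  "gamma1 Ca ca \<beta>2 = (Ca + 1 + \<beta>2 + gamma2 Ca ca)\<^sup>2 / (\<beta>2\<^sup>2 * gamma2 Ca ca)"

definition data_norm :: "(real ^ 'n) set \<Rightarrow> 'n::finite vector_fld \<Rightarrow> 'n scalar_fld \<Rightarrow>
    'n vector_fld set \<Rightarrow> ('n scalar_fld set \<Rightarrow> real) \<Rightarrow> real" where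
  "data_norm \<Omega> f g u\<^sub>\<Gamma> r\<^sub>\<Gamma> =
     L2_norm \<Omega> g + H_mhalf_norm \<Omega> r\<^sub>\<Gamma> + H_half_vec_norm \<Omega> u\<^sub>\<Gamma> + L2_norm \<Omega> f"

end

theory Submission
  imports Defs "HOL-Library.Function_Algebras"
begin

text \<open>
  The linearised problem is a saddle point problem in which the permeability acts only on the pressure.
  Its solution is determined by the strain and the pressure alone: the stress is
  \<open>\<C> d - \<alpha> p \<I>\<close>, and the displacement and the rotation are the multipliers of the second form, which the
  inf-sup condition recovers. So the whole theorem rests on one estimate
  \<open>\<parallel>d\<parallel> \<le> \<gamma>1 \<cdot> data\<close> for the linearised problem (\<open>a_priori_estimate\<close>).

  To see it, test the first equation with the solution. The two coupling terms cancel, and coercivity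
  bounds \<open>ca \<parallel>d\<parallel>\<^sup>2\<close> by the data and the work \<open>\<integral> \<sigma> : d\<close> of the stress. Write \<open>\<sigma>\<close> as a stress that balances the
  load, small by the inf-sup condition, plus a stress in the kernel of the second form; on the kernel
  the second equation replaces the work by the boundary datum. Since the stress is bounded by the strain
  and the pressure through the constitutive law, this is a quadratic inequality for \<open>\<parallel>d\<parallel>\<close>. The permeability enters only
  through its lower bound, so the constant does not depend on the point of linearisation, and a computation
  shows that \<open>\<gamma>1\<close> is large enough (\<open>energy_estimate\<close>).

  The rest follows. The difference of the solutions for two points of linearisation solves a
  linearised problem whose only datum is the difference of the permeabilities (\<open>saddle_difference\<close>),
  so \<open>J\<close> is Lipschitz with constant \<open>\<gamma>1\<^sup>2 \<kappa>2 \<cdot> data\<close>, while \<open>J\<close> maps into the ball of radius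
  \<open>\<gamma>1 \<cdot> data\<close>. The two entries of the maximum in the smallness condition guarantee that \<open>J\<close> is a
  contraction and that the ball of radius \<open>r\<close> is invariant.

  Existence for the linearised problem (\<open>linear_problem_solvable\<close>) follows the same splitting: a
  balancing stress is found from the inf-sup condition, the gradient of a lifting of the boundary
  displacement serves as a particular strain, the Lax-Milgram lemma is used on the strains
  orthogonal to the kernel, and the closed range theorem provides the multipliers.

  Most of the work lies in the function spaces. Their elements are representatives, so all Hilbert space
  theory is developed for complete semi-inner products. The choice operators in the definitions of
  gradient and divergence are harmless because weak derivatives are unique almost everywhere
  (\<open>AE_zero_if_test_integrals_zero\<close>), which needs a supply of smooth bump functions; and the normal trace is
  independent of the lifting because test functions are dense in the kernel of the trace
  (\<open>green_row_H10\<close>).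
\<close>

section \<open>Hilbert spaces with a semi-inner product\<close>

text \<open>Pointwise scaling turns spaces of fields into subspaces of a real vector space.\<close>

instantiation "fun" :: (type, scaleR) scaleR
begin

definition scaleR_fun_def: "c *\<^sub>R f = (\<lambda>x. c *\<^sub>R f x)"

instance ..

end

lemma scaleR_fun_apply [simp]: "(c *\<^sub>R f) x = c *\<^sub>R f x"
  by (simp add: scaleR_fun_def)

instance "fun" :: (type, real_vector) real_vector
  by standard (simp_all add: fun_eq_iff scaleR_add_right scaleR_add_left)

text \<open>An inner product of representatives vanishes on every field that is zero almost everywhere, so it is
  only positive semidefinite. What would be an equality in a Hilbert space becomes the statement that a
  difference has seminorm zero.\<close>

definition snorm :: "('a \<Rightarrow> 'a \<Rightarrow> real) \<Rightarrow> 'a \<Rightarrow> real" where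
  "snorm B x = sqrt (B x x)"

definition linear_form_on :: "'a::real_vector set \<Rightarrow> ('a \<Rightarrow> real) \<Rightarrow> bool" where
  "linear_form_on S l \<longleftrightarrow>
     (\<forall>x\<in>S. \<forall>y\<in>S. l (x + y) = l x + l y) \<and> (\<forall>c. \<forall>x\<in>S. l (c *\<^sub>R x) = c * l x)"

lemma linear_form_onI:
  assumes "\<And>x y. x \<in> S \<Longrightarrow> y \<in> S \<Longrightarrow> l (x + y) = l x + l y"
    and "\<And>c x. x \<in> S \<Longrightarrow> l (c *\<^sub>R x) = c * l x"
  shows "linear_form_on S l"
  using assms by (simp add: linear_form_on_def)

lemma linear_form_on_add: "linear_form_on S l \<Longrightarrow> x \<in> S \<Longrightarrow> y \<in> S \<Longrightarrow> l (x + y) = l x + l y"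
  and linear_form_on_scale: "linear_form_on S l \<Longrightarrow> x \<in> S \<Longrightarrow> l (c *\<^sub>R x) = c * l x"
  by (simp_all add: linear_form_on_def)

lemma linear_form_on_zero: "linear_form_on S l \<Longrightarrow> subspace S \<Longrightarrow> l 0 = 0"
  using linear_form_on_scale[of S l 0 0] by (simp add: subspace_0)

lemma linear_form_on_diff:
  assumes "linear_form_on S l" "subspace S" "x \<in> S" "y \<in> S"
  shows "l (x - y) = l x - l y"
  using linear_form_on_add[OF assms(1), of x "(- 1) *\<^sub>R y"] linear_form_on_scale[OF assms(1), of y "- 1"]
    subspace_scale[OF assms(2,4), of "- 1"] assms by simp

lemma linear_form_on_sub: "linear_form_on S l \<Longrightarrow> T \<subseteq> S \<Longrightarrow> linear_form_on T l"
  unfolding linear_form_on_def by blast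

lemma linear_form_on_uminus: "linear_form_on S l \<Longrightarrow> linear_form_on S (\<lambda>x. - l x)"
  by (auto simp: linear_form_on_def)

lemma linear_form_on_plus:
  "linear_form_on S l \<Longrightarrow> linear_form_on S m \<Longrightarrow> linear_form_on S (\<lambda>x. l x + m x)"
  by (auto simp: linear_form_on_def algebra_simps)

lemma linear_form_on_minus:
  "linear_form_on S l \<Longrightarrow> linear_form_on S m \<Longrightarrow> linear_form_on S (\<lambda>x. l x - m x)"
  by (auto simp: linear_form_on_def algebra_simps)

text \<open>This gives both the Cauchy-Schwarz inequality and the first-order condition along a minimising
  sequence. In a seminormed space the leading coefficient can vanish for a nonzero direction.\<close>

lemma discriminant_bound:
  fixes a b c :: real
  assumes "\<And>t. a + 2 * t * b + t\<^sup>2 * c \<ge> 0" and c: "c \<ge> 0"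
  shows "b\<^sup>2 \<le> a * c"
proof (cases "c = 0")
  case True
  have "b = 0"
  proof (rule ccontr)
    assume "b \<noteq> 0"
    then have "a + 2 * (- (a + 1) / (2 * b)) * b = -1" by (simp add: field_simps)
    with assms(1)[of "- (a + 1) / (2 * b)"] True show False by simp
  qed
  then show ?thesis using True by simp
next
  case False
  then have "c > 0" using c by simp
  have "a + 2 * (- b / c) * b + (- b / c)\<^sup>2 * c = a - b\<^sup>2 / c"
    using False by (simp add: power2_eq_square field_simps)
  with assms(1)[of "- b / c"] have "b\<^sup>2 / c \<le> a" by simp
  then show ?thesis using \<open>c > 0\<close> by (simp add: field_simps)
qed

locale semi_inner =
  fixes S :: "'a::real_vector set" and B :: "'a \<Rightarrow> 'a \<Rightarrow> real"
  assumes sub: "subspace S"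
    and lin: "x \<in> S \<Longrightarrow> linear_form_on S (\<lambda>y. B y x)"
    and sym: "x \<in> S \<Longrightarrow> y \<in> S \<Longrightarrow> B x y = B y x"
    and nonneg: "x \<in> S \<Longrightarrow> B x x \<ge> 0"
begin

lemma mem [simp, intro]:
  shows "0 \<in> S" "\<And>x y. x \<in> S \<Longrightarrow> y \<in> S \<Longrightarrow> x + y \<in> S" "\<And>x y. x \<in> S \<Longrightarrow> y \<in> S \<Longrightarrow> x - y \<in> S"
    "\<And>x c. x \<in> S \<Longrightarrow> c *\<^sub>R x \<in> S"
  using sub by (auto simp: subspace_0 subspace_add subspace_diff subspace_scale)

lemma add_left: "x \<in> S \<Longrightarrow> y \<in> S \<Longrightarrow> z \<in> S \<Longrightarrow> B (x + y) z = B x z + B y z"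
  and scale_left: "x \<in> S \<Longrightarrow> z \<in> S \<Longrightarrow> B (c *\<^sub>R x) z = c * B x z"
  and diff_left: "x \<in> S \<Longrightarrow> y \<in> S \<Longrightarrow> z \<in> S \<Longrightarrow> B (x - y) z = B x z - B y z"
  by (simp_all add: linear_form_on_add[OF lin] linear_form_on_scale[OF lin] linear_form_on_diff[OF lin sub])

lemma add_right: "x \<in> S \<Longrightarrow> y \<in> S \<Longrightarrow> z \<in> S \<Longrightarrow> B z (x + y) = B z x + B z y"
  and scale_right: "x \<in> S \<Longrightarrow> z \<in> S \<Longrightarrow> B z (c *\<^sub>R x) = c * B z x"
  and diff_right: "x \<in> S \<Longrightarrow> y \<in> S \<Longrightarrow> z \<in> S \<Longrightarrow> B z (x - y) = B z x - B z y"
  by (simp_all add: sym[of z] add_left scale_left diff_left)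

lemma lin_right: "x \<in> S \<Longrightarrow> linear_form_on S (B x)"
  by (rule linear_form_onI) (simp_all add: add_right scale_right)

lemmas expand = add_left diff_left scale_left add_right diff_right scale_right

lemma snorm_nonneg [simp]: "x \<in> S \<Longrightarrow> snorm B x \<ge> 0"
  by (simp add: snorm_def nonneg)

lemma snorm_sq: "x \<in> S \<Longrightarrow> (snorm B x)\<^sup>2 = B x x"
  by (simp add: snorm_def nonneg)

lemma snorm_zero [simp]: "snorm B 0 = 0"
  using scale_left[of 0 0 0] by (simp add: snorm_def)

lemma Cauchy_Schwarz:
  assumes "x \<in> S" "y \<in> S" shows "\<bar>B x y\<bar> \<le> snorm B x * snorm B y"
proof -
  have "B x x + 2 * t * B x y + t\<^sup>2 * B y y \<ge> 0" for t
    using nonneg[of "x + t *\<^sub>R y"] assms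
    by (simp add: expand sym[of y x] power2_eq_square algebra_simps)
  then have "(B x y)\<^sup>2 \<le> B x x * B y y"
    using assms by (intro discriminant_bound) (auto simp: nonneg)
  also have "\<dots> = (snorm B x * snorm B y)\<^sup>2"
    using assms by (simp add: power_mult_distrib snorm_sq)
  finally show ?thesis
    using assms abs_le_square_iff[of "B x y" "snorm B x * snorm B y"] by simp
qed

lemma snorm_triangle: "x \<in> S \<Longrightarrow> y \<in> S \<Longrightarrow> snorm B (x + y) \<le> snorm B x + snorm B y"
proof (rule power2_le_imp_le)
  assume xy: "x \<in> S" "y \<in> S"
  have "(snorm B (x + y))\<^sup>2 = (snorm B x)\<^sup>2 + 2 * B x y + (snorm B y)\<^sup>2"
    using xy by (simp add: snorm_sq expand sym[of y x])
  also have "\<dots> \<le> (snorm B x + snorm B y)\<^sup>2"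
    using Cauchy_Schwarz[OF xy] by (simp add: power2_sum)
  finally show "(snorm B (x + y))\<^sup>2 \<le> (snorm B x + snorm B y)\<^sup>2" .
qed simp

lemma snorm_scale: "x \<in> S \<Longrightarrow> snorm B (c *\<^sub>R x) = \<bar>c\<bar> * snorm B x"
  by (simp add: snorm_def expand real_sqrt_mult flip: mult.assoc)

lemma snorm_diff_commute: "x \<in> S \<Longrightarrow> y \<in> S \<Longrightarrow> snorm B (x - y) = snorm B (y - x)"
  using snorm_scale[of "x - y" "-1"] by simp

lemma snorm_triangle_diff:
  "x \<in> S \<Longrightarrow> y \<in> S \<Longrightarrow> z \<in> S \<Longrightarrow> snorm B (x - z) \<le> snorm B (x - y) + snorm B (y - z)"
  using snorm_triangle[of "x - y" "y - z"] by simp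

lemma snorm_diff_le: "x \<in> S \<Longrightarrow> y \<in> S \<Longrightarrow> \<bar>snorm B x - snorm B y\<bar> \<le> snorm B (x - y)"
  using snorm_triangle[of "x - y" y] snorm_triangle[of "y - x" x] snorm_diff_commute[of x y]
  by simp

lemma snorm_diff_triangle: "x \<in> S \<Longrightarrow> y \<in> S \<Longrightarrow> snorm B (x - y) \<le> snorm B x + snorm B y"
  using snorm_triangle[of x "(-1) *\<^sub>R y"] snorm_scale[of y "-1"] mem(4)[of y "-1"] by simp

lemma null_left: "x \<in> S \<Longrightarrow> snorm B x = 0 \<Longrightarrow> y \<in> S \<Longrightarrow> B x y = 0"
  using Cauchy_Schwarz[of x y] by simp

lemma tendsto_snorm:
  assumes "\<And>n. X n \<in> S" "x \<in> S" "(\<lambda>n. snorm B (X n - x)) \<longlonglongrightarrow> 0"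
  shows "(\<lambda>n. snorm B (X n)) \<longlonglongrightarrow> snorm B x"
proof -
  have "(\<lambda>n. snorm B (X n) - snorm B x) \<longlonglongrightarrow> 0"
    by (rule Lim_null_comparison[OF _ assms(3)]) (auto intro!: always_eventually snorm_diff_le assms)
  then show ?thesis by (simp add: LIM_zero_iff)
qed

lemma tendsto_form:
  assumes "\<And>n. X n \<in> S" "x \<in> S" "(\<lambda>n. snorm B (X n - x)) \<longlonglongrightarrow> 0"
    and l: "linear_form_on S l" "\<And>x. x \<in> S \<Longrightarrow> \<bar>l x\<bar> \<le> K * snorm B x"
  shows "(\<lambda>n. l (X n)) \<longlonglongrightarrow> l x"
proof -
  have lim: "(\<lambda>n. K * snorm B (X n - x)) \<longlonglongrightarrow> 0"
    using tendsto_mult_right_zero[OF assms(3)] by simp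
  have le: "norm (l (X n) - l x) \<le> K * snorm B (X n - x)" for n
    using l(2)[of "X n - x"] assms sub by (simp add: linear_form_on_diff)
  have "(\<lambda>n. l (X n) - l x) \<longlonglongrightarrow> 0"
    by (rule Lim_null_comparison[OF always_eventually[OF allI[OF le]] lim])
  then show ?thesis by (simp add: LIM_zero_iff)
qed

end

locale semi_hilbert = semi_inner +
  assumes complete: "(\<And>n. X n \<in> S) \<Longrightarrow> (\<And>\<epsilon>. \<epsilon> > 0 \<Longrightarrow> \<exists>N. \<forall>m\<ge>N. \<forall>n\<ge>N. snorm B (X m - X n) < \<epsilon>) \<Longrightarrow>
      \<exists>x\<in>S. (\<lambda>n. snorm B (X n - x)) \<longlonglongrightarrow> 0"
begin

lemma closed_subspace:
  assumes "subspace T" "T \<subseteq> S"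
    and "\<And>X x. (\<And>n. X n \<in> T) \<Longrightarrow> x \<in> S \<Longrightarrow> (\<lambda>n. snorm B (X n - x)) \<longlonglongrightarrow> 0 \<Longrightarrow> x \<in> T"
  shows "semi_hilbert T B"
proof
  show "subspace T" by fact
  show "linear_form_on T (\<lambda>y. B y x)" if "x \<in> T" for x
    using lin linear_form_on_sub assms(2) that by blast
  show "B x y = B y x" "B x x \<ge> 0" if "x \<in> T" "y \<in> T" for x y
    using subsetD[OF assms(2) that(1)] subsetD[OF assms(2) that(2)] sym nonneg by auto
  show "\<exists>x\<in>T. (\<lambda>n. snorm B (X n - x)) \<longlonglongrightarrow> 0"
    if "\<And>n. X n \<in> T" "\<And>\<epsilon>. \<epsilon> > 0 \<Longrightarrow> \<exists>N. \<forall>m\<ge>N. \<forall>n\<ge>N. snorm B (X m - X n) < \<epsilon>" for X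
    using complete[of X] that assms(2,3) by blast
qed

text \<open>The constrained spaces of the saddle point problem arise this way; continuity of the functionals
  makes their common kernel closed.\<close>

lemma kernel_semi_hilbert:
  assumes "\<And>i. i \<in> I \<Longrightarrow> linear_form_on S (l i)"
    and "\<And>i. i \<in> I \<Longrightarrow> \<exists>K. \<forall>x\<in>S. \<bar>l i x\<bar> \<le> K * snorm B x"
  shows "semi_hilbert {x \<in> S. \<forall>i\<in>I. l i x = 0} B"
proof (rule closed_subspace)
  show "subspace {x \<in> S. \<forall>i\<in>I. l i x = 0}"
    using assms(1) sub
    by (auto simp: subspace_def linear_form_on_zero[OF assms(1) sub] linear_form_on_add[OF assms(1)]
        linear_form_on_scale[OF assms(1)])
  fix X x assume X: "\<And>n. X n \<in> {x \<in> S. \<forall>i\<in>I. l i x = 0}" and x: "x \<in> S"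
    and lim: "(\<lambda>n. snorm B (X n - x)) \<longlonglongrightarrow> 0"
  have "l i x = 0" if i: "i \<in> I" for i
  proof -
    obtain K where K: "\<And>x. x \<in> S \<Longrightarrow> \<bar>l i x\<bar> \<le> K * snorm B x" using assms(2)[OF i] by blast
    have "(\<lambda>n. l i (X n)) \<longlonglongrightarrow> l i x"
      using tendsto_form[OF _ x lim assms(1)[OF i] K] X by auto
    then show ?thesis using X i by (simp add: LIMSEQ_const_iff)
  qed
  then show "x \<in> {x \<in> S. \<forall>i\<in>I. l i x = 0}" using x by simp
qed auto

text \<open>Banach's iteration. As limits are unique only up to seminorm zero, so is the fixed point
  equation.\<close>

lemma contraction_fixed_point:
  assumes C: "C \<subseteq> S" "x0 \<in> C"
    and closed: "\<And>X x. (\<And>n. X n \<in> C) \<Longrightarrow> x \<in> S \<Longrightarrow> (\<lambda>n. snorm B (X n - x)) \<longlonglongrightarrow> 0 \<Longrightarrow> x \<in> C"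
    and T: "\<And>x. x \<in> C \<Longrightarrow> T x \<in> C"
    and L: "0 \<le> L" "L < 1"
    and contr: "\<And>x y. x \<in> C \<Longrightarrow> y \<in> C \<Longrightarrow> snorm B (T x - T y) \<le> L * snorm B (x - y)"
  shows "\<exists>x\<in>C. snorm B (T x - x) = 0"
proof -
  define X where "X n = (T ^^ n) x0" for n
  have XC: "X n \<in> C" for n by (induction n) (auto simp: X_def C T)
  have XS: "X n \<in> S" for n using XC C by auto
  have XSuc: "X (Suc n) = T (X n)" for n by (simp add: X_def)
  define D where "D = snorm B (X 1 - X 0)"
  have D0: "D \<ge> 0" unfolding D_def using XS by simp
  have step: "snorm B (X (Suc n) - X n) \<le> L ^ n * D" for n
  proof (induction n)
    case (Suc n)
    have "snorm B (X (Suc (Suc n)) - X (Suc n)) \<le> L * snorm B (X (Suc n) - X n)"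
      unfolding XSuc using XC XSuc contr by metis
    also have "\<dots> \<le> L * (L ^ n * D)" using Suc L by (intro mult_left_mono)
    finally show ?case by simp
  qed (simp add: D_def)
  have tail: "snorm B (X (n + k) - X n) \<le> L ^ n * (1 - L ^ k) / (1 - L) * D" for n k
  proof (induction k)
    case (Suc k)
    have "snorm B (X (n + Suc k) - X n) \<le> snorm B (X (Suc (n + k)) - X (n + k)) + snorm B (X (n + k) - X n)"
      using snorm_triangle_diff[OF XS XS XS] by simp
    also have "\<dots> \<le> L ^ (n + k) * D + L ^ n * (1 - L ^ k) / (1 - L) * D"
      using step Suc by (intro add_mono)
    also have "\<dots> = L ^ n * (1 - L ^ Suc k) / (1 - L) * D"
      using L by (simp add: field_simps power_add)
    finally show ?case .
  qed simp
  have tail': "snorm B (X m - X n) \<le> L ^ n * (D / (1 - L))" if "n \<le> m" for m n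
  proof -
    have "snorm B (X m - X n) \<le> L ^ n * (1 - L ^ (m - n)) / (1 - L) * D"
      using tail[of n "m - n"] that by simp
    also have "\<dots> = L ^ n * (D / (1 - L)) * (1 - L ^ (m - n))" by simp
    also have "\<dots> \<le> L ^ n * (D / (1 - L)) * 1"
      using L D0 by (intro mult_left_mono) auto
    finally show ?thesis by simp
  qed
  have lim0: "(\<lambda>n. L ^ n * (D / (1 - L))) \<longlonglongrightarrow> 0"
    using L by (intro tendsto_mult_left_zero LIMSEQ_power_zero) auto
  have "\<exists>x\<in>S. (\<lambda>n. snorm B (X n - x)) \<longlonglongrightarrow> 0"
  proof (rule complete)
    fix \<epsilon> :: real assume "\<epsilon> > 0"
    then obtain N where N: "\<And>n. n \<ge> N \<Longrightarrow> L ^ n * (D / (1 - L)) < \<epsilon>"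
      using order_tendstoD(2)[OF lim0, of \<epsilon>] by (auto simp: eventually_sequentially)
    have "snorm B (X m - X n) < \<epsilon>" if "m \<ge> N" "n \<ge> N" for m n
      using tail'[of n m] tail'[of m n] N[OF that(1)] N[OF that(2)] snorm_diff_commute[of "X m" "X n"] XS
      by (cases "n \<le> m") auto
    then show "\<exists>N. \<forall>m\<ge>N. \<forall>n\<ge>N. snorm B (X m - X n) < \<epsilon>" by blast
  qed (rule XS)
  then obtain x where x: "x \<in> S" and lim: "(\<lambda>n. snorm B (X n - x)) \<longlonglongrightarrow> 0" by blast
  have xC: "x \<in> C" using closed[OF XC x lim] .
  have "snorm B (T x - x) \<le> L * snorm B (X n - x) + snorm B (X (Suc n) - x)" for n
  proof -
    have "snorm B (T x - x) \<le> snorm B (T x - X (Suc n)) + snorm B (X (Suc n) - x)"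
      using T[OF xC] C x XS by (intro snorm_triangle_diff) auto
    moreover have "snorm B (T x - X (Suc n)) \<le> L * snorm B (X n - x)"
      using contr[OF xC XC, of n] snorm_diff_commute[of x "X n"] x XS by (simp add: XSuc)
    ultimately show ?thesis by simp
  qed
  moreover have "(\<lambda>n. L * snorm B (X n - x) + snorm B (X (Suc n) - x)) \<longlonglongrightarrow> L * 0 + 0"
    by (intro tendsto_intros lim LIMSEQ_Suc)
  ultimately have "snorm B (T x - x) \<le> L * 0 + 0"
    by (intro LIMSEQ_le_const) auto
  moreover have "T x - x \<in> S" using T[OF xC] C x by auto
  ultimately have "snorm B (T x - x) = 0" using snorm_nonneg[of "T x - x"] by linarith
  then show ?thesis using xC by blast
qed

text \<open>A minimising sequence of the energy \<open>B x x - 2 l x\<close> is Cauchy by the parallelogram identity. Almost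
  minimality of its members bounds their residuals by the discriminant, so the limit satisfies the
  equation.\<close>

lemma Riesz_representation:
  assumes l: "linear_form_on S l" and K: "\<And>x. x \<in> S \<Longrightarrow> \<bar>l x\<bar> \<le> K * snorm B x"
  shows "\<exists>z\<in>S. \<forall>x\<in>S. B z x = l x"
proof -
  define J where "J x = B x x - 2 * l x" for x
  have Jge: "J x \<ge> - K\<^sup>2" if "x \<in> S" for x
  proof -
    have "J x \<ge> (snorm B x)\<^sup>2 - 2 * (K * snorm B x)"
      using K[OF that] by (simp add: J_def snorm_sq that)
    moreover have "(snorm B x)\<^sup>2 - 2 * (K * snorm B x) = (snorm B x - K)\<^sup>2 - K\<^sup>2"
      by (simp add: power2_diff)
    ultimately show ?thesis using zero_le_power2[of "snorm B x - K"] by linarith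
  qed
  define m where "m = Inf (J ` S)"
  have m: "m \<le> J x" if "x \<in> S" for x
    unfolding m_def using that Jge by (intro cInf_lower) (auto intro!: bdd_belowI2)
  have "\<exists>x\<in>S. J x < m + 1 / real (Suc n)" for n
  proof -
    have "Inf (J ` S) < m + 1 / real (Suc n)" by (simp add: m_def)
    then show ?thesis using cInf_lessD[of "J ` S"] mem(1) by blast
  qed
  then obtain X where X: "\<And>n. X n \<in> S" "\<And>n. J (X n) < m + 1 / real (Suc n)" by metis
  \<comment> \<open>The parallelogram identity turns almost-minimality into the Cauchy property.\<close>
  have par: "B (x - y) (x - y) = 2 * J x + 2 * J y - 4 * J ((1/2) *\<^sub>R (x + y))" if "x \<in> S" "y \<in> S" for x y
    using that by (simp add: J_def expand linear_form_on_scale[OF l] linear_form_on_add[OF l] algebra_simps)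
  have par': "(snorm B (X i - X j))\<^sup>2 \<le> 2 / real (Suc i) + 2 / real (Suc j)" for i j
    using par[OF X(1)[of i] X(1)[of j]] X(2)[of i] X(2)[of j] m[of "(1/2) *\<^sub>R (X i + X j)"] X(1)
    by (simp add: snorm_sq)
  have "\<exists>z\<in>S. (\<lambda>n. snorm B (X n - z)) \<longlonglongrightarrow> 0"
  proof (rule complete)
    fix \<epsilon> :: real assume "\<epsilon> > 0"
    then have "\<epsilon>\<^sup>2 / 4 > 0" by simp
    then obtain N where N: "1 / real (Suc N) < \<epsilon>\<^sup>2 / 4"
      using reals_Archimedean[of "\<epsilon>\<^sup>2 / 4"] by (auto simp: inverse_eq_divide)
    have "snorm B (X i - X j) < \<epsilon>" if "i \<ge> N" "j \<ge> N" for i j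
    proof -
      have "1 / real (Suc i) \<le> 1 / real (Suc N)" "1 / real (Suc j) \<le> 1 / real (Suc N)"
        using that by (auto intro!: divide_left_mono)
      then have "(snorm B (X i - X j))\<^sup>2 < \<epsilon>\<^sup>2"
        using order_le_less_trans[OF _ N, of "1 / real (Suc i)"]
          order_le_less_trans[OF _ N, of "1 / real (Suc j)"] par'[of i j] by simp
      then show ?thesis using \<open>\<epsilon> > 0\<close> power2_less_imp_less by fastforce
    qed
    then show "\<exists>N. \<forall>m\<ge>N. \<forall>n\<ge>N. snorm B (X m - X n) < \<epsilon>" by blast
  qed (rule X)
  then obtain z where z: "z \<in> S" and lim: "(\<lambda>n. snorm B (X n - z)) \<longlonglongrightarrow> 0" by blast
  have "B z x = l x" if x: "x \<in> S" for x
  proof -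
    have "(B (X n) x - l x)\<^sup>2 \<le> 1 / real (Suc n) * B x x" for n
    proof (rule discriminant_bound)
      fix t
      have "J (X n + t *\<^sub>R x) = J (X n) + 2 * t * (B (X n) x - l x) + t\<^sup>2 * B x x"
        using x X(1)[of n]
        by (simp add: J_def expand linear_form_on_scale[OF l] linear_form_on_add[OF l]
            sym[of x "X n"] power2_eq_square algebra_simps)
      with m[of "X n + t *\<^sub>R x"] X[of n] x
      show "1 / real (Suc n) + 2 * t * (B (X n) x - l x) + t\<^sup>2 * B x x \<ge> 0" by simp
    qed (simp add: nonneg x)
    moreover have "(\<lambda>n. 1 / real (Suc n) * B x x) \<longlonglongrightarrow> 0"
      using tendsto_mult_left_zero[OF LIMSEQ_inverse_real_of_nat, of "B x x"]
      by (simp add: inverse_eq_divide)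
    moreover have "(\<lambda>n. B (X n) x) \<longlonglongrightarrow> B z x"
      by (rule tendsto_form[OF X(1) z lim, where K = "snorm B x"])
        (use lin x Cauchy_Schwarz in \<open>auto simp: mult.commute\<close>)
    then have "(\<lambda>n. (B (X n) x - l x)\<^sup>2) \<longlonglongrightarrow> (B z x - l x)\<^sup>2" by (intro tendsto_intros)
    ultimately have "(B z x - l x)\<^sup>2 \<le> 0"
      using LIMSEQ_le by blast
    then show ?thesis by simp
  qed
  then show ?thesis using z by blast
qed

text \<open>By Riesz' theorem the equation reads \<open>R z = 0\<close> for an affine map \<open>R\<close>, and the damped iteration
  \<open>z - \<rho> R z\<close> contracts.\<close>

lemma Lax_Milgram:
  assumes lin1: "\<And>y. y \<in> S \<Longrightarrow> linear_form_on S (\<lambda>x. a x y)"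
    and lin2: "\<And>x. x \<in> S \<Longrightarrow> linear_form_on S (a x)"
    and bd: "\<And>x y. x \<in> S \<Longrightarrow> y \<in> S \<Longrightarrow> \<bar>a x y\<bar> \<le> M * snorm B x * snorm B y"
    and coer: "c > 0" "\<And>x. x \<in> S \<Longrightarrow> a x x \<ge> c * (snorm B x)\<^sup>2"
    and l: "linear_form_on S l" and K: "\<And>x. x \<in> S \<Longrightarrow> \<bar>l x\<bar> \<le> K * snorm B x"
  shows "\<exists>z\<in>S. \<forall>x\<in>S. a z x = l x"
proof -
  \<comment> \<open>The contraction factor below is real only if the coercivity constant does not exceed the bound.\<close>
  define M' where "M' = max M c"
  have M': "M' > 0" "c \<le> M'" "M \<le> M'" using coer(1) by (auto simp: M'_def)
  have bd': "\<bar>a x y\<bar> \<le> M' * snorm B x * snorm B y" if "x \<in> S" "y \<in> S" for x y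
    using bd[OF that] mult_right_mono[OF M'(3), of "snorm B x * snorm B y"] that by (simp add: mult.assoc)
  have "\<exists>R\<in>S. \<forall>y\<in>S. B R y = a x y - l y" if "x \<in> S" for x
  proof (rule Riesz_representation)
    show "\<bar>a x y - l y\<bar> \<le> (M' * snorm B x + K) * snorm B y" if "y \<in> S" for y
      using bd'[OF \<open>x \<in> S\<close> that] K[OF that] by (simp add: algebra_simps)
  qed (intro linear_form_on_minus lin2 l that)
  then obtain R where R: "\<And>x. x \<in> S \<Longrightarrow> R x \<in> S" "\<And>x y. x \<in> S \<Longrightarrow> y \<in> S \<Longrightarrow> B (R x) y = a x y - l y"
    by metis
  define \<rho> where "\<rho> = c / M'\<^sup>2"
  define L where "L = sqrt (1 - c\<^sup>2 / M'\<^sup>2)"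
  have q: "c\<^sup>2 / M'\<^sup>2 > 0" "c\<^sup>2 / M'\<^sup>2 \<le> 1"
    using M' coer(1) by (auto simp: field_simps intro!: power_mono)
  have "\<exists>x\<in>S. snorm B ((x - \<rho> *\<^sub>R R x) - x) = 0"
  proof (rule contraction_fixed_point)
    show "0 \<in> S" "S \<subseteq> S" by auto
    show "0 \<le> L" "L < 1" using q by (auto simp: L_def)
    show "x - \<rho> *\<^sub>R R x \<in> S" if "x \<in> S" for x using that R by auto
    fix x y assume xy: "x \<in> S" "y \<in> S"
    define u v where "u = x - y" and "v = R x - R y"
    have uv: "u \<in> S" "v \<in> S" using xy R by (auto simp: u_def v_def)
    have Bv: "B v w = a u w" if "w \<in> S" for w
      using that xy R linear_form_on_diff[OF lin1[OF that] sub xy] by (simp add: v_def u_def expand)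
    have "(snorm B v)\<^sup>2 \<le> M' * snorm B u * snorm B v"
      using bd'[OF uv] Bv[OF uv(2)] by (simp add: snorm_sq uv)
    then have v_le: "snorm B v \<le> M' * snorm B u"
      using uv M' mult_right_le_imp_le[of "snorm B v" "snorm B v" "M' * snorm B u"]
      by (cases "snorm B v = 0") (auto simp: power2_eq_square order.strict_iff_order)
    have "(snorm B (u - \<rho> *\<^sub>R v))\<^sup>2 = (snorm B u)\<^sup>2 - 2 * \<rho> * a u u + \<rho>\<^sup>2 * (snorm B v)\<^sup>2"
      using uv Bv[OF uv(1)] sym[OF uv]
      by (simp add: snorm_sq expand power2_eq_square[of \<rho>] algebra_simps)
    also have "\<dots> \<le> (snorm B u)\<^sup>2 - 2 * \<rho> * (c * (snorm B u)\<^sup>2) + \<rho>\<^sup>2 * (M' * snorm B u)\<^sup>2"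
      using coer M' uv v_le
      by (intro add_mono diff_mono mult_left_mono power_mono) (auto simp: \<rho>_def)
    also have "\<dots> = (L * snorm B u)\<^sup>2"
      using q M' by (simp add: L_def \<rho>_def power_mult_distrib field_simps power2_eq_square)
    finally have "snorm B (u - \<rho> *\<^sub>R v) \<le> L * snorm B u"
      by (rule power2_le_imp_le) (use q uv in \<open>simp add: L_def\<close>)
    then show "snorm B ((x - \<rho> *\<^sub>R R x) - (y - \<rho> *\<^sub>R R y)) \<le> L * snorm B (x - y)"
      by (simp add: u_def v_def algebra_simps)
  qed
  then obtain z where z: "z \<in> S" "snorm B ((z - \<rho> *\<^sub>R R z) - z) = 0" by blast
  have "\<rho> > 0" using M' coer(1) by (simp add: \<rho>_def)
  then have "snorm B (R z) = 0"
    using z snorm_scale[OF R(1)[OF z(1)], of "- \<rho>"] by simp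
  then have "a z x = l x" if "x \<in> S" for x
    using null_left[OF R(1)[OF z(1)] _ that] R(2)[OF z(1) that] by simp
  then show ?thesis using z(1) by blast
qed

end

definition prod_form :: "('a \<Rightarrow> 'a \<Rightarrow> real) \<Rightarrow> ('b \<Rightarrow> 'b \<Rightarrow> real) \<Rightarrow> 'a \<times> 'b \<Rightarrow> 'a \<times> 'b \<Rightarrow> real" where
  "prod_form B1 B2 x y = B1 (fst x) (fst y) + B2 (snd x) (snd y)"

lemma snorm_prod: "semi_inner S1 B1 \<Longrightarrow> semi_inner S2 B2 \<Longrightarrow> x \<in> S1 \<times> S2 \<Longrightarrow>
    snorm (prod_form B1 B2) x = sqrt ((snorm B1 (fst x))\<^sup>2 + (snorm B2 (snd x))\<^sup>2)"
  by (auto simp: snorm_def prod_form_def semi_inner.nonneg)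

lemma semi_hilbert_prod:
  fixes B1 :: "'a::real_vector \<Rightarrow> 'a \<Rightarrow> real" and B2 :: "'b::real_vector \<Rightarrow> 'b \<Rightarrow> real"
  assumes "semi_hilbert S1 B1" "semi_hilbert S2 B2"
  shows "semi_hilbert (S1 \<times> S2) (prod_form B1 B2)"
proof -
  interpret S1: semi_hilbert S1 B1 by fact
  interpret S2: semi_hilbert S2 B2 by fact
  note sn = snorm_prod[OF S1.semi_inner_axioms S2.semi_inner_axioms]
  show ?thesis
  proof
    show "subspace (S1 \<times> S2)" using S1.sub S2.sub by (rule subspace_Times)
    show "linear_form_on (S1 \<times> S2) (\<lambda>y. prod_form B1 B2 y x)" if "x \<in> S1 \<times> S2" for x
      using that by (auto intro!: linear_form_onI simp: prod_form_def S1.expand S2.expand algebra_simps)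
    show "prod_form B1 B2 x y = prod_form B1 B2 y x" if "x \<in> S1 \<times> S2" "y \<in> S1 \<times> S2" for x y
      using that S1.sym S2.sym by (auto simp: prod_form_def)
    show "prod_form B1 B2 x x \<ge> 0" if "x \<in> S1 \<times> S2" for x
      using that by (auto simp: prod_form_def S1.nonneg S2.nonneg)
    fix X assume X: "\<And>n::nat. X n \<in> S1 \<times> S2"
      and Cau: "\<And>\<epsilon>. \<epsilon> > 0 \<Longrightarrow> \<exists>N. \<forall>m\<ge>N. \<forall>n\<ge>N. snorm (prod_form B1 B2) (X m - X n) < \<epsilon>"
    have X12: "\<And>n. fst (X n) \<in> S1" "\<And>n. snd (X n) \<in> S2" using X by (auto simp: mem_Times_iff)
    have mem: "X m - X n \<in> S1 \<times> S2" for m n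
      using X12 by (simp add: mem_Times_iff)
    have le: "snorm B1 (fst (X m) - fst (X n)) \<le> snorm (prod_form B1 B2) (X m - X n)"
         "snorm B2 (snd (X m) - snd (X n)) \<le> snorm (prod_form B1 B2) (X m - X n)" for m n
      using sn[OF mem] S1.snorm_nonneg S2.snorm_nonneg X12
      by (auto simp: fst_diff snd_diff real_le_rsqrt)
    obtain x where x: "x \<in> S1" "(\<lambda>n. snorm B1 (fst (X n) - x)) \<longlonglongrightarrow> 0"
      using S1.complete[of "\<lambda>n. fst (X n)"] X12 Cau le(1) order_le_less_trans by meson
    obtain y where y: "y \<in> S2" "(\<lambda>n. snorm B2 (snd (X n) - y)) \<longlonglongrightarrow> 0"
      using S2.complete[of "\<lambda>n. snd (X n)"] X12 Cau le(2) order_le_less_trans by meson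
    have "(\<lambda>n. sqrt ((snorm B1 (fst (X n) - x))\<^sup>2 + (snorm B2 (snd (X n) - y))\<^sup>2)) \<longlonglongrightarrow> sqrt (0\<^sup>2 + 0\<^sup>2)"
      by (intro tendsto_intros x y)
    moreover have "snorm (prod_form B1 B2) (X n - (x, y)) =
        sqrt ((snorm B1 (fst (X n) - x))\<^sup>2 + (snorm B2 (snd (X n) - y))\<^sup>2)" for n
      using sn[of "X n - (x, y)"] X12[of n] x y by (simp add: mem_Times_iff fst_diff snd_diff)
    ultimately have "(\<lambda>n. snorm (prod_form B1 B2) (X n - (x, y))) \<longlonglongrightarrow> 0" by simp
    then show "\<exists>x\<in>S1 \<times> S2. (\<lambda>n. snorm (prod_form B1 B2) (X n - x)) \<longlonglongrightarrow> 0"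
      using x(1) y(1) by blast
  qed
qed

text \<open>The domain of a closed operator is complete in the graph norm. The operator chooses representatives,
  so it is linear only up to elements of seminorm zero.\<close>

lemma semi_hilbert_graph:
  fixes B1 :: "'a::real_vector \<Rightarrow> 'a \<Rightarrow> real" and B2 :: "'b::real_vector \<Rightarrow> 'b \<Rightarrow> real"
  assumes "semi_hilbert S1 B1" "semi_hilbert S2 B2"
    and T: "subspace T" "T \<subseteq> S1"
    and D: "\<And>x. x \<in> T \<Longrightarrow> D x \<in> S2"
    and D_add: "\<And>x y. x \<in> T \<Longrightarrow> y \<in> T \<Longrightarrow> snorm B2 (D (x + y) - (D x + D y)) = 0"
    and D_scale: "\<And>x c. x \<in> T \<Longrightarrow> snorm B2 (D (c *\<^sub>R x) - c *\<^sub>R D x) = 0"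
    and closed: "\<And>X x y. (\<And>n. X n \<in> T) \<Longrightarrow> x \<in> S1 \<Longrightarrow> y \<in> S2 \<Longrightarrow>
       (\<lambda>n. snorm B1 (X n - x)) \<longlonglongrightarrow> 0 \<Longrightarrow> (\<lambda>n. snorm B2 (D (X n) - y)) \<longlonglongrightarrow> 0 \<Longrightarrow>
       x \<in> T \<and> snorm B2 (D x - y) = 0"
  shows "semi_hilbert T (\<lambda>x y. B1 x y + B2 (D x) (D y))"
proof -
  interpret S1: semi_hilbert S1 B1 by fact
  interpret S2: semi_hilbert S2 B2 by fact
  let ?B = "\<lambda>x y. B1 x y + B2 (D x) (D y)"
  have TS: "x \<in> T \<Longrightarrow> x \<in> S1" for x using T by auto
  have Tm: "x \<in> T \<Longrightarrow> y \<in> T \<Longrightarrow> x + y \<in> T" "x \<in> T \<Longrightarrow> y \<in> T \<Longrightarrow> x - y \<in> T" "x \<in> T \<Longrightarrow> c *\<^sub>R x \<in> T" for x y c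
    using T(1) by (auto simp: subspace_add subspace_diff subspace_scale)
  have addB: "B2 (D (x + y)) z = B2 (D x) z + B2 (D y) z" if "x \<in> T" "y \<in> T" "z \<in> S2" for x y z
    using S2.null_left[OF _ D_add[OF that(1,2)] that(3)] that D Tm
    by (simp add: S2.expand)
  have scaleB: "B2 (D (c *\<^sub>R x)) z = c * B2 (D x) z" if "x \<in> T" "z \<in> S2" for x c z
    using S2.null_left[OF _ D_scale[OF that(1)] that(2), of c] that D Tm
    by (simp add: S2.expand)
  have D_diff: "snorm B2 (D (x - y) - (D x - D y)) = 0" if "x \<in> T" "y \<in> T" for x y
  proof -
    have "snorm B2 (D ((x - y) + y) - (D (x - y) + D y)) = 0" using D_add[of "x - y" y] that Tm by blast
    then have "snorm B2 ((D x - D y) - D (x - y)) = 0" by (simp add: algebra_simps)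
    then show ?thesis using S2.snorm_diff_commute[of "D x - D y" "D (x - y)"] that D Tm by simp
  qed
  have sn: "snorm ?B x = sqrt ((snorm B1 x)\<^sup>2 + (snorm B2 (D x))\<^sup>2)" if "x \<in> T" for x
    using that TS D by (simp add: snorm_def S1.nonneg S2.nonneg)
  show ?thesis
  proof
    show "subspace T" by fact
    show "linear_form_on T (\<lambda>y. ?B y x)" if "x \<in> T" for x
      using that TS D by (auto intro!: linear_form_onI simp: addB scaleB S1.expand algebra_simps)
    show "?B x y = ?B y x" if "x \<in> T" "y \<in> T" for x y
      using that TS D S1.sym S2.sym by metis
    show "?B x x \<ge> 0" if "x \<in> T" for x
      using that TS D by (simp add: S1.nonneg S2.nonneg)
    fix X assume X: "\<And>n::nat. X n \<in> T"
      and Cau: "\<And>\<epsilon>. \<epsilon> > 0 \<Longrightarrow> \<exists>N. \<forall>m\<ge>N. \<forall>n\<ge>N. snorm ?B (X m - X n) < \<epsilon>"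
    have le1: "snorm B1 (X m - X n) \<le> snorm ?B (X m - X n)" for m n
      using sn[of "X m - X n"] X Tm TS by (simp add: real_le_rsqrt)
    have le2: "snorm B2 (D (X m) - D (X n)) \<le> snorm ?B (X m - X n)" for m n
    proof -
      have "snorm B2 (D (X m) - D (X n)) \<le> snorm B2 (D (X m - X n))"
        using S2.snorm_diff_le[of "D (X m) - D (X n)" "D (X m - X n)"] D_diff[OF X[of m] X[of n]] X D Tm
          S2.snorm_diff_commute[of "D (X m) - D (X n)" "D (X m - X n)"] by simp
      also have "\<dots> \<le> snorm ?B (X m - X n)" using sn[of "X m - X n"] X Tm TS D by (simp add: real_le_rsqrt)
      finally show ?thesis .
    qed
    obtain x where x: "x \<in> S1" "(\<lambda>n. snorm B1 (X n - x)) \<longlonglongrightarrow> 0"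
      using S1.complete[of "\<lambda>n. X n"] X TS Cau le1 order_le_less_trans by meson
    obtain y where y: "y \<in> S2" "(\<lambda>n. snorm B2 (D (X n) - y)) \<longlonglongrightarrow> 0"
      using S2.complete[of "\<lambda>n. D (X n)"] X D Cau le2 order_le_less_trans by meson
    have xT: "x \<in> T" "snorm B2 (D x - y) = 0" using closed[OF X x(1) y(1) x(2) y(2)] by auto
    have lim2: "(\<lambda>n. snorm B2 (D (X n - x))) \<longlonglongrightarrow> 0"
    proof (rule Lim_null_comparison[OF always_eventually y(2)], rule allI)
      fix n
      have "snorm B2 (D (X n - x)) \<le> snorm B2 (D (X n) - D x)"
        using S2.snorm_diff_le[of "D (X n - x)" "D (X n) - D x"] D_diff[OF X[of n] xT(1)] X D Tm xT by simp
      also have "\<dots> \<le> snorm B2 (D (X n) - y)"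
        using S2.snorm_triangle_diff[of "D (X n)" y "D x"] S2.snorm_diff_commute[of y "D x"] xT X D y by simp
      finally show "norm (snorm B2 (D (X n - x))) \<le> snorm B2 (D (X n) - y)"
        using X xT D Tm by simp
    qed
    have "(\<lambda>n. sqrt ((snorm B1 (X n - x))\<^sup>2 + (snorm B2 (D (X n - x)))\<^sup>2)) \<longlonglongrightarrow> sqrt (0\<^sup>2 + 0\<^sup>2)"
      by (intro tendsto_intros x lim2)
    then have "(\<lambda>n. snorm ?B (X n - x)) \<longlonglongrightarrow> 0" using sn X Tm xT by simp
    then show "\<exists>x\<in>T. (\<lambda>n. snorm ?B (X n - x)) \<longlonglongrightarrow> 0" using xT by blast
  qed
qed

text \<open>The inf-sup condition is stated without a supremum: whatever bounds the functional \<open>b t v\<close> of \<open>t\<close> bounds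
  \<open>\<beta>\<close> times the norm of \<open>v\<close>.\<close>

locale inf_sup_form = Y: semi_hilbert Y BY + Z: semi_hilbert Z BZ
  for Y :: "'a::real_vector set" and BY and Z :: "'b::real_vector set" and BZ +
  fixes b :: "'a \<Rightarrow> 'b \<Rightarrow> real" and \<beta> M :: real
  assumes lin1: "\<And>v. v \<in> Z \<Longrightarrow> linear_form_on Y (\<lambda>t. b t v)"
    and lin2: "\<And>t. t \<in> Y \<Longrightarrow> linear_form_on Z (b t)"
    and bd: "\<And>t v. t \<in> Y \<Longrightarrow> v \<in> Z \<Longrightarrow> \<bar>b t v\<bar> \<le> M * snorm BY t * snorm BZ v"
    and inf_sup: "\<And>v K. v \<in> Z \<Longrightarrow> 0 \<le> K \<Longrightarrow> (\<And>t. t \<in> Y \<Longrightarrow> \<bar>b t v\<bar> \<le> K * snorm BY t) \<Longrightarrow> \<beta> * snorm BZ v \<le> K"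
    and \<beta>: "\<beta> > 0"
begin

text \<open>Let \<open>R v\<close> be the Riesz representative of \<open>b t v\<close> as a functional of \<open>t\<close>. The inf-sup condition bounds \<open>R\<close>
  from below, so \<open>b (R v) w = BY (R v) (R w)\<close> is a coercive form on \<open>Z\<close>, and the Lax-Milgram lemma finds
  a solution in the range of \<open>R\<close>.\<close>

lemma lifted_solution:
  assumes l: "linear_form_on Z l" and K: "\<And>v. v \<in> Z \<Longrightarrow> \<bar>l v\<bar> \<le> K * snorm BZ v"
  obtains t v where "t \<in> Y" "v \<in> Z" "\<And>w. w \<in> Z \<Longrightarrow> b t w = l w" "\<And>s. s \<in> Y \<Longrightarrow> BY t s = b s v"
    "K \<ge> 0 \<Longrightarrow> snorm BY t \<le> K / \<beta>"
proof -
  have "\<exists>t\<in>Y. \<forall>s\<in>Y. BY t s = b s v" if "v \<in> Z" for v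
    by (rule Y.Riesz_representation[OF lin1[OF that], where K = "M * snorm BZ v"])
      (use bd[OF _ that] in \<open>simp add: mult_ac\<close>)
  then obtain R where R: "\<And>v. v \<in> Z \<Longrightarrow> R v \<in> Y" "\<And>v s. v \<in> Z \<Longrightarrow> s \<in> Y \<Longrightarrow> BY (R v) s = b s v"
    by metis
  have low: "\<beta> * snorm BZ v \<le> snorm BY (R v)" if "v \<in> Z" for v
    by (rule inf_sup) (use that R Y.Cauchy_Schwarz[of "R v"] in auto)
  have up: "snorm BY (R v) \<le> M * snorm BZ v" if "v \<in> Z" for v
  proof -
    have "snorm BY (R v) * snorm BY (R v) \<le> (M * snorm BZ v) * snorm BY (R v)"
      using bd[OF R(1)[OF that] that] R(2)[OF that R(1)[OF that]] Y.snorm_sq[OF R(1)[OF that]]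
      by (simp add: power2_eq_square mult_ac)
    moreover have "0 \<le> M * snorm BZ v" if *: "snorm BY (R v) = 0"
    proof -
      have "snorm BZ v \<le> 0" using low[OF \<open>v \<in> Z\<close>] * \<beta> by (simp add: mult_le_0_iff)
      then show ?thesis using Z.snorm_nonneg[OF \<open>v \<in> Z\<close>] by simp
    qed
    ultimately show ?thesis using Y.snorm_nonneg[OF R(1)[OF that]]
      by (cases "snorm BY (R v) = 0") auto
  qed
  have "\<exists>v\<in>Z. \<forall>w\<in>Z. b (R v) w = l w"
  proof (rule Z.Lax_Milgram[OF _ _ _ _ _ l K])
    show "linear_form_on Z (\<lambda>x. b (R x) y)" if "y \<in> Z" for y
    proof -
      have eq: "b (R x) y = b (R y) x" if "x \<in> Z" for x
        using R(2)[OF that R(1)[OF \<open>y \<in> Z\<close>]] R(2)[OF \<open>y \<in> Z\<close> R(1)[OF that]] Y.sym[OF R(1) R(1)] that \<open>y \<in> Z\<close> by simp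
      show ?thesis
        using lin2[OF R(1)[OF that]] Z.mem by (auto simp: linear_form_on_def eq)
    qed
    show "linear_form_on Z (b (R x))" if "x \<in> Z" for x using lin2 R(1) that by blast
    show "\<beta>\<^sup>2 > 0" using \<beta> by simp
    show "b (R x) x \<ge> \<beta>\<^sup>2 * (snorm BZ x)\<^sup>2" if "x \<in> Z" for x
    proof -
      have "(\<beta> * snorm BZ x)\<^sup>2 \<le> (snorm BY (R x))\<^sup>2"
        using low[OF that] \<beta> Z.snorm_nonneg[OF that] by (intro power_mono) auto
      then show ?thesis using R(2)[OF that R(1)[OF that]] Y.snorm_sq[OF R(1)[OF that]]
        by (simp add: power_mult_distrib)
    qed
    show "\<bar>b (R x) y\<bar> \<le> (\<bar>M\<bar> * \<bar>M\<bar>) * snorm BZ x * snorm BZ y" if "x \<in> Z" "y \<in> Z" for x y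
    proof -
      have "\<bar>b (R x) y\<bar> \<le> M * snorm BY (R x) * snorm BZ y" using bd[OF R(1)[OF that(1)] that(2)] .
      also have "\<dots> \<le> \<bar>M\<bar> * snorm BY (R x) * snorm BZ y"
        using R that by (intro mult_right_mono) auto
      also have "\<dots> \<le> \<bar>M\<bar> * (\<bar>M\<bar> * snorm BZ x) * snorm BZ y"
        using R that up[OF that(1)] order_trans[OF up[OF that(1)] mult_right_mono[of M "\<bar>M\<bar>" "snorm BZ x"]]
        by (intro mult_right_mono mult_left_mono) auto
      finally show ?thesis by (simp add: mult_ac)
    qed
  qed
  then obtain v where v: "v \<in> Z" "\<And>w. w \<in> Z \<Longrightarrow> b (R v) w = l w" by blast
  have "snorm BY (R v) \<le> K / \<beta>" if "K \<ge> 0"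
  proof -
    have "(snorm BY (R v))\<^sup>2 = l v" using v R Y.snorm_sq by simp
    also have "\<dots> \<le> K * snorm BZ v" using K[OF v(1)] by simp
    also have "\<dots> \<le> K * (snorm BY (R v) / \<beta>)"
      using low[OF v(1)] \<beta> that by (intro mult_left_mono) (auto simp: field_simps)
    finally have "snorm BY (R v) * snorm BY (R v) \<le> (K / \<beta>) * snorm BY (R v)"
      by (simp add: power2_eq_square)
    then show ?thesis using R(1)[OF v(1)] \<beta> that mult_right_le_imp_le[of "snorm BY (R v)" "snorm BY (R v)" "K / \<beta>"]
      by (cases "snorm BY (R v) = 0") (auto simp: order.strict_iff_order)
  qed
  then show thesis using that[of "R v" v] v R by blast
qed

text \<open>Compare the representative \<open>r\<close> of \<open>l\<close> with the element \<open>t\<close> of the range of \<open>R\<close> for which \<open>b t = b r\<close>.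
  Their difference lies in the kernel of \<open>b\<close>, on which \<open>l\<close> vanishes and to which \<open>t\<close> is orthogonal, so it is
  orthogonal to itself.\<close>

lemma closed_range:
  assumes l: "linear_form_on Y l" and K: "\<And>t. t \<in> Y \<Longrightarrow> \<bar>l t\<bar> \<le> K * snorm BY t"
    and ker: "\<And>t. t \<in> Y \<Longrightarrow> (\<And>v. v \<in> Z \<Longrightarrow> b t v = 0) \<Longrightarrow> l t = 0"
  shows "\<exists>v\<in>Z. \<forall>t\<in>Y. b t v = l t"
proof -
  obtain r where r: "r \<in> Y" "\<And>t. t \<in> Y \<Longrightarrow> BY r t = l t" using Y.Riesz_representation[OF l K] by blast
  have *: "\<bar>b r v\<bar> \<le> (M * snorm BY r) * snorm BZ v" if "v \<in> Z" for v
    using bd[OF r(1) that] by simp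
  obtain t v where t: "t \<in> Y" "v \<in> Z" "\<And>w. w \<in> Z \<Longrightarrow> b t w = b r w" "\<And>s. s \<in> Y \<Longrightarrow> BY t s = b s v"
    using lifted_solution[OF lin2[OF r(1)] *] by metis
  define d where "d = r - t"
  have d: "d \<in> Y" using r t by (simp add: d_def)
  have bd0: "b d w = 0" if "w \<in> Z" for w
    using linear_form_on_diff[OF lin1[OF that] Y.sub r(1) t(1)] t(3)[OF that] by (simp add: d_def)
  have "BY r d = 0" using r(2)[OF d] ker[OF d bd0] by simp
  moreover have "BY t d = 0" using t(4)[OF d] bd0[OF t(2)] by simp
  ultimately have "snorm BY d = 0" using r t d unfolding snorm_def
    by (simp add: d_def Y.expand)
  then have "BY d s = 0" if "s \<in> Y" for s using Y.null_left d that by blast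
  then have "b s v = l s" if "s \<in> Y" for s
    using that r t by (simp add: d_def Y.expand)
  then show ?thesis using t(2) by blast
qed

end
section \<open>The space of square integrable functions\<close>

definition L2_ip :: "(real ^ 'n) set \<Rightarrow> (real ^ 'n \<Rightarrow> 'b::euclidean_space) \<Rightarrow> (real ^ 'n \<Rightarrow> 'b) \<Rightarrow> real" where
  "L2_ip \<Omega> f g = (LINT x|lebesgue_on \<Omega>. f x \<bullet> g x)"

lemma L2_norm_eq_snorm: "L2_norm \<Omega> f = snorm (L2_ip \<Omega>) f"
  by (simp add: L2_norm_def snorm_def L2_ip_def power2_norm_eq_inner)

lemma L2_measurable: "f \<in> L2 \<Omega> \<Longrightarrow> f \<in> borel_measurable (lebesgue_on \<Omega>)"
  and L2_integrable_norm: "f \<in> L2 \<Omega> \<Longrightarrow> integrable (lebesgue_on \<Omega>) (\<lambda>x. (norm (f x))\<^sup>2)"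
  by (simp_all add: L2_def)

lemma L2_norm_nonneg [simp]: "L2_norm \<Omega> f \<ge> 0"
  by (simp add: L2_norm_def)

lemma L2_integrable_inner:
  fixes f g :: "real ^ 'n \<Rightarrow> 'b::euclidean_space"
  assumes "f \<in> L2 \<Omega>" "g \<in> L2 \<Omega>"
  shows "integrable (lebesgue_on \<Omega>) (\<lambda>x. f x \<bullet> g x)"
proof (rule Bochner_Integration.integrable_bound)
  show "integrable (lebesgue_on \<Omega>) (\<lambda>x. (norm (f x))\<^sup>2 + (norm (g x))\<^sup>2)"
    using assms by (intro Bochner_Integration.integrable_add L2_integrable_norm)
  show "(\<lambda>x. f x \<bullet> g x) \<in> borel_measurable (lebesgue_on \<Omega>)"
    using assms by (intro borel_measurable_inner L2_measurable)
  have "\<bar>f x \<bullet> g x\<bar> \<le> (norm (f x))\<^sup>2 + (norm (g x))\<^sup>2" for x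
  proof -
    have "2 * (norm (f x) * norm (g x)) \<le> (norm (f x))\<^sup>2 + (norm (g x))\<^sup>2"
      using sum_squares_bound[of "norm (f x)" "norm (g x)"] by (simp add: mult.assoc)
    moreover have "0 \<le> norm (f x) * norm (g x)" by simp
    ultimately show ?thesis
      using Cauchy_Schwarz_ineq2[of "f x" "g x"] by linarith
  qed
  then show "AE x in lebesgue_on \<Omega>. norm (f x \<bullet> g x) \<le> norm ((norm (f x))\<^sup>2 + (norm (g x))\<^sup>2)"
    by simp
qed

lemma L2_dominated:
  assumes "f \<in> L2 \<Omega>" "g \<in> borel_measurable (lebesgue_on \<Omega>)"
    and "AE x in lebesgue_on \<Omega>. norm (g x) \<le> c * norm (f x)"
  shows "g \<in> L2 \<Omega>"
proof -
  have "integrable (lebesgue_on \<Omega>) (\<lambda>x. (norm (g x))\<^sup>2)"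
  proof (rule Bochner_Integration.integrable_bound)
    show "integrable (lebesgue_on \<Omega>) (\<lambda>x. c\<^sup>2 * (norm (f x))\<^sup>2)"
      using assms by (intro integrable_mult_right L2_integrable_norm)
    show "(\<lambda>x. (norm (g x))\<^sup>2) \<in> borel_measurable (lebesgue_on \<Omega>)"
      using assms by measurable
    show "AE x in lebesgue_on \<Omega>. norm ((norm (g x))\<^sup>2) \<le> norm (c\<^sup>2 * (norm (f x))\<^sup>2)"
      using assms(3)
    proof eventually_elim
      case (elim x)
      then have "(norm (g x))\<^sup>2 \<le> (c * norm (f x))\<^sup>2" by (intro power_mono) auto
      then show ?case by (simp add: power_mult_distrib)
    qed
  qed
  then show ?thesis using assms by (simp add: L2_def)
qed

lemma L2_bounded_linear:
  assumes "bounded_linear h" "f \<in> L2 \<Omega>"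
  shows "(\<lambda>x. h (f x)) \<in> L2 \<Omega>"
proof -
  obtain K where K: "\<And>x. norm (h x) \<le> K * norm x"
    using bounded_linear.bounded[OF assms(1)] by (auto simp: mult.commute)
  show ?thesis
    by (rule L2_dominated[OF assms(2), of _ K])
      (auto intro!: measurable_compose[OF L2_measurable[OF assms(2)]] borel_measurable_continuous_onI
        linear_continuous_on[OF assms(1)] simp: K)
qed

lemma L2_norm_mono:
  assumes "f \<in> L2 \<Omega>" "g \<in> borel_measurable (lebesgue_on \<Omega>)" "c \<ge> 0"
    and "AE x in lebesgue_on \<Omega>. norm (g x) \<le> c * norm (f x)"
  shows "L2_norm \<Omega> g \<le> c * L2_norm \<Omega> f"
proof -
  have g: "g \<in> L2 \<Omega>" using L2_dominated assms by blast
  have "(LINT x|lebesgue_on \<Omega>. (norm (g x))\<^sup>2) \<le> (LINT x|lebesgue_on \<Omega>. c\<^sup>2 * (norm (f x))\<^sup>2)"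
  proof (rule integral_mono_AE)
    show "AE x in lebesgue_on \<Omega>. (norm (g x))\<^sup>2 \<le> c\<^sup>2 * (norm (f x))\<^sup>2"
      using assms(4)
    proof eventually_elim
      case (elim x)
      then have "(norm (g x))\<^sup>2 \<le> (c * norm (f x))\<^sup>2" by (intro power_mono) auto
      then show ?case by (simp add: power_mult_distrib)
    qed
  qed (use g assms L2_integrable_norm in auto)
  also have "\<dots> = c\<^sup>2 * (LINT x|lebesgue_on \<Omega>. (norm (f x))\<^sup>2)" by simp
  finally have "L2_norm \<Omega> g \<le> sqrt (c\<^sup>2 * (LINT x|lebesgue_on \<Omega>. (norm (f x))\<^sup>2))"
    unfolding L2_norm_def by (rule real_sqrt_le_mono)
  then show ?thesis using assms(3) by (simp add: L2_norm_def real_sqrt_mult)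
qed

lemma L2_subspace: "subspace (L2 \<Omega> :: (real ^ 'n \<Rightarrow> 'b::euclidean_space) set)"
proof (rule subspaceI)
  show "(0 :: real ^ 'n \<Rightarrow> 'b) \<in> L2 \<Omega>" by (simp add: L2_def zero_fun_def)
  fix f g :: "real ^ 'n \<Rightarrow> 'b" assume fg: "f \<in> L2 \<Omega>" "g \<in> L2 \<Omega>"
  show "f + g \<in> L2 \<Omega>"
  proof -
    have "integrable (lebesgue_on \<Omega>) (\<lambda>x. (norm (f x))\<^sup>2 + 2 * (f x \<bullet> g x) + (norm (g x))\<^sup>2)"
      using fg by (intro Bochner_Integration.integrable_add integrable_mult_right
          L2_integrable_norm L2_integrable_inner)
    moreover have "(norm (f x + g x))\<^sup>2 = (norm (f x))\<^sup>2 + 2 * (f x \<bullet> g x) + (norm (g x))\<^sup>2" for x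
      by (simp add: power2_norm_eq_inner inner_simps inner_commute)
    ultimately show ?thesis using fg
      by (auto simp: L2_def plus_fun_def intro!: borel_measurable_add)
  qed
next
  fix f :: "real ^ 'n \<Rightarrow> 'b" and c :: real assume "f \<in> L2 \<Omega>"
  from L2_bounded_linear[OF bounded_linear_scaleR_right this, of c]
  show "c *\<^sub>R f \<in> L2 \<Omega>" by (simp add: scaleR_fun_def)
qed

lemma L2_semi_inner: "semi_inner (L2 \<Omega> :: (real ^ 'n \<Rightarrow> 'b::euclidean_space) set) (L2_ip \<Omega>)"
proof
  show "subspace (L2 \<Omega> :: (real ^ 'n \<Rightarrow> 'b) set)" by (rule L2_subspace)
  show "linear_form_on (L2 \<Omega>) (\<lambda>g. L2_ip \<Omega> g f)" if "f \<in> L2 \<Omega>" for f :: "real ^ 'n \<Rightarrow> 'b"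
    using that by (auto intro!: linear_form_onI simp: L2_ip_def inner_simps L2_integrable_inner)
qed (simp_all add: L2_ip_def inner_commute)

lemmas L2_Cauchy_Schwarz = semi_inner.Cauchy_Schwarz[OF L2_semi_inner, folded L2_norm_eq_snorm]

lemma L2_norm_eq_0_iff:
  assumes "f \<in> L2 \<Omega>" shows "L2_norm \<Omega> f = 0 \<longleftrightarrow> (AE x in lebesgue_on \<Omega>. f x = 0)"
  using integral_nonneg_eq_0_iff_AE[OF L2_integrable_norm[OF assms]] by (simp add: L2_norm_def)

lemma ae_eq_iff_snorm:
  assumes "f \<in> L2 \<Omega>" "g \<in> L2 \<Omega>"
  shows "ae_eq \<Omega> f g \<longleftrightarrow> snorm (L2_ip \<Omega>) (f - g) = 0"
  using L2_norm_eq_0_iff[OF subspace_diff[OF L2_subspace assms]]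
  by (simp add: L2_norm_eq_snorm ae_eq_def)

locale bounded_open =
  fixes \<Omega> :: "(real ^ 'n::finite) set"
  assumes open_Omega: "open \<Omega>" and bounded_Omega: "bounded \<Omega>" and nonempty_Omega: "\<Omega> \<noteq> {}"
begin

lemma lmeasurable_Omega: "\<Omega> \<in> lmeasurable"
  using open_Omega bounded_Omega by (simp add: lmeasurable_open)

lemma Omega_sets: "\<Omega> \<in> sets lebesgue"
  using lmeasurable_Omega by (simp add: fmeasurableD)

sublocale M: finite_measure "lebesgue_on \<Omega>"
  using lmeasurable_Omega by (rule finite_measure_lebesgue_on)

lemma L2_bounded:
  assumes "f \<in> borel_measurable (lebesgue_on \<Omega>)" "\<And>x. x \<in> \<Omega> \<Longrightarrow> norm (f x) \<le> K"
  shows "(f :: real ^ 'n \<Rightarrow> 'b::euclidean_space) \<in> L2 \<Omega>"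
proof -
  have "integrable (lebesgue_on \<Omega>) (\<lambda>x. (norm (f x))\<^sup>2)"
  proof (rule M.integrable_const_bound)
    have "(norm (f x))\<^sup>2 \<le> K\<^sup>2" if "x \<in> \<Omega>" for x using assms(2)[OF that] by (intro power_mono) auto
    then show "AE x in lebesgue_on \<Omega>. norm ((norm (f x))\<^sup>2) \<le> K\<^sup>2"
      by (intro AE_I2) simp
  qed (use assms in measurable)
  then show ?thesis using assms by (simp add: L2_def)
qed

lemma L2_const: "(\<lambda>x. c) \<in> L2 \<Omega>"
  by (rule L2_bounded[of _ "norm c"]) auto

lemma L2_integrable:
  fixes f :: "real ^ 'n \<Rightarrow> 'b::euclidean_space"
  assumes "f \<in> L2 \<Omega>" shows "integrable (lebesgue_on \<Omega>) f"
proof (rule Bochner_Integration.integrable_bound)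
  show "integrable (lebesgue_on \<Omega>) (\<lambda>x. 1 + (norm (f x))\<^sup>2)"
    using L2_integrable_norm[OF assms] by simp
  have "norm (f x) \<le> 1 + (norm (f x))\<^sup>2" for x
  proof -
    have "2 * norm (f x) \<le> 1 + (norm (f x))\<^sup>2" using sum_squares_bound[of 1 "norm (f x)"] by simp
    then show ?thesis using norm_ge_zero[of "f x"] by linarith
  qed
  then show "AE x in lebesgue_on \<Omega>. norm (f x) \<le> norm (1 + (norm (f x))\<^sup>2)" by simp
qed (use assms L2_measurable in auto)

lemma integral_norm_le_L2_norm:
  assumes "f \<in> L2 \<Omega>"
  shows "(LINT x|lebesgue_on \<Omega>. norm (f x)) \<le> L2_norm \<Omega> (\<lambda>x. 1 :: real) * L2_norm \<Omega> f"
proof -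
  have nf: "(\<lambda>x. norm (f x)) \<in> L2 \<Omega>"
    using L2_measurable[OF assms] by (intro L2_dominated[OF assms, of _ 1]) auto
  have "\<bar>L2_ip \<Omega> (\<lambda>x. 1) (\<lambda>x. norm (f x))\<bar> \<le> L2_norm \<Omega> (\<lambda>x. 1 :: real) * L2_norm \<Omega> (\<lambda>x. norm (f x))"
    by (rule L2_Cauchy_Schwarz[OF L2_const nf])
  then show ?thesis by (simp add: L2_ip_def L2_norm_def)
qed

lemma nn_integral_L2:
  assumes "f \<in> L2 \<Omega>"
  shows "(\<integral>\<^sup>+x. ennreal ((norm (f x))\<^sup>2) \<partial>lebesgue_on \<Omega>) = ennreal ((L2_norm \<Omega> f)\<^sup>2)"
  using nn_integral_eq_integral[OF L2_integrable_norm[OF assms]] by (simp add: L2_norm_def)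

text \<open>On a set of finite measure the \<open>L\<^sup>1\<close> norm is controlled by the \<open>L\<^sup>2\<close> norm, so the increments are summable
  in \<open>L\<^sup>1\<close> and therefore absolutely summable at almost every point.\<close>

lemma AE_convergent_of_fast_Cauchy:
  fixes Y :: "nat \<Rightarrow> real ^ 'n \<Rightarrow> 'b::euclidean_space"
  assumes Y: "\<And>k. Y k \<in> L2 \<Omega>"
    and fast: "\<And>k. L2_norm \<Omega> (Y (Suc k) - Y k) \<le> (1/2) ^ k"
  shows "AE x in lebesgue_on \<Omega>. convergent (\<lambda>k. Y k x)"
proof -
  define g where "g k x = norm (Y (Suc k) x - Y k x)" for k x
  define A where "A = L2_norm \<Omega> (\<lambda>x :: real ^ 'n. 1 :: real)"
  have dL2: "Y (Suc k) - Y k \<in> L2 \<Omega>" for k using Y subspace_diff[OF L2_subspace] by blast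
  have gm [measurable]: "g k \<in> borel_measurable (lebesgue_on \<Omega>)" for k
    unfolding g_def using measurable_compose[OF L2_measurable[OF dL2[of k]] borel_measurable_norm] by simp
  have "integrable (lebesgue_on \<Omega>) (g k)" for k
    unfolding g_def using integrable_norm[OF L2_integrable[OF dL2[of k]]] by simp
  then have "(\<integral>\<^sup>+x. ennreal (g k x) \<partial>lebesgue_on \<Omega>) = ennreal (LINT x|lebesgue_on \<Omega>. g k x)" for k
    by (rule nn_integral_eq_integral) (simp add: g_def)
  also have "ennreal (LINT x|lebesgue_on \<Omega>. g k x) \<le> ennreal (A * (1/2) ^ k)" for k
  proof (rule ennreal_leI)
    have "(LINT x|lebesgue_on \<Omega>. g k x) \<le> A * L2_norm \<Omega> (Y (Suc k) - Y k)"
      using integral_norm_le_L2_norm[OF dL2[of k]] by (simp add: g_def A_def)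
    also have "\<dots> \<le> A * (1/2) ^ k" using fast by (intro mult_left_mono) (auto simp: A_def)
    finally show "(LINT x|lebesgue_on \<Omega>. g k x) \<le> A * (1/2) ^ k" .
  qed
  finally have le: "(\<integral>\<^sup>+x. ennreal (g k x) \<partial>lebesgue_on \<Omega>) \<le> ennreal (A * (1/2) ^ k)" for k .
  have "(\<integral>\<^sup>+x. (\<Sum>k. ennreal (g k x)) \<partial>lebesgue_on \<Omega>) = (\<Sum>k. \<integral>\<^sup>+x. ennreal (g k x) \<partial>lebesgue_on \<Omega>)"
    by (rule nn_integral_suminf) measurable
  also have "\<dots> \<le> (\<Sum>k. ennreal (A * (1/2) ^ k))" by (intro suminf_le le) auto
  also have "\<dots> = ennreal (\<Sum>k. A * (1/2) ^ k)"
    by (rule suminf_ennreal2) (auto simp: A_def intro!: summable_mult)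
  also have "\<dots> < \<infinity>" by simp
  finally have "(\<integral>\<^sup>+x. (\<Sum>k. ennreal (g k x)) \<partial>lebesgue_on \<Omega>) \<noteq> \<infinity>" by simp
  then have "AE x in lebesgue_on \<Omega>. (\<Sum>k. ennreal (g k x)) \<noteq> \<infinity>"
    by (intro nn_integral_PInf_AE) measurable
  then show ?thesis
  proof eventually_elim
    case (elim x)
    then have "summable (\<lambda>k. g k x)"
      by (intro summable_suminf_not_top) (auto simp: g_def)
    then have "summable (\<lambda>k. Y (Suc k) x - Y k x)"
      unfolding g_def by (rule summable_norm_cancel)
    then have "convergent (\<lambda>n. \<Sum>k<n. Y (Suc k) x - Y k x)" by (simp add: summable_iff_convergent)
    then have "convergent (\<lambda>n. Y n x - Y 0 x)" by (simp add: sum_lessThan_telescope[of "\<lambda>k. Y k x"])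
    then show ?case using convergent_diff_const_right_iff by blast
  qed
qed

text \<open>Riesz-Fischer: a subsequence converges almost everywhere because its increments are summable
  in \<open>L\<^sup>1\<close>, and Fatou's lemma identifies the pointwise limit as the limit in norm.\<close>

lemma L2_complete:
  fixes X :: "nat \<Rightarrow> real ^ 'n \<Rightarrow> 'b::euclidean_space"
  assumes X: "\<And>n. X n \<in> L2 \<Omega>"
    and Cau: "\<And>\<epsilon>. \<epsilon> > 0 \<Longrightarrow> \<exists>N. \<forall>m\<ge>N. \<forall>n\<ge>N. L2_norm \<Omega> (X m - X n) < \<epsilon>"
  shows "\<exists>f\<in>L2 \<Omega>. (\<lambda>n. L2_norm \<Omega> (X n - f)) \<longlonglongrightarrow> 0"
proof -
  have "\<exists>N. \<forall>m\<ge>N. \<forall>n\<ge>N. L2_norm \<Omega> (X m - X n) < (1/2) ^ k" for k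
    by (rule Cau) simp
  then obtain N where N: "\<And>k m n. m \<ge> N k \<Longrightarrow> n \<ge> N k \<Longrightarrow> L2_norm \<Omega> (X m - X n) < (1/2) ^ k"
    by metis
  \<comment> \<open>The partial sums dominate all earlier thresholds, which makes the subsequence fast.\<close>
  define r where "r k = (\<Sum>i\<le>k. N i)" for k
  have r: "r k \<ge> N i" if "i \<le> k" for i k
    unfolding r_def using that by (intro member_le_sum) auto
  define Y where "Y k = X (r k)" for k
  have Y: "Y k \<in> L2 \<Omega>" for k using X by (simp add: Y_def)
  have [measurable]: "X k \<in> borel_measurable (lebesgue_on \<Omega>)" "Y k \<in> borel_measurable (lebesgue_on \<Omega>)" for k
    using X Y L2_measurable by blast+
  have conv: "AE x in lebesgue_on \<Omega>. convergent (\<lambda>k. Y k x)"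
    by (rule AE_convergent_of_fast_Cauchy[OF Y])
      (use N r in \<open>auto simp: Y_def intro!: less_imp_le\<close>)
  define f where "f x = lim (\<lambda>k. Y k x)" for x
  have fm [measurable]: "f \<in> borel_measurable (lebesgue_on \<Omega>)"
    unfolding f_def by measurable
  have dist: "f - X n \<in> L2 \<Omega> \<and> L2_norm \<Omega> (f - X n) \<le> (1/2) ^ k" if n: "n \<ge> N k" for n k
  proof -
    have "AE x in lebesgue_on \<Omega>. ennreal ((norm (f x - X n x))\<^sup>2) =
        liminf (\<lambda>j. ennreal ((norm (Y j x - X n x))\<^sup>2))"
      using conv
    proof eventually_elim
      case (elim x)
      then have "(\<lambda>k. Y k x) \<longlonglongrightarrow> f x" unfolding f_def by (simp add: convergent_LIMSEQ_iff)
      then have "(\<lambda>j. ennreal ((norm (Y j x - X n x))\<^sup>2)) \<longlonglongrightarrow> ennreal ((norm (f x - X n x))\<^sup>2)"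
        by (intro tendsto_ennrealI tendsto_intros)
      then show ?case using lim_imp_Liminf[OF trivial_limit_sequentially] by metis
    qed
    then have "(\<integral>\<^sup>+x. ennreal ((norm (f x - X n x))\<^sup>2) \<partial>lebesgue_on \<Omega>) =
        (\<integral>\<^sup>+x. liminf (\<lambda>j. ennreal ((norm (Y j x - X n x))\<^sup>2)) \<partial>lebesgue_on \<Omega>)"
      by (rule nn_integral_cong_AE)
    also have "\<dots> \<le> liminf (\<lambda>j. \<integral>\<^sup>+x. ennreal ((norm (Y j x - X n x))\<^sup>2) \<partial>lebesgue_on \<Omega>)"
      by (rule nn_integral_liminf) measurable
    also have "\<dots> \<le> ennreal (((1/2) ^ k)\<^sup>2)"
    proof (rule order_trans[OF Liminf_le_Limsup Limsup_bounded])
      show "\<forall>\<^sub>F j in sequentially. (\<integral>\<^sup>+x. ennreal ((norm (Y j x - X n x))\<^sup>2) \<partial>lebesgue_on \<Omega>) \<le> ennreal (((1/2) ^ k)\<^sup>2)"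
        using eventually_ge_at_top[of k]
      proof eventually_elim
        case (elim j)
        have "L2_norm \<Omega> (Y j - X n) \<le> (1/2) ^ k"
          unfolding Y_def using N[of k "r j" n] n r[OF elim] by simp
        then have "(L2_norm \<Omega> (Y j - X n))\<^sup>2 \<le> ((1/2) ^ k)\<^sup>2" by (intro power_mono) auto
        moreover have "Y j - X n \<in> L2 \<Omega>" using subspace_diff[OF L2_subspace Y X] .
        ultimately show ?case using nn_integral_L2[of "Y j - X n"] by (simp add: ennreal_leI)
      qed
    qed simp
    finally have le: "(\<integral>\<^sup>+x. ennreal ((norm (f x - X n x))\<^sup>2) \<partial>lebesgue_on \<Omega>) \<le> ennreal (((1/2) ^ k)\<^sup>2)" .
    then have fin: "(\<integral>\<^sup>+x. ennreal ((norm (f x - X n x))\<^sup>2) \<partial>lebesgue_on \<Omega>) < \<infinity>"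
      by (rule order_le_less_trans) simp
    have "integrable (lebesgue_on \<Omega>) (\<lambda>x. (norm (f x - X n x))\<^sup>2)"
      by (rule integrableI_bounded) (use fin in auto)
    then have d: "f - X n \<in> L2 \<Omega>" by (simp add: L2_def fun_diff_def)
    have "(L2_norm \<Omega> (f - X n))\<^sup>2 \<le> ((1/2) ^ k)\<^sup>2"
      using nn_integral_L2[OF d] le by simp
    then have "L2_norm \<Omega> (f - X n) \<le> (1/2) ^ k" by (rule power2_le_imp_le) simp
    with d show ?thesis by blast
  qed
  have f: "f \<in> L2 \<Omega>"
    using subspace_add[OF L2_subspace conjunct1[OF dist[OF order_refl, of 0]] X[of "N 0"]] by simp
  have "(\<lambda>n. L2_norm \<Omega> (X n - f)) \<longlonglongrightarrow> 0"
  proof (rule LIMSEQ_I)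
    fix \<epsilon> :: real assume "\<epsilon> > 0"
    then obtain k where k: "(1/2 :: real) ^ k < \<epsilon>" using real_arch_pow_inv[of \<epsilon> "1/2"] by auto
    have "L2_norm \<Omega> (X n - f) < \<epsilon>" if "n \<ge> N k" for n
      using dist[OF that] k semi_inner.snorm_diff_commute[OF L2_semi_inner X f, of n]
      by (simp add: L2_norm_eq_snorm)
    then show "\<exists>no. \<forall>n\<ge>no. norm (L2_norm \<Omega> (X n - f) - 0) < \<epsilon>" by auto
  qed
  then show ?thesis using f by blast
qed

lemma L2_semi_hilbert: "semi_hilbert (L2 \<Omega> :: (real ^ 'n \<Rightarrow> 'b::euclidean_space) set) (L2_ip \<Omega>)"
  by (rule semi_hilbert.intro[OF L2_semi_inner])
    (unfold_locales, rule L2_complete[unfolded L2_norm_eq_snorm])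

lemma bounded_linear_transpose: "bounded_linear (transpose :: real ^ 'n ^ 'n \<Rightarrow> real ^ 'n ^ 'n)"
  by (rule linear_conv_bounded_linear[THEN iffD1], rule linearI)
    (simp_all add: transpose_def vec_eq_iff)

text \<open>Skewness means that the bounded operator \<open>\<eta> + \<eta>\<^sup>t\<close> of \<open>\<eta>\<close> vanishes, which is a closed condition.\<close>

lemma L2_skew_semi_hilbert: "semi_hilbert (L2_skew \<Omega>) (L2_ip \<Omega> :: 'n tensor_fld \<Rightarrow> _)"
proof (rule semi_hilbert.closed_subspace[OF L2_semi_hilbert])
  define P where "P \<eta> = (\<lambda>x. \<eta> x + transpose (\<eta> x))" for \<eta> :: "'n tensor_fld"
  have P_bl: "bounded_linear (\<lambda>A :: real ^ 'n ^ 'n. A + transpose A)"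
    by (intro bounded_linear_add bounded_linear_ident bounded_linear_transpose)
  have P_L2: "P \<eta> \<in> L2 \<Omega>" if "\<eta> \<in> L2 \<Omega>" for \<eta>
    unfolding P_def by (rule L2_bounded_linear[OF P_bl that])
  have skew_iff: "\<eta> \<in> L2_skew \<Omega> \<longleftrightarrow> \<eta> \<in> L2 \<Omega> \<and> L2_norm \<Omega> (P \<eta>) = 0" for \<eta>
    using L2_norm_eq_0_iff[OF P_L2, of \<eta>] by (auto simp: L2_skew_def P_def eq_neg_iff_add_eq_0)
  obtain K where K: "K \<ge> 0" "\<And>A :: real ^ 'n ^ 'n. norm (A + transpose A) \<le> K * norm A"
    using bounded_linear.nonneg_bounded[OF P_bl] by (auto simp: mult.commute)
  have P_le: "L2_norm \<Omega> (P \<eta>) \<le> K * L2_norm \<Omega> \<eta>" if "\<eta> \<in> L2 \<Omega>" for \<eta>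
    by (rule L2_norm_mono[OF that]) (use K P_L2[OF that] L2_measurable in \<open>auto simp: P_def\<close>)
  have P_add: "P (\<eta> + \<zeta>) = P \<eta> + P \<zeta>" and P_diff: "P (\<eta> - \<zeta>) = P \<eta> - P \<zeta>"
    and P_scale: "P (c *\<^sub>R \<eta>) = c *\<^sub>R P \<eta>" for \<eta> \<zeta> c
    by (auto simp: P_def fun_eq_iff transpose_def vec_eq_iff scaleR_add_right)
  show "L2_skew \<Omega> \<subseteq> L2 \<Omega>" by (auto simp: L2_skew_def)
  note s = semi_inner.snorm_triangle[OF L2_semi_inner, folded L2_norm_eq_snorm]
    semi_inner.snorm_scale[OF L2_semi_inner, folded L2_norm_eq_snorm]
  show "subspace (L2_skew \<Omega>)"
  proof (rule subspaceI)
    show "0 \<in> L2_skew \<Omega>"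
      by (simp add: L2_skew_def subspace_0[OF L2_subspace] transpose_def zero_vec_def)
    show "\<eta> + \<zeta> \<in> L2_skew \<Omega>" if "\<eta> \<in> L2_skew \<Omega>" "\<zeta> \<in> L2_skew \<Omega>" for \<eta> \<zeta>
      using that s(1)[OF P_L2 P_L2, of \<eta> \<zeta>] L2_norm_nonneg[of \<Omega> "P \<eta> + P \<zeta>"] subspace_add[OF L2_subspace]
      unfolding skew_iff P_add by auto
    show "c *\<^sub>R \<eta> \<in> L2_skew \<Omega>" if "\<eta> \<in> L2_skew \<Omega>" for c \<eta>
      using that s(2)[OF P_L2, of \<eta> c] subspace_scale[OF L2_subspace]
      unfolding skew_iff P_scale by auto
  qed
  fix X and \<eta> :: "'n tensor_fld"
  assume X: "\<And>n. X n \<in> L2_skew \<Omega>" and \<eta>: "\<eta> \<in> L2 \<Omega>"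
    and lim: "(\<lambda>n. snorm (L2_ip \<Omega>) (X n - \<eta>)) \<longlonglongrightarrow> 0"
  have "L2_norm \<Omega> (P \<eta>) \<le> K * L2_norm \<Omega> (X n - \<eta>)" for n
  proof -
    have Xn: "X n \<in> L2 \<Omega>" "L2_norm \<Omega> (P (X n)) = 0" using X[of n] by (auto simp: skew_iff)
    have "L2_norm \<Omega> (P \<eta>) \<le> L2_norm \<Omega> (P (X n - \<eta>))"
      using semi_inner.snorm_diff_le[OF L2_semi_inner P_L2[OF Xn(1)] P_L2[OF \<eta>]] Xn(2)
      by (simp add: P_diff L2_norm_eq_snorm)
    also have "\<dots> \<le> K * L2_norm \<Omega> (X n - \<eta>)"
      using P_le subspace_diff[OF L2_subspace Xn(1) \<eta>] by blast
    finally show ?thesis .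
  qed
  moreover have "(\<lambda>n. K * L2_norm \<Omega> (X n - \<eta>)) \<longlonglongrightarrow> K * 0"
    using lim unfolding L2_norm_eq_snorm by (rule tendsto_mult_left)
  ultimately have "L2_norm \<Omega> (P \<eta>) \<le> K * 0" by (intro LIMSEQ_le_const) auto
  then show "\<eta> \<in> L2_skew \<Omega>" using \<eta> L2_norm_nonneg[of \<Omega> "P \<eta>"] by (simp add: skew_iff order_antisym)
qed

end
section \<open>Smooth bump functions\<close>

text \<open>Differentiation maps this family to itself, which is why \<open>exp (- 1 / t)\<close>, extended by zero, is smooth; in
  terms of \<open>s = 1 / t\<close> the derivative acts on the polynomial factor as below.\<close>

definition flat :: "real poly \<Rightarrow> real \<Rightarrow> real" where
  "flat P t = (if t > 0 then poly P (1 / t) * exp (- 1 / t) else 0)"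

definition flat_deriv :: "real poly \<Rightarrow> real poly" where
  "flat_deriv P = [:0, 0, 1:] * (P - pderiv P)"

lemma poly_div_exp_tendsto_0: "((\<lambda>s. poly P s / exp s) \<longlongrightarrow> (0::real)) at_top"
proof -
  have "((\<lambda>s. \<Sum>i\<le>degree P. coeff P i * (s ^ i / exp s)) \<longlongrightarrow> (\<Sum>i\<le>degree P. coeff P i * (0::real))) at_top"
    by (intro tendsto_sum tendsto_mult tendsto_const tendsto_power_div_exp_0)
  then show ?thesis by (simp add: poly_altdef sum_divide_distrib)
qed

lemma flat_tendsto_0: "(flat P \<longlongrightarrow> 0) (at 0)"
proof -
  have "((\<lambda>t. poly P (inverse t) / exp (inverse t)) \<longlongrightarrow> 0) (at_right (0::real))"
    by (rule filterlim_compose[OF poly_div_exp_tendsto_0 filterlim_inverse_at_top_right])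
  moreover have "poly P (inverse t) / exp (inverse t) = flat P t" if "t > 0" for t
    using that by (simp add: flat_def exp_minus divide_inverse)
  then have "\<forall>\<^sub>F t in at_right 0. poly P (inverse t) / exp (inverse t) = flat P t"
    by (simp add: eventually_at_filter)
  ultimately have "(flat P \<longlongrightarrow> 0) (at_right 0)" by (rule Lim_transform_eventually)
  moreover have "\<forall>\<^sub>F t in at_left 0. 0 = flat P t"
    by (simp add: flat_def eventually_at_filter)
  then have "(flat P \<longlongrightarrow> 0) (at_left 0)"
    by (rule Lim_transform_eventually[OF tendsto_const])
  ultimately show ?thesis by (simp add: filterlim_split_at)
qed

lemma flat_has_derivative: "(flat P has_real_derivative flat (flat_deriv P) t) (at t)"
proof -
  consider "t > 0" | "t < 0" | "t = 0" by linarith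
  then show ?thesis
  proof cases
    case 1
    have "((\<lambda>t. poly P (1 / t) * exp (- 1 / t)) has_real_derivative
        (poly (pderiv P) (1 / t) * (- 1 / t\<^sup>2)) * exp (- 1 / t) + poly P (1 / t) * (exp (- 1 / t) * (1 / t\<^sup>2))) (at t)"
      using 1 by (auto intro!: derivative_eq_intros poly_DERIV[THEN DERIV_chain2] simp: power2_eq_square field_simps)
    moreover have "(poly (pderiv P) (1 / t) * (- 1 / t\<^sup>2)) * exp (- 1 / t)
        + poly P (1 / t) * (exp (- 1 / t) * (1 / t\<^sup>2)) = flat (flat_deriv P) t"
      using 1 by (simp add: flat_def flat_deriv_def power2_eq_square field_simps)
    ultimately have *: "((\<lambda>t. poly P (1 / t) * exp (- 1 / t)) has_real_derivative flat (flat_deriv P) t) (at t)"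
      by simp
    show ?thesis
      by (rule DERIV_cong_ev[THEN iffD1, OF refl _ refl *])
        (use eventually_nhds_in_open[of "{0<..}" t] 1 in \<open>auto elim!: eventually_mono simp: flat_def\<close>)
  next
    case 2
    have *: "((\<lambda>t. 0) has_real_derivative flat (flat_deriv P) t) (at t)" using 2 by (simp add: flat_def)
    show ?thesis
      by (rule DERIV_cong_ev[THEN iffD1, OF refl _ refl *])
        (use eventually_nhds_in_open[of "{..<0}" t] 2 in \<open>auto elim!: eventually_mono simp: flat_def\<close>)
  next
    case 3
    \<comment> \<open>At the origin the difference quotient is again a flat function.\<close>
    have "(\<lambda>h. (flat P (0 + h) - flat P 0) / h) = flat ([:0, 1:] * P)"
      by (auto simp: flat_def fun_eq_iff)
    then show ?thesis using 3 flat_tendsto_0[of "[:0, 1:] * P"]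
      by (simp add: DERIV_def flat_def)
  qed
qed

text \<open>Differentiable functions whose partial derivatives stay in the same set have derivatives of all orders, so
  no bookkeeping of orders is needed.\<close>

inductive_set smooth_algebra :: "'n::finite scalar_fld set" where
  const: "(\<lambda>x. c) \<in> smooth_algebra"
| flat: "(\<lambda>x. flat P (a + s * x $ i)) \<in> smooth_algebra"
| add: "f \<in> smooth_algebra \<Longrightarrow> g \<in> smooth_algebra \<Longrightarrow> (\<lambda>x. f x + g x) \<in> smooth_algebra"
| mult: "f \<in> smooth_algebra \<Longrightarrow> g \<in> smooth_algebra \<Longrightarrow> (\<lambda>x. f x * g x) \<in> smooth_algebra"

lemma partial_eqI: "(\<And>x. (f has_derivative f' x) (at x)) \<Longrightarrow> partial j f = (\<lambda>x. f' x (axis j 1))"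
proof (rule ext)
  fix x assume "\<And>x. (f has_derivative f' x) (at x)"
  then show "partial j f x = f' x (axis j 1)"
    using frechet_derivative_at[of f "f' x" x] by (simp add: partial_def)
qed

lemma has_derivative_frechet: "f differentiable (at x) \<Longrightarrow> (f has_derivative frechet_derivative f (at x)) (at x)"
  using frechet_derivative_works by blast

lemma partial_add:
  assumes "\<And>x. f differentiable (at x)" "\<And>x. g differentiable (at x)"
  shows "partial j (\<lambda>x. f x + g x) = (\<lambda>x. partial j f x + partial j g x)"
  by (subst partial_eqI[OF has_derivative_add[OF assms[THEN has_derivative_frechet]]])
    (simp add: partial_def)

lemma partial_mult:
  assumes "\<And>x. f differentiable (at x)" "\<And>x. g differentiable (at x)"
  shows "partial j (\<lambda>x. f x * g x) = (\<lambda>x. f x * partial j g x + partial j f x * g x)"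
  by (subst partial_eqI[OF has_derivative_mult[OF assms[THEN has_derivative_frechet]]])
    (simp add: partial_def)

lemma smooth_algebra_partial:
  fixes f :: "'n::finite scalar_fld"
  assumes "f \<in> smooth_algebra"
  shows "(\<forall>x. f differentiable (at x)) \<and> (\<forall>j. partial j f \<in> smooth_algebra)"
  using assms
proof induction
  case (const c)
  have "partial j (\<lambda>x :: real ^ 'n. c) = (\<lambda>x. 0)" for j by (rule partial_eqI) simp
  then show ?case by (auto intro: smooth_algebra.const)
next
  case (flat P a s i)
  have der: "((\<lambda>x. flat P (a + s * x $ i)) has_derivative
      (\<lambda>h. (s * h $ i) * flat (flat_deriv P) (a + s * x $ i))) (at x)" for x :: "real ^ 'n"
  proof -
    have "((\<lambda>x :: real ^ 'n. a + s * x $ i) has_derivative (\<lambda>h. s * h $ i)) (at x)"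
      by (auto intro!: derivative_eq_intros bounded_linear_imp_has_derivative[OF bounded_linear_vec_nth])
    from has_derivative_compose[OF this
        flat_has_derivative[of P "a + s * x $ i", unfolded has_field_derivative_def]]
    show ?thesis by (simp add: mult.commute)
  qed
  have "partial j (\<lambda>x. flat P (a + s * x $ i)) =
      (\<lambda>x. (s * (axis j 1 :: real ^ 'n) $ i) * flat (flat_deriv P) (a + s * x $ i))" for j
    by (rule partial_eqI) (rule der)
  then show ?case using der
    by (auto simp: differentiable_def intro: smooth_algebra.mult smooth_algebra.const smooth_algebra.flat)
next
  case (add f g)
  then show ?case
    by (auto simp: partial_add intro: smooth_algebra.add)
next
  case (mult f g)
  then have "(\<lambda>x. f x * partial j g x + partial j f x * g x) \<in> smooth_algebra" for j
    by (intro smooth_algebra.add smooth_algebra.mult) auto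
  then show ?case
    using mult by (simp add: partial_mult)
qed

lemma smooth_algebra_times_cont_diff: "f \<in> smooth_algebra \<Longrightarrow> times_cont_diff k f"
proof (induction k arbitrary: f)
  case 0
  then show ?case
    using smooth_algebra_partial[OF 0] by (auto simp: continuous_on_eq_continuous_at differentiable_imp_continuous_within)
next
  case (Suc k)
  then show ?case using smooth_algebra_partial[OF Suc.prems] by simp
qed

text \<open>As \<open>m\<close> grows, these smooth functions increase to the indicator function of the open box.\<close>

definition box_bump :: "real ^ 'n::finite \<Rightarrow> real ^ 'n \<Rightarrow> real \<Rightarrow> 'n scalar_fld" where
  "box_bump a b m x = (\<Prod>i\<in>UNIV. flat 1 (- (m * a $ i) + m * x $ i) * flat 1 (m * b $ i + (- m) * x $ i))"

lemma box_bump_smooth: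
  fixes a b :: "real ^ 'n::finite" shows "box_bump a b m \<in> smooth_algebra"
proof -
  have "finite A \<Longrightarrow> (\<lambda>x :: real ^ 'n. \<Prod>i\<in>A. flat 1 (- (m * a $ i) + m * x $ i) * flat 1 (m * b $ i + (- m) * x $ i))
      \<in> smooth_algebra" for A :: "'n set"
  proof (induction A rule: finite_induct)
    case empty
    show ?case using smooth_algebra.const[of 1] by simp
  next
    case (insert i A)
    then show ?case
      unfolding prod.insert[OF insert.hyps]
      by (intro smooth_algebra.mult smooth_algebra.flat)
  qed
  then show ?thesis by (simp add: box_bump_def[abs_def])
qed

lemma flat_1_nonneg: "0 \<le> flat 1 t" and flat_1_le_1: "flat 1 t \<le> 1"
  by (auto simp: flat_def)

lemma box_bump_nonneg: "0 \<le> box_bump a b m x" and box_bump_le_1: "box_bump a b m x \<le> 1"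
  by (auto simp: box_bump_def intro!: prod_nonneg prod_le_1 mult_nonneg_nonneg mult_le_one flat_1_nonneg flat_1_le_1)

lemma box_bump_outside: "m > 0 \<Longrightarrow> x \<notin> box a b \<Longrightarrow> box_bump a b m x = 0"
proof -
  assume m: "m > 0" and "x \<notin> box a b"
  then obtain i where "\<not> a $ i < x $ i \<or> \<not> x $ i < b $ i" by (auto simp: mem_box_cart)
  then have "- (m * a $ i) + m * x $ i \<le> 0 \<or> m * b $ i + (- m) * x $ i \<le> 0"
    using m by (auto simp: not_less)
  then have "flat 1 (- (m * a $ i) + m * x $ i) * flat 1 (m * b $ i + (- m) * x $ i) = 0"
    by (auto simp: flat_def)
  then show ?thesis unfolding box_bump_def by (intro prod_zero) auto
qed

lemma flat_1_tendsto_1: "t > 0 \<Longrightarrow> (\<lambda>k. flat 1 (real (Suc k) * t)) \<longlonglongrightarrow> 1"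
proof -
  assume t: "t > 0"
  have "(\<lambda>k. exp (- (1 / t) * (1 / real (Suc k)))) \<longlonglongrightarrow> exp (- (1 / t) * 0)"
    using LIMSEQ_inverse_real_of_nat by (intro tendsto_intros) (simp add: inverse_eq_divide)
  moreover have "flat 1 (real (Suc k) * t) = exp (- (1 / t) * (1 / real (Suc k)))" for k
  proof -
    have "real (Suc k) * t > 0" using t by simp
    moreover have "- 1 / (real (Suc k) * t) = - (1 / t) * (1 / real (Suc k))" by (simp add: mult.commute)
    ultimately show ?thesis by (simp add: flat_def del: of_nat_Suc)
  qed
  ultimately show ?thesis by simp
qed

lemma box_bump_tendsto:
  fixes a b x :: "real ^ 'n::finite" shows "(\<lambda>k. box_bump a b (real (Suc k)) x) \<longlonglongrightarrow> indicator (box a b) x"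
proof (cases "x \<in> box a b")
  case True
  then have ab: "x $ i - a $ i > 0" "b $ i - x $ i > 0" for i by (auto simp: mem_box_cart)
  have "(\<lambda>k. \<Prod>i\<in>UNIV. flat 1 (real (Suc k) * (x $ i - a $ i)) * flat 1 (real (Suc k) * (b $ i - x $ i)))
      \<longlonglongrightarrow> (\<Prod>i\<in>(UNIV :: 'n set). 1 * 1)"
    by (intro tendsto_prod tendsto_mult flat_1_tendsto_1 ab)
  then show ?thesis using True by (simp add: box_bump_def algebra_simps)
next
  case False
  then show ?thesis by (simp add: box_bump_outside)
qed

lemma box_bump_test_function:
  assumes "cbox a b \<subseteq> \<Omega>" "m > 0" shows "box_bump a b m \<in> test_functions \<Omega>"
proof -
  have "{x. box_bump a b m x \<noteq> 0} \<subseteq> cbox a b"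
    using box_bump_outside[OF assms(2)] box_subset_cbox by blast
  then have "closure {x. box_bump a b m x \<noteq> 0} \<subseteq> cbox a b"
    by (rule closure_minimal[OF _ closed_cbox])
  then show ?thesis
    unfolding test_functions_def using assms smooth_algebra_times_cont_diff[OF box_bump_smooth]
    by (auto simp: compact_eq_bounded_closed intro: bounded_subset[OF bounded_cbox])
qed


section \<open>Test functions\<close>

lemma test_functions_differentiable:
  assumes "\<phi> \<in> test_functions \<Omega>"
  shows "\<phi> differentiable (at x)" "continuous_on UNIV \<phi>" "continuous_on UNIV (partial j \<phi>)"
proof -
  have *: "times_cont_diff k \<phi>" for k using assms by (simp add: test_functions_def)
  from *[of 0] *[of "Suc 0"] show "\<phi> differentiable (at x)" "continuous_on UNIV \<phi>" "continuous_on UNIV (partial j \<phi>)"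
    by auto
qed

lemma zero_test_function: "(\<lambda>x. 0) \<in> test_functions \<Omega>"
  by (simp add: test_functions_def smooth_algebra_times_cont_diff[OF smooth_algebra.const])

lemma test_functions_support:
  assumes "\<phi> \<in> test_functions \<Omega>"
  obtains K where "compact K" "K \<subseteq> \<Omega>" "\<And>x. x \<notin> K \<Longrightarrow> \<phi> x = 0" "\<And>j x. x \<notin> K \<Longrightarrow> partial j \<phi> x = 0"
proof (rule that[of "closure {x. \<phi> x \<noteq> 0}"])
  let ?K = "closure {x. \<phi> x \<noteq> 0}"
  show "compact ?K" "?K \<subseteq> \<Omega>" using assms by (auto simp: test_functions_def)
  show z: "\<phi> x = 0" if "x \<notin> ?K" for x using closure_subset[of "{x. \<phi> x \<noteq> 0}"] that by blast
  show "partial j \<phi> x = 0" if "x \<notin> ?K" for j x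
  proof -
    have "((\<lambda>x. 0) has_derivative (\<lambda>h. 0)) (at x)" by simp
    then have "(\<phi> has_derivative (\<lambda>h. 0)) (at x)"
    proof (rule has_derivative_transform_within_open)
      show "open (- ?K)" by (rule open_Compl[OF closed_closure])
      show "x \<in> - ?K" using that by blast
      show "0 = \<phi> y" if "y \<in> - ?K" for y using z[OF ComplD[OF that]] by (rule sym)
    qed
    then have "frechet_derivative \<phi> (at x) = (\<lambda>h. 0)" by (rule frechet_derivative_at[symmetric])
    then show ?thesis by (simp add: partial_def)
  qed
qed

lemma MVT_partial:
  assumes "\<And>x. f differentiable (at x)" "h > 0"
  shows "\<exists>t. 0 < t \<and> t < h \<and> f (x + h *\<^sub>R axis j 1) - f x = h * partial j f (x + t *\<^sub>R axis j 1)"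
proof -
  have "((\<lambda>t. f (x + t *\<^sub>R axis j 1)) has_real_derivative partial j f (x + t *\<^sub>R axis j 1)) (at t)" for t
  proof -
    let ?D = "frechet_derivative f (at (x + t *\<^sub>R axis j 1))"
    have lin: "linear ?D" using assms(1) by (rule linear_frechet_derivative)
    have "((\<lambda>t. x + t *\<^sub>R axis j 1) has_derivative (\<lambda>s. s *\<^sub>R axis j 1)) (at t)"
      by (auto intro!: derivative_eq_intros)
    from has_derivative_compose[OF this has_derivative_frechet[OF assms(1)]]
    have "((\<lambda>t. f (x + t *\<^sub>R axis j 1)) has_derivative (\<lambda>s. ?D (s *\<^sub>R axis j 1))) (at t)" .
    moreover have "(\<lambda>s. ?D (s *\<^sub>R axis j 1)) = (*) (partial j f (x + t *\<^sub>R axis j 1))"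
      by (simp add: fun_eq_iff linear_scale[OF lin] partial_def mult.commute)
    ultimately show ?thesis by (simp add: has_field_derivative_def)
  qed
  from MVT2[OF assms(2), of "\<lambda>t. f (x + t *\<^sub>R axis j 1)", OF this] show ?thesis by auto
qed

text \<open>The integral of a difference quotient vanishes by translation invariance; dominated
  convergence passes to the derivative.\<close>

lemma integral_partial_eq_0:
  fixes f :: "'n::finite scalar_fld"
  assumes diff: "\<And>x. f differentiable (at x)" and cont: "continuous_on UNIV (partial j f)"
    and R: "\<And>x. f x \<noteq> 0 \<Longrightarrow> norm x \<le> R"
  shows "(LINT x|lborel. partial j f x) = 0"
proof -
  define e :: "real ^ 'n" where "e = axis j 1"
  have norm_e: "norm e = 1" by (simp add: e_def)
  define h where "h n = 1 / real (Suc n)" for n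
  have h: "0 < h n" "h n \<le> 1" for n by (auto simp: h_def)
  have hlim: "h \<longlonglongrightarrow> 0" unfolding h_def using LIMSEQ_inverse_real_of_nat by (simp add: inverse_eq_divide)
  have cf: "continuous_on UNIV f"
    using diff by (auto simp: continuous_on_eq_continuous_at differentiable_imp_continuous_within)
  have [measurable]: "f \<in> borel_measurable borel" "partial j f \<in> borel_measurable borel"
    using cf cont by (auto intro: borel_measurable_continuous_onI)
  have intf: "integrable lborel f"
  proof -
    have "integrable lborel (\<lambda>x. indicator (cball 0 R) x *\<^sub>R f x)"
      by (rule borel_integrable_compact) (auto intro: continuous_on_subset[OF cf])
    moreover have "(\<lambda>x. indicator (cball 0 R) x *\<^sub>R f x) = f"
      using R by (auto simp: indicator_def fun_eq_iff)
    ultimately show ?thesis by simp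
  qed
  have trans: "integrable lborel (\<lambda>x. f (x + v))" "(LINT x|lborel. f (x + v)) = (LINT x|lborel. f x)" for v
  proof -
    have "distr lborel borel ((+) v) = lborel" by (rule lborel_distr_plus)
    then show "(LINT x|lborel. f (x + v)) = (LINT x|lborel. f x)"
      using integral_distr[of "(+) v" lborel borel f] by (simp add: add.commute)
    show "integrable lborel (\<lambda>x. f (x + v))"
      using integrable_distr_eq[of "(+) v" lborel borel f] intf \<open>distr lborel borel ((+) v) = lborel\<close>
      by (simp add: add.commute)
  qed
  define D where "D n x = (f (x + h n *\<^sub>R e) - f x) / h n" for n x
  have D0: "(LINT x|lborel. D n x) = 0" for n
    unfolding D_def using trans intf by simp
  have mvt: "\<exists>t. 0 < t \<and> t < h n \<and> D n x = partial j f (x + t *\<^sub>R e)" for n x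
    using MVT_partial[OF diff h(1)[of n], of x j] h(1)[of n] by (fastforce simp: D_def e_def)
  have "bounded (partial j f ` cball 0 (R + 2))"
    by (intro compact_imp_bounded compact_continuous_image continuous_on_subset[OF cont]) auto
  then obtain K where K: "\<And>x. norm x \<le> R + 2 \<Longrightarrow> \<bar>partial j f x\<bar> \<le> K"
    by (force simp: bounded_iff)
  have "(\<lambda>n. LINT x|lborel. D n x) \<longlonglongrightarrow> (LINT x|lborel. partial j f x)"
  proof (rule integral_dominated_convergence[where w = "\<lambda>x. K * indicator (cball 0 (R + 1)) x"])
    show "partial j f \<in> borel_measurable lborel" "D n \<in> borel_measurable lborel" for n
      by (simp_all add: D_def[abs_def])
    show "integrable lborel (\<lambda>x. K * indicator (cball 0 (R + 1)) x)"
      using borel_integrable_compact[of "cball 0 (R + 1)" "\<lambda>x. K"] by (simp add: mult.commute)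
    have "(\<lambda>n. D n x) \<longlonglongrightarrow> partial j f x" for x
    proof -
      obtain t where t: "\<And>n. 0 < t n" "\<And>n. t n < h n" "\<And>n. D n x = partial j f (x + t n *\<^sub>R e)"
        using mvt[of _ x] by metis
      have "t \<longlonglongrightarrow> 0"
        by (rule tendsto_sandwich[OF _ _ tendsto_const hlim])
          (intro always_eventually allI less_imp_le t(1,2))+
      then have "(\<lambda>n. x + t n *\<^sub>R e) \<longlonglongrightarrow> x + 0 *\<^sub>R e" by (intro tendsto_intros)
      then have "(\<lambda>n. partial j f (x + t n *\<^sub>R e)) \<longlonglongrightarrow> partial j f x"
        using continuous_on_tendsto_compose[OF cont, of _ x] by simp
      then show ?thesis using t(3) by simp
    qed
    then show "AE x in lborel. (\<lambda>n. D n x) \<longlonglongrightarrow> partial j f x" by simp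
    have "\<bar>D n x\<bar> \<le> K * indicator (cball 0 (R + 1)) x" for n x
    proof (cases "norm x \<le> R + 1")
      case True
      obtain t where t: "0 < t" "t < h n" "D n x = partial j f (x + t *\<^sub>R e)" using mvt by blast
      have "norm (x + t *\<^sub>R e) \<le> norm x + \<bar>t\<bar>" using norm_triangle_ineq[of x "t *\<^sub>R e"] by (simp add: norm_e)
      then have "norm (x + t *\<^sub>R e) \<le> R + 2" using True t h(2)[of n] by linarith
      then show ?thesis using K t True by simp
    next
      case False
      have "norm x \<le> norm (x + h n *\<^sub>R e) + h n"
        using norm_triangle_ineq4[of "x + h n *\<^sub>R e" "h n *\<^sub>R e"] h[of n] by (simp add: norm_e)
      then have "f (x + h n *\<^sub>R e) = 0" "f x = 0" using False R h(2)[of n] by (smt (verit))+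
      then show ?thesis using False by (simp add: D_def)
    qed
    then show "AE x in lborel. norm (D n x) \<le> K * indicator (cball 0 (R + 1)) x" for n by simp
  qed
  then show ?thesis using D0 by (simp add: LIMSEQ_const_iff)
qed

context bounded_open
begin

lemma continuous_measurable: "continuous_on UNIV f \<Longrightarrow> f \<in> borel_measurable (lebesgue_on \<Omega>)"
  using continuous_imp_measurable_on_sets_lebesgue[OF continuous_on_subset Omega_sets] by blast

lemma L2_continuous_compact_support:
  fixes f :: "real ^ 'n \<Rightarrow> real"
  assumes "continuous_on UNIV f" "compact K" "\<And>x. x \<notin> K \<Longrightarrow> f x = 0"
  shows "f \<in> L2 \<Omega>"
proof -
  have "bounded (f ` K)"
    using assms by (intro compact_imp_bounded compact_continuous_image) (auto intro: continuous_on_subset)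
  then obtain B where B: "\<And>x. x \<in> K \<Longrightarrow> norm (f x) \<le> B" by (force simp: bounded_iff)
  have "norm (f x) \<le> max B 0" for x using B[of x] assms(3)[of x] by (cases "x \<in> K") auto
  then show ?thesis using assms(1) continuous_measurable by (intro L2_bounded)
qed

lemma test_functions_L2:
  assumes "\<phi> \<in> test_functions \<Omega>" shows "\<phi> \<in> L2 \<Omega>" "partial j \<phi> \<in> L2 \<Omega>"
proof -
  obtain K where K: "compact K" "\<And>x. x \<notin> K \<Longrightarrow> \<phi> x = 0" "\<And>j x. x \<notin> K \<Longrightarrow> partial j \<phi> x = 0"
    using test_functions_support[OF assms] by metis
  show "\<phi> \<in> L2 \<Omega>" "partial j \<phi> \<in> L2 \<Omega>"
    using L2_continuous_compact_support[OF _ K(1)] K test_functions_differentiable[OF assms] by auto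
qed

text \<open>The product of two test functions is differentiable with compact support, so its derivative integrates to zero.\<close>

lemma test_function_integration_by_parts:
  assumes \<phi>: "\<phi> \<in> test_functions \<Omega>" and \<psi>: "\<psi> \<in> test_functions \<Omega>"
  shows "(LINT x|lebesgue_on \<Omega>. \<phi> x * partial j \<psi> x) = - (LINT x|lebesgue_on \<Omega>. partial j \<phi> x * \<psi> x)"
proof -
  obtain K where K: "compact K" "K \<subseteq> \<Omega>" "\<And>x. x \<notin> K \<Longrightarrow> \<phi> x = 0" "\<And>j x. x \<notin> K \<Longrightarrow> partial j \<phi> x = 0"
    using test_functions_support[OF \<phi>] by metis
  obtain R where R: "\<And>x. x \<in> K \<Longrightarrow> norm x \<le> R" using compact_imp_bounded[OF K(1)] by (auto simp: bounded_iff)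
  note d = test_functions_differentiable[OF \<phi>] test_functions_differentiable[OF \<psi>]
  define F where "F x = \<phi> x * partial j \<psi> x + partial j \<phi> x * \<psi> x" for x
  have pF: "partial j (\<lambda>x. \<phi> x * \<psi> x) = F" unfolding F_def by (rule partial_mult[OF d(1) d(4)])
  have cF: "continuous_on UNIV F" unfolding F_def by (intro continuous_intros d)
  have "norm x \<le> R" if "\<phi> x * \<psi> x \<noteq> 0" for x
    using that K(3)[of x] R[of x] by (cases "x \<in> K") auto
  then have "(LINT x|lborel. partial j (\<lambda>x. \<phi> x * \<psi> x) x) = 0"
    using d cF by (intro integral_partial_eq_0[where R = R] differentiable_mult) (simp_all add: pF)
  then have "(LINT x|lebesgue. F x) = 0"
    using cF by (simp add: pF integral_completion borel_measurable_continuous_onI)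
  moreover have "indicator \<Omega> x *\<^sub>R F x = F x" for x
    using K by (cases "x \<in> K") (auto simp: F_def)
  then have "(\<lambda>x. indicator \<Omega> x *\<^sub>R F x) = F" by (rule ext)
  ultimately have "(LINT x|lebesgue_on \<Omega>. F x) = 0"
    using Omega_sets by (subst integral_restrict_space) auto
  moreover have "integrable (lebesgue_on \<Omega>) (\<lambda>x. \<phi> x * partial j \<psi> x)"
    "integrable (lebesgue_on \<Omega>) (\<lambda>x. partial j \<phi> x * \<psi> x)"
    using L2_integrable_inner[OF test_functions_L2(1)[OF \<phi>] test_functions_L2(2)[OF \<psi>]]
      L2_integrable_inner[OF test_functions_L2(2)[OF \<phi>] test_functions_L2(1)[OF \<psi>]] by auto
  ultimately show ?thesis by (simp add: F_def)
qed

text \<open>The fundamental lemma of the calculus of variations: testing against bumps gives the vanishing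
  of the integral over every box in \<open>\<Omega>\<close>, and then Lebesgue's differentiation theorem applies.\<close>

lemma AE_zero_if_test_integrals_zero:
  fixes g :: "'n scalar_fld"
  assumes g: "g \<in> L2 \<Omega>" and 0: "\<And>\<phi>. \<phi> \<in> test_functions \<Omega> \<Longrightarrow> (LINT x|lebesgue_on \<Omega>. g x * \<phi> x) = 0"
  shows "AE x in lebesgue_on \<Omega>. g x = 0"
proof -
  define G where "G x = indicator \<Omega> x *\<^sub>R g x" for x
  have Gint: "integrable lebesgue G"
    using L2_integrable[OF g] Omega_sets by (simp add: G_def[abs_def] integrable_restrict_space)
  have box0: "(LINT x|lebesgue. indicator (box a b) x *\<^sub>R G x) = 0" if ab: "cbox a b \<subseteq> \<Omega>" for a b
  proof -
    have "(\<lambda>k. LINT x|lebesgue. box_bump a b (real (Suc k)) x *\<^sub>R G x) \<longlonglongrightarrow>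
        (LINT x|lebesgue. indicator (box a b) x *\<^sub>R G x)"
    proof (rule integral_dominated_convergence[where w = "\<lambda>x. norm (G x)"])
      show "(\<lambda>x. indicator (box a b) x *\<^sub>R G x) \<in> borel_measurable lebesgue"
        using borel_measurable_integrable[OF Gint]
        by (intro borel_measurable_scaleR borel_measurable_indicator) auto
      have "box_bump a b (real (Suc k)) \<in> borel_measurable lebesgue" for k
        using test_functions_differentiable(2)[OF box_bump_test_function[OF ab]]
        by (intro measurable_completion) (simp add: borel_measurable_continuous_onI)
      then show "(\<lambda>x. box_bump a b (real (Suc k)) x *\<^sub>R G x) \<in> borel_measurable lebesgue" for k
        using borel_measurable_integrable[OF Gint] by (intro borel_measurable_scaleR)
      show "integrable lebesgue (\<lambda>x. norm (G x))" using Gint by (rule integrable_norm)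
      show "AE x in lebesgue. (\<lambda>k. box_bump a b (real (Suc k)) x *\<^sub>R G x) \<longlonglongrightarrow> indicator (box a b) x *\<^sub>R G x"
        by (intro AE_I2 tendsto_scaleR box_bump_tendsto tendsto_const)
      show "AE x in lebesgue. norm (box_bump a b (real (Suc k)) x *\<^sub>R G x) \<le> norm (G x)" for k
        using box_bump_nonneg[of a b "real (Suc k)"] box_bump_le_1[of a b "real (Suc k)"]
        by (intro AE_I2) (auto simp: abs_mult intro!: mult_left_le_one_le)
    qed
    moreover have "(LINT x|lebesgue. box_bump a b (real (Suc k)) x *\<^sub>R G x) = 0" for k
    proof -
      have "(LINT x|lebesgue. box_bump a b (real (Suc k)) x *\<^sub>R G x) =
          (LINT x|lebesgue. indicator \<Omega> x *\<^sub>R (g x * box_bump a b (real (Suc k)) x))"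
        by (simp add: G_def mult_ac)
      also have "\<dots> = (LINT x|lebesgue_on \<Omega>. g x * box_bump a b (real (Suc k)) x)"
        using Omega_sets by (subst integral_restrict_space) auto
      also have "\<dots> = 0" by (rule 0) (rule box_bump_test_function[OF ab], simp)
      finally show ?thesis .
    qed
    ultimately show ?thesis by (simp add: LIMSEQ_const_iff)
  qed
  have hk: "integral (cbox a b) G = 0" if "cbox a b \<subseteq> \<Omega>" for a b
  proof -
    have "set_integrable lebesgue (box a b) G"
      unfolding set_integrable_def using Gint by (intro integrable_mult_indicator) auto
    then have "(LINT x:box a b|lebesgue. G x) = integral (box a b) G" by (rule set_lebesgue_integral_eq_integral(2))
    then show ?thesis using box0[OF that] by (simp add: set_lebesgue_integral_def integral_open_interval)
  qed
  have "G integrable_on cbox a b" for a b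
    using has_integral_integral_lebesgue[OF Gint] integrable_on_subcbox by blast
  then obtain N where N: "negligible N" "\<And>x e. \<lbrakk>x \<notin> N; 0 < e\<rbrakk> \<Longrightarrow> \<exists>d>0. \<forall>h. 0 < h \<and> h < d \<longrightarrow>
      norm (integral (cbox x (x + h *\<^sub>R One)) G /\<^sub>R h ^ DIM(real ^ 'n) - G x) < e"
    using integrable_ccontinuous_explicit[of G] by metis
  have "g x = 0" if x: "x \<in> \<Omega>" "x \<notin> N" for x
  proof (rule ccontr)
    assume "g x \<noteq> 0"
    then obtain d where d: "d > 0" "\<And>h. 0 < h \<and> h < d \<Longrightarrow>
        norm (integral (cbox x (x + h *\<^sub>R One)) G /\<^sub>R h ^ DIM(real ^ 'n) - G x) < \<bar>g x\<bar>"
      using N(2)[OF x(2), of "\<bar>g x\<bar>"] by auto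
    obtain \<epsilon> where \<epsilon>: "\<epsilon> > 0" "ball x \<epsilon> \<subseteq> \<Omega>" using open_Omega x open_contains_ball by blast
    define c where "c = norm (One :: real ^ 'n) + 1"
    have c: "c > 0" "norm (One :: real ^ 'n) \<le> c" by (simp_all add: c_def add_nonneg_pos)
    define h where "h = min (d / 2) (\<epsilon> / (2 * c))"
    have "h > 0" using d \<epsilon> c by (simp add: h_def)
    moreover have "h \<le> d / 2" unfolding h_def by (rule min.cobounded1)
    ultimately have h: "h > 0" "h < d" by linarith+
    have "h * norm (One :: real ^ 'n) \<le> \<epsilon> / (2 * c) * c"
      using c \<epsilon> h unfolding h_def by (intro mult_mono min.cobounded2) auto
    also have "\<dots> < \<epsilon>" using c \<epsilon> by simp
    finally have "h * norm (One :: real ^ 'n) < \<epsilon>" .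
    have "cbox x (x + h *\<^sub>R One) \<subseteq> ball x \<epsilon>"
    proof
      fix y assume y: "y \<in> cbox x (x + h *\<^sub>R One)"
      have "norm (y - x) \<le> norm (h *\<^sub>R One :: real ^ 'n)"
        by (rule norm_le_componentwise) (use y in \<open>auto simp: mem_box inner_simps\<close>)
      also have "\<dots> < \<epsilon>" using \<open>h * norm One < \<epsilon>\<close> h by simp
      finally show "y \<in> ball x \<epsilon>" by (simp add: dist_norm norm_minus_commute)
    qed
    then have "integral (cbox x (x + h *\<^sub>R One)) G = 0" using hk \<epsilon> by blast
    then show False using d(2)[of h] h x by (simp add: G_def)
  qed
  then have "{x \<in> \<Omega>. g x \<noteq> 0} \<subseteq> N" by auto
  moreover have "N \<in> null_sets lebesgue" using N(1) by (simp add: negligible_iff_null_sets)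
  ultimately have "AE x in lebesgue. x \<in> \<Omega> \<longrightarrow> g x = 0"
    by (intro AE_I'[of N]) auto
  then show ?thesis using Omega_sets by (simp add: AE_restrict_space_iff)
qed

end
section \<open>Weak differential operators\<close>

text \<open>The weak gradient and the weak divergence are adjoints: \<open>y\<close> is the image of \<open>x\<close> if testing \<open>x\<close> with
  \<open>A t\<close> and \<open>y\<close> with \<open>E t\<close> gives opposite numbers for all \<open>t\<close>. Such an operator is closed, and it is
  single-valued up to seminorm zero as soon as the \<open>E t\<close> separate points.\<close>

locale weak_operator = S1: semi_hilbert S1 B1 + S2: semi_hilbert S2 B2
  for S1 :: "'a::real_vector set" and B1 and S2 :: "'b::real_vector set" and B2 +
  fixes I :: "'t set" and A :: "'t \<Rightarrow> 'a" and E :: "'t \<Rightarrow> 'b"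
  assumes A: "t \<in> I \<Longrightarrow> A t \<in> S1" and E: "t \<in> I \<Longrightarrow> E t \<in> S2"
    and separating: "y \<in> S2 \<Longrightarrow> (\<And>t. t \<in> I \<Longrightarrow> B2 y (E t) = 0) \<Longrightarrow> snorm B2 y = 0"
begin

definition weak :: "'a \<Rightarrow> 'b \<Rightarrow> bool" where
  "weak x y \<longleftrightarrow> (\<forall>t\<in>I. B1 x (A t) = - B2 y (E t))"

definition dom :: "'a set" where
  "dom = {x \<in> S1. \<exists>y\<in>S2. weak x y}"

definition der :: "'a \<Rightarrow> 'b" where
  "der x = (SOME y. y \<in> S2 \<and> weak x y)"

lemma dom_S1: "x \<in> dom \<Longrightarrow> x \<in> S1"
  by (simp add: dom_def)

lemma der: assumes "x \<in> dom" shows "der x \<in> S2" "weak x (der x)"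
  using someI_ex[of "\<lambda>y. y \<in> S2 \<and> weak x y"] assms by (auto simp: dom_def der_def)

lemma weak_add:
  assumes "x \<in> S1" "x' \<in> S1" "y \<in> S2" "y' \<in> S2" "weak x y" "weak x' y'"
  shows "weak (x + x') (y + y')"
  using assms A E by (simp add: weak_def S1.add_left S2.add_left)

lemma weak_scale:
  assumes "x \<in> S1" "y \<in> S2" "weak x y" shows "weak (c *\<^sub>R x) (c *\<^sub>R y)"
  using assms A E by (simp add: weak_def S1.scale_left S2.scale_left)

lemma weak_0: "weak 0 0"
  using A E S1.scale_left[of 0 _ 0] S2.scale_left[of 0 _ 0] by (simp add: weak_def)

lemma weak_unique:
  assumes "y \<in> S2" "y' \<in> S2" "weak x y" "weak x y'" shows "snorm B2 (y - y') = 0"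
proof (rule separating)
  fix t assume t: "t \<in> I"
  have "B2 y (E t) = B2 y' (E t)" using assms(3,4) t unfolding weak_def by fastforce
  then show "B2 (y - y') (E t) = 0" using assms(1,2) E[OF t] by (simp add: S2.diff_left)
qed (use assms in auto)

lemma der_unique: "y \<in> S2 \<Longrightarrow> weak x y \<Longrightarrow> x \<in> S1 \<Longrightarrow> x \<in> dom \<and> snorm B2 (der x - y) = 0"
  using der[of x] weak_unique by (auto simp: dom_def)

lemma dom_subspace: "subspace dom"
proof (rule subspaceI)
  show "0 \<in> dom" using weak_0 by (auto simp: dom_def)
  show "x + y \<in> dom" if "x \<in> dom" "y \<in> dom" for x y
    using that weak_add by (fastforce simp: dom_def)
  show "c *\<^sub>R x \<in> dom" if "x \<in> dom" for c x
    using that weak_scale by (fastforce simp: dom_def)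
qed

lemma der_add: "x \<in> dom \<Longrightarrow> y \<in> dom \<Longrightarrow> snorm B2 (der (x + y) - (der x + der y)) = 0"
  using der_unique[of "der x + der y" "x + y"] weak_add[of x y "der x" "der y"] der dom_S1 by simp

lemma der_scale: "x \<in> dom \<Longrightarrow> snorm B2 (der (c *\<^sub>R x) - c *\<^sub>R der x) = 0"
  using der_unique[of "c *\<^sub>R der x" "c *\<^sub>R x"] weak_scale[of x "der x" c] der dom_S1 by simp

lemma linear_der:
  assumes "z \<in> S2" shows "linear_form_on dom (\<lambda>x. B2 (der x) z)"
proof (rule linear_form_onI)
  note m = subspace_add[OF dom_subspace] subspace_scale[OF dom_subspace]
  show "B2 (der (x + y)) z = B2 (der x) z + B2 (der y) z" if "x \<in> dom" "y \<in> dom" for x y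
    using S2.null_left[OF _ der_add[OF that] assms] that der m assms by (simp add: S2.expand)
  show "B2 (der (c *\<^sub>R x)) z = c * B2 (der x) z" if "x \<in> dom" for x c
    using S2.null_left[OF _ der_scale[OF that] assms, of c] that der m assms by (simp add: S2.expand)
qed

lemma linear_der_right:
  assumes "z \<in> S2" shows "linear_form_on dom (\<lambda>x. B2 z (der x))"
  using linear_der[OF assms] subspace_add[OF dom_subspace] subspace_scale[OF dom_subspace]
  by (auto simp: linear_form_on_def S2.sym[OF assms der(1)])

definition graph_form :: "'a \<Rightarrow> 'a \<Rightarrow> real" where
  "graph_form x y = B1 x y + B2 (der x) (der y)"

lemma snorm_graph_form: "x \<in> dom \<Longrightarrow> snorm graph_form x = sqrt ((snorm B1 x)\<^sup>2 + (snorm B2 (der x))\<^sup>2)"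
  by (simp add: snorm_def graph_form_def S1.nonneg S2.nonneg dom_S1 der)

lemma snorm_le_graph:
  assumes "x \<in> dom"
  shows "snorm B1 x \<le> snorm graph_form x" "snorm B2 (der x) \<le> snorm graph_form x"
  unfolding snorm_graph_form[OF assms] by (simp_all add: real_le_rsqrt)

lemma graph_semi_hilbert: "semi_hilbert dom graph_form"
  unfolding graph_form_def[abs_def]
proof (rule semi_hilbert_graph[OF S1.semi_hilbert_axioms S2.semi_hilbert_axioms dom_subspace])
  show "dom \<subseteq> S1" by (auto simp: dom_def)
  fix X x y assume X: "\<And>n::nat. X n \<in> dom" and xy: "x \<in> S1" "y \<in> S2"
    and lim: "(\<lambda>n. snorm B1 (X n - x)) \<longlonglongrightarrow> 0" "(\<lambda>n. snorm B2 (der (X n) - y)) \<longlonglongrightarrow> 0"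
  have "B1 x (A t) = - B2 y (E t)" if t: "t \<in> I" for t
  proof -
    have "(\<lambda>n. B1 (X n) (A t)) \<longlonglongrightarrow> B1 x (A t)"
      by (rule S1.tendsto_form[OF _ xy(1) lim(1) S1.lin[OF A[OF t]], where K = "snorm B1 (A t)"])
        (use X dom_S1 A[OF t] S1.Cauchy_Schwarz in \<open>auto simp: mult.commute\<close>)
    moreover have "(\<lambda>n. - B2 (der (X n)) (E t)) \<longlonglongrightarrow> - B2 y (E t)"
      by (intro tendsto_minus S2.tendsto_form[OF _ xy(2) lim(2) S2.lin[OF E[OF t]], where K = "snorm B2 (E t)"])
        (use X der E[OF t] S2.Cauchy_Schwarz in \<open>auto simp: mult.commute\<close>)
    moreover have "B1 (X n) (A t) = - B2 (der (X n)) (E t)" for n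
      using der(2)[OF X] t by (simp add: weak_def)
    ultimately show ?thesis using LIMSEQ_unique by simp
  qed
  then have "weak x y" by (simp add: weak_def)
  then show "x \<in> dom \<and> snorm B2 (der x - y) = 0" using der_unique xy by blast
qed (use der der_add der_scale in auto)

end

lemma L2_vec_nth: "f \<in> L2 \<Omega> \<Longrightarrow> (\<lambda>x. f x $ i) \<in> L2 \<Omega>"
  by (rule L2_bounded_linear[OF bounded_linear_vec_nth])

lemma L2_axis:
  fixes h :: "real ^ 'n \<Rightarrow> 'c::euclidean_space" and i :: "'m::finite"
  assumes "h \<in> L2 \<Omega>" shows "(\<lambda>x. axis i (h x)) \<in> L2 \<Omega>"
proof (rule L2_bounded_linear[OF _ assms])
  show "bounded_linear (axis i :: 'c \<Rightarrow> 'c ^ 'm)"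
    by (rule linear_conv_bounded_linear[THEN iffD1], rule linearI)
      (auto simp: axis_def vec_eq_iff)
qed

lemma L2_lambda:
  fixes f :: "'b::finite \<Rightarrow> real ^ 'n \<Rightarrow> 'c::euclidean_space"
  assumes "\<And>i. f i \<in> L2 \<Omega>" shows "(\<lambda>x. \<chi> i. f i x) \<in> L2 \<Omega>"
proof -
  have "(\<Sum>i\<in>UNIV. (\<lambda>x. axis i (f i x))) \<in> L2 \<Omega>"
    by (intro subspace_sum[OF L2_subspace] L2_axis assms)
  moreover have "(\<Sum>i\<in>UNIV. (\<lambda>x. axis i (f i x))) = (\<lambda>x. \<chi> i. f i x)"
  proof
    fix x
    have "(\<Sum>i\<in>A. (\<lambda>x. axis i (f i x))) x = (\<Sum>i\<in>A. axis i (f i x))" if "finite A" for A :: "'b set"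
      using that by induction auto
    then show "(\<Sum>i\<in>UNIV. (\<lambda>x. axis i (f i x))) x = (\<chi> i. f i x)"
      by (simp add: vec_eq_iff axis_def)
  qed
  ultimately show ?thesis by simp
qed

text \<open>Both operators are tested with a test function and an index. For the gradient the index selects a
  partial derivative, for the divergence the row of a tensor that carries the gradient of the test function.\<close>

definition test_partial :: "'n::finite scalar_fld \<times> 'n \<Rightarrow> 'n scalar_fld" where
  "test_partial t = partial (snd t) (fst t)"

definition test_unit :: "'n::finite scalar_fld \<times> 'n \<Rightarrow> 'n vector_fld" where
  "test_unit t = (\<lambda>x. axis (snd t) (fst t x))"

definition test_row :: "'n::finite scalar_fld \<times> 'n \<Rightarrow> 'n tensor_fld" where
  "test_row t = (\<lambda>x. axis (snd t) (\<chi> j. partial j (fst t) x))"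

context bounded_open
begin

lemma test_unit_separating:
  assumes G: "G \<in> L2 \<Omega>" and 0: "\<And>t. t \<in> test_functions \<Omega> \<times> UNIV \<Longrightarrow> L2_ip \<Omega> G (test_unit t) = 0"
  shows "snorm (L2_ip \<Omega>) G = 0"
proof -
  have "AE x in lebesgue_on \<Omega>. G x $ j = 0" for j
    by (rule AE_zero_if_test_integrals_zero[OF L2_vec_nth[OF G]])
      (use 0[of "(_, j)"] in \<open>simp add: L2_ip_def test_unit_def inner_axis\<close>)
  then have "AE x in lebesgue_on \<Omega>. \<forall>j. G x $ j = 0" by (simp add: AE_all_countable)
  then have "AE x in lebesgue_on \<Omega>. G x = 0" by eventually_elim (simp add: vec_eq_iff)
  then show ?thesis using L2_norm_eq_0_iff[OF G] by (simp add: L2_norm_eq_snorm)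
qed

sublocale grad: weak_operator "L2 \<Omega>" "L2_ip \<Omega>" "L2 \<Omega>" "L2_ip \<Omega>" "test_functions \<Omega> \<times> UNIV"
  test_partial test_unit
proof (intro weak_operator.intro weak_operator_axioms.intro L2_semi_hilbert)
  fix t :: "'n scalar_fld \<times> 'n" assume "t \<in> test_functions \<Omega> \<times> UNIV"
  then show "test_partial t \<in> L2 \<Omega>" "test_unit t \<in> L2 \<Omega>"
    using test_functions_L2[of "fst t"] by (auto simp: test_partial_def test_unit_def intro: L2_axis)
qed (rule test_unit_separating)

sublocale div: weak_operator "L2 \<Omega>" "L2_ip \<Omega>" "L2 \<Omega>" "L2_ip \<Omega>" "test_functions \<Omega> \<times> UNIV"
  test_row test_unit
proof (intro weak_operator.intro weak_operator_axioms.intro L2_semi_hilbert)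
  fix t :: "'n scalar_fld \<times> 'n" assume "t \<in> test_functions \<Omega> \<times> UNIV"
  then show "test_row t \<in> L2 \<Omega>" "test_unit t \<in> L2 \<Omega>"
    using test_functions_L2[of "fst t"] by (auto simp: test_row_def test_unit_def intro!: L2_axis L2_lambda)
qed (rule test_unit_separating)

lemma has_weak_grad_iff: "has_weak_grad \<Omega> q G \<longleftrightarrow> grad.weak q G"
  by (auto simp: has_weak_grad_def grad.weak_def L2_ip_def test_partial_def test_unit_def inner_axis)

lemma has_weak_div_iff: "has_weak_div \<Omega> \<tau> D \<longleftrightarrow> div.weak \<tau> D"
  by (auto simp: has_weak_div_def div.weak_def L2_ip_def test_row_def test_unit_def inner_axis inner_vec_def[of "_ $ _"])

lemma H1_eq: "H1 \<Omega> = grad.dom" and grad_eq: "grad \<Omega> = grad.der"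
  by (auto simp: H1_def grad.dom_def grad_def grad.der_def has_weak_grad_iff fun_eq_iff)

lemma Y_eq: "Y_space \<Omega> = div.dom" and tensor_div_eq: "tensor_div \<Omega> = div.der"
  by (auto simp: Y_space_def div.dom_def tensor_div_def div.der_def has_weak_div_iff fun_eq_iff)

end

definition H1_ip :: "(real ^ 'n::finite) set \<Rightarrow> 'n scalar_fld \<Rightarrow> 'n scalar_fld \<Rightarrow> real" where
  "H1_ip \<Omega> p q = L2_ip \<Omega> p q + L2_ip \<Omega> (grad \<Omega> p) (grad \<Omega> q)"

definition Y_ip :: "(real ^ 'n::finite) set \<Rightarrow> 'n tensor_fld \<Rightarrow> 'n tensor_fld \<Rightarrow> real" where
  "Y_ip \<Omega> \<sigma> \<tau> = L2_ip \<Omega> \<sigma> \<tau> + L2_ip \<Omega> (tensor_div \<Omega> \<sigma>) (tensor_div \<Omega> \<tau>)"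

definition X_ip :: "(real ^ 'n::finite) set \<Rightarrow> 'n X_elem \<Rightarrow> 'n X_elem \<Rightarrow> real" where
  "X_ip \<Omega> = prod_form (L2_ip \<Omega>) (H1_ip \<Omega>)"

definition Z_ip :: "(real ^ 'n::finite) set \<Rightarrow> 'n Z_elem \<Rightarrow> 'n Z_elem \<Rightarrow> real" where
  "Z_ip \<Omega> = prod_form (L2_ip \<Omega>) (L2_ip \<Omega>)"

context bounded_open
begin

lemma H1_ip_eq: "H1_ip \<Omega> = grad.graph_form" and Y_ip_eq: "Y_ip \<Omega> = div.graph_form"
  by (simp_all add: fun_eq_iff H1_ip_def Y_ip_def grad.graph_form_def div.graph_form_def grad_eq tensor_div_eq)

lemma H1_semi_hilbert: "semi_hilbert (H1 \<Omega>) (H1_ip \<Omega>)"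
  unfolding H1_eq H1_ip_eq by (rule grad.graph_semi_hilbert)

lemma Y_semi_hilbert: "semi_hilbert (Y_space \<Omega>) (Y_ip \<Omega>)"
  unfolding Y_eq Y_ip_eq by (rule div.graph_semi_hilbert)

lemma X_semi_hilbert: "semi_hilbert (X_space \<Omega>) (X_ip \<Omega>)"
  unfolding X_space_def X_ip_def by (intro semi_hilbert_prod L2_semi_hilbert H1_semi_hilbert)

lemma Z_semi_hilbert: "semi_hilbert (Z_space \<Omega>) (Z_ip \<Omega>)"
  unfolding Z_space_def Z_ip_def by (intro semi_hilbert_prod L2_semi_hilbert L2_skew_semi_hilbert)

sublocale L2: semi_hilbert "L2 \<Omega> :: (real ^ 'n \<Rightarrow> 'b::euclidean_space) set" "L2_ip \<Omega>"
  by (rule L2_semi_hilbert)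
sublocale H1: semi_hilbert "H1 \<Omega>" "H1_ip \<Omega>" by (rule H1_semi_hilbert)
sublocale X: semi_hilbert "X_space \<Omega>" "X_ip \<Omega>" by (rule X_semi_hilbert)
sublocale Y: semi_hilbert "Y_space \<Omega>" "Y_ip \<Omega>" by (rule Y_semi_hilbert)
sublocale Z: semi_hilbert "Z_space \<Omega>" "Z_ip \<Omega>" by (rule Z_semi_hilbert)

lemma H1_norm_eq: "H1_norm \<Omega> q = snorm (H1_ip \<Omega>) q"
  by (simp add: H1_norm_def snorm_def H1_ip_def L2_norm_eq_snorm L2_ip_def)

lemma Y_norm_eq: "Y_norm \<Omega> \<tau> = snorm (Y_ip \<Omega>) \<tau>"
  by (simp add: Y_norm_def snorm_def Y_ip_def L2_norm_eq_snorm L2_ip_def)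

lemma X_norm_eq: "X_norm \<Omega> e = snorm (X_ip \<Omega>) e"
  by (cases e) (simp add: snorm_def X_ip_def prod_form_def L2_norm_eq_snorm H1_norm_eq H1_ip_def L2_ip_def)

lemma Z_norm_eq: "Z_norm \<Omega> v = snorm (Z_ip \<Omega>) v"
  by (cases v) (simp add: snorm_def Z_ip_def prod_form_def L2_norm_eq_snorm L2_ip_def)

lemma grad_L2: "q \<in> H1 \<Omega> \<Longrightarrow> grad \<Omega> q \<in> L2 \<Omega>"
  unfolding H1_eq grad_eq by (rule grad.der)

lemma div_L2: "\<tau> \<in> Y_space \<Omega> \<Longrightarrow> tensor_div \<Omega> \<tau> \<in> L2 \<Omega>"
  unfolding Y_eq tensor_div_eq by (rule div.der)

lemma H1_L2: "q \<in> H1 \<Omega> \<Longrightarrow> q \<in> L2 \<Omega>" and Y_L2: "\<tau> \<in> Y_space \<Omega> \<Longrightarrow> \<tau> \<in> L2 \<Omega>"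
  by (simp_all add: H1_def Y_space_def)

lemmas grad_linear = grad.linear_der[folded H1_eq grad_eq] grad.linear_der_right[folded H1_eq grad_eq]
lemmas div_linear = div.linear_der[folded Y_eq tensor_div_eq] div.linear_der_right[folded Y_eq tensor_div_eq]
lemmas H1_norm_ge = grad.snorm_le_graph[folded H1_eq H1_ip_eq grad_eq H1_norm_eq, folded L2_norm_eq_snorm]
lemmas Y_norm_ge = div.snorm_le_graph[folded Y_eq Y_ip_eq tensor_div_eq Y_norm_eq, folded L2_norm_eq_snorm]

lemma grad_unique: "G \<in> L2 \<Omega> \<Longrightarrow> has_weak_grad \<Omega> q G \<Longrightarrow> q \<in> L2 \<Omega> \<Longrightarrow>
    q \<in> H1 \<Omega> \<and> L2_norm \<Omega> (grad \<Omega> q - G) = 0"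
  using grad.der_unique unfolding H1_eq grad_eq has_weak_grad_iff L2_norm_eq_snorm by blast

end
section \<open>Boundary functionals\<close>

lemma Cauchy_Schwarz_2:
  fixes a b c d :: real
  shows "a * c + b * d \<le> sqrt (a\<^sup>2 + b\<^sup>2) * sqrt (c\<^sup>2 + d\<^sup>2)"
proof -
  have "(a * c + b * d)\<^sup>2 \<le> (a\<^sup>2 + b\<^sup>2) * (c\<^sup>2 + d\<^sup>2)"
    using zero_le_power2[of "a * d - b * c"] by (simp add: power2_eq_square algebra_simps)
  then show ?thesis by (simp add: real_le_rsqrt flip: real_sqrt_mult)
qed

context bounded_open
begin

text \<open>The norm in the definition of \<open>H10\<close> involves weak gradients, Green's formula the classical partial
  derivatives of test functions.\<close>

lemma test_function_grad:
  assumes \<phi>: "\<phi> \<in> test_functions \<Omega>"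
  shows "\<phi> \<in> H1 \<Omega>" "L2_norm \<Omega> (grad \<Omega> \<phi> - (\<lambda>x. \<chi> j. partial j \<phi> x)) = 0"
proof -
  have G: "(\<lambda>x. \<chi> j. partial j \<phi> x) \<in> L2 \<Omega>"
    by (intro L2_lambda test_functions_L2[OF \<phi>])
  have "has_weak_grad \<Omega> \<phi> (\<lambda>x. \<chi> j. partial j \<phi> x)"
    using test_function_integration_by_parts[OF \<phi>] by (simp add: has_weak_grad_def)
  then show "\<phi> \<in> H1 \<Omega>" "L2_norm \<Omega> (grad \<Omega> \<phi> - (\<lambda>x. \<chi> j. partial j \<phi> x)) = 0"
    using grad_unique[OF G _ test_functions_L2(1)[OF \<phi>]] by simp_all
qed

lemma zero_H10: "(\<lambda>x. 0) \<in> H10 \<Omega>"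
proof -
  have "H1_norm \<Omega> (\<lambda>x. 0) = 0" using H1.snorm_zero by (simp add: H1_norm_eq zero_fun_def)
  moreover have "(\<lambda>x. 0) \<in> H1 \<Omega>" using H1.mem(1) by (simp add: zero_fun_def)
  ultimately show ?thesis
    unfolding H10_def using zero_test_function by (force intro!: bexI[of _ "\<lambda>x. 0"])
qed

text \<open>One row of Green's formula: the pairing of a component of the normal trace of \<open>\<tau>\<close> with the trace
  of \<open>v\<close>.\<close>

definition green_row :: "'n tensor_fld \<Rightarrow> 'n \<Rightarrow> 'n scalar_fld \<Rightarrow> real" where
  "green_row \<tau> i v = L2_ip \<Omega> (\<lambda>x. \<tau> x $ i) (grad \<Omega> v) + L2_ip \<Omega> (\<lambda>x. tensor_div \<Omega> \<tau> x $ i) v"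

lemma green_row_linear: "\<tau> \<in> Y_space \<Omega> \<Longrightarrow> linear_form_on (H1 \<Omega>) (green_row \<tau> i)"
  unfolding green_row_def[abs_def]
  by (intro linear_form_on_plus grad_linear(2) linear_form_on_sub[OF L2.lin_right] L2_vec_nth Y_L2 div_L2)
    (auto simp: H1_L2)

text \<open>On test functions this is the definition of the weak divergence; both sides are continuous in the \<open>H\<^sup>1\<close> norm,
  in which test functions are dense in \<open>H10\<close>.\<close>

lemma green_row_H10:
  assumes \<tau>: "\<tau> \<in> Y_space \<Omega>" and v: "v \<in> H10 \<Omega>"
  shows "green_row \<tau> i v = 0"
proof -
  let ?T = "\<lambda>x. \<tau> x $ i" and ?D = "\<lambda>x. tensor_div \<Omega> \<tau> x $ i"
  have L: "?T \<in> L2 \<Omega>" "?D \<in> L2 \<Omega>" using \<tau> by (auto intro: L2_vec_nth Y_L2 div_L2)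
  define C where "C = L2_norm \<Omega> ?T + L2_norm \<Omega> ?D"
  have bound: "\<bar>green_row \<tau> i w\<bar> \<le> C * H1_norm \<Omega> w" if "w \<in> H1 \<Omega>" for w
  proof -
    have "\<bar>green_row \<tau> i w\<bar> \<le> L2_norm \<Omega> ?T * L2_norm \<Omega> (grad \<Omega> w) + L2_norm \<Omega> ?D * L2_norm \<Omega> w"
      using L2_Cauchy_Schwarz[OF L(1) grad_L2[OF that]] L2_Cauchy_Schwarz[OF L(2) H1_L2[OF that]]
      by (simp add: green_row_def)
    also have "\<dots> \<le> L2_norm \<Omega> ?T * H1_norm \<Omega> w + L2_norm \<Omega> ?D * H1_norm \<Omega> w"
      using H1_norm_ge[OF that] by (intro add_mono mult_left_mono) auto
    finally show ?thesis by (simp add: C_def algebra_simps)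
  qed
  have test0: "green_row \<tau> i \<phi> = 0" if \<phi>: "\<phi> \<in> test_functions \<Omega>" for \<phi>
  proof -
    let ?G = "\<lambda>x. \<chi> j. partial j \<phi> x"
    have G: "?G \<in> L2 \<Omega>" using test_functions_L2[OF \<phi>] by (intro L2_lambda)
    have "L2_ip \<Omega> ?T ?G = - L2_ip \<Omega> ?D \<phi>"
      using div.der(2)[of \<tau>] \<tau> \<phi>
      unfolding Y_eq tensor_div_eq[symmetric] div.weak_def
      by (auto dest!: bspec[of _ _ "(\<phi>, i)"] simp: L2_ip_def test_row_def test_unit_def inner_axis)
    moreover have "L2_ip \<Omega> ?T (grad \<Omega> \<phi>) = L2_ip \<Omega> ?T ?G"
      using L2_Cauchy_Schwarz[OF L(1) L2.mem(3)[OF grad_L2[OF test_function_grad(1)[OF \<phi>]] G]]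
        test_function_grad[OF \<phi>] grad_L2 G L by (simp add: L2.diff_right)
    ultimately show ?thesis by (simp add: green_row_def)
  qed
  have vH: "v \<in> H1 \<Omega>" using v by (simp add: H10_def)
  have approx: "\<bar>green_row \<tau> i v\<bar> \<le> C * \<epsilon>" if \<epsilon>: "\<epsilon> > 0" for \<epsilon>
  proof -
    obtain \<phi> where \<phi>: "\<phi> \<in> test_functions \<Omega>" "H1_norm \<Omega> (v - \<phi>) < \<epsilon>"
      using v \<epsilon> unfolding H10_def fun_diff_def by blast
    have "green_row \<tau> i v = green_row \<tau> i (v - \<phi>)"
      using linear_form_on_diff[OF green_row_linear[OF \<tau>] H1.sub vH test_function_grad(1)[OF \<phi>(1)]] test0[OF \<phi>(1)]
      by simp
    then have "\<bar>green_row \<tau> i v\<bar> \<le> C * H1_norm \<Omega> (v - \<phi>)"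
      using bound[of "v - \<phi>"] vH test_function_grad(1)[OF \<phi>(1)] by simp
    also have "\<dots> \<le> C * \<epsilon>" using \<phi>(2) by (intro mult_left_mono) (auto simp: C_def)
    finally show ?thesis .
  qed
  have "\<bar>green_row \<tau> i v\<bar> \<le> 0 + e" if "e > 0" for e
  proof -
    have C: "C \<ge> 0" by (simp add: C_def)
    then have "\<bar>green_row \<tau> i v\<bar> \<le> C * (e / (C + 1))" using approx[of "e / (C + 1)"] that by simp
    also have "\<dots> \<le> (C + 1) * (e / (C + 1))" using C that by (intro mult_right_mono) auto
    also have "\<dots> = e" using C by simp
    finally show ?thesis by simp
  qed
  then have "\<bar>green_row \<tau> i v\<bar> \<le> 0" by (rule field_le_epsilon)
  then show ?thesis by simp
qed

definition green :: "'n tensor_fld \<Rightarrow> 'n vector_fld \<Rightarrow> real" where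
  "green \<tau> v = L2_ip \<Omega> \<tau> (grad_vec \<Omega> v) + L2_ip \<Omega> v (tensor_div \<Omega> \<tau>)"

lemma H1_vec_L2: "v \<in> H1_vec \<Omega> \<Longrightarrow> v \<in> L2 \<Omega>" "v \<in> H1_vec \<Omega> \<Longrightarrow> grad_vec \<Omega> v \<in> L2 \<Omega>"
proof -
  assume v: "v \<in> H1_vec \<Omega>"
  then have "(\<lambda>x. \<chi> i. v x $ i) \<in> L2 \<Omega>" "(\<lambda>x. \<chi> i. grad \<Omega> (\<lambda>y. v y $ i) x) \<in> L2 \<Omega>"
    by (intro L2_lambda; simp add: H1_vec_def H1_L2 grad_L2)+
  then show "v \<in> L2 \<Omega>" "grad_vec \<Omega> v \<in> L2 \<Omega>" by (simp_all add: grad_vec_def)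
qed

lemma green_eq_sum:
  assumes "\<tau> \<in> Y_space \<Omega>" "v \<in> H1_vec \<Omega>"
  shows "green \<tau> v = (\<Sum>i\<in>UNIV. green_row \<tau> i (\<lambda>x. v x $ i))"
proof -
  have int: "integrable (lebesgue_on \<Omega>) (\<lambda>x. \<tau> x $ i \<bullet> grad \<Omega> (\<lambda>y. v y $ i) x)"
    "integrable (lebesgue_on \<Omega>) (\<lambda>x. tensor_div \<Omega> \<tau> x $ i * v x $ i)" for i
    using assms L2_integrable_inner[OF L2_vec_nth[OF Y_L2] grad_L2, of \<tau> "\<lambda>y. v y $ i" i]
      L2_integrable_inner[OF L2_vec_nth[OF div_L2] L2_vec_nth[OF H1_vec_L2(1)], of \<tau> v i i]
    by (auto simp: H1_vec_def)
  show ?thesis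
    using int by (simp add: green_def green_row_def L2_ip_def inner_vec_def[of "\<tau> _"] inner_vec_def[of "v _"]
        grad_vec_def sum.distrib mult.commute)
qed

lemma green_bound:
  assumes "\<tau> \<in> Y_space \<Omega>" "v \<in> H1_vec \<Omega>"
  shows "\<bar>green \<tau> v\<bar> \<le> Y_norm \<Omega> \<tau> * H1_vec_norm \<Omega> v"
proof -
  have "\<bar>green \<tau> v\<bar> \<le> L2_norm \<Omega> \<tau> * L2_norm \<Omega> (grad_vec \<Omega> v) + L2_norm \<Omega> (tensor_div \<Omega> \<tau>) * L2_norm \<Omega> v"
    using L2_Cauchy_Schwarz[OF Y_L2 H1_vec_L2(2)] L2_Cauchy_Schwarz[OF H1_vec_L2(1) div_L2] assms
    by (fastforce simp: green_def mult.commute)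
  also have "\<dots> \<le> Y_norm \<Omega> \<tau> * H1_vec_norm \<Omega> v"
    using Cauchy_Schwarz_2[of "L2_norm \<Omega> \<tau>" "L2_norm \<Omega> (grad_vec \<Omega> v)" "L2_norm \<Omega> (tensor_div \<Omega> \<tau>)" "L2_norm \<Omega> v"]
    by (simp add: Y_norm_def H1_vec_norm_def add.commute)
  finally show ?thesis .
qed

text \<open>All liftings of the boundary displacement give the same value of Green's formula, so the infimum over them,
  the trace norm, can be used in the bound. The chosen lifting itself is exported because its gradient is a strain
  that carries the boundary displacement.\<close>

lemma H_fun_representation:
  assumes "u\<^sub>\<Gamma> \<in> H_half_vec \<Omega>"
  obtains v where "v \<in> H1_vec \<Omega>" "\<And>\<tau>. H_fun \<Omega> u\<^sub>\<Gamma> \<tau> = - green \<tau> v"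
    "\<And>\<tau>. \<tau> \<in> Y_space \<Omega> \<Longrightarrow> \<bar>H_fun \<Omega> u\<^sub>\<Gamma> \<tau>\<bar> \<le> H_half_vec_norm \<Omega> u\<^sub>\<Gamma> * Y_norm \<Omega> \<tau>"
    "H_half_vec_norm \<Omega> u\<^sub>\<Gamma> \<ge> 0"
proof -
  obtain v0 where v0: "v0 \<in> H1_vec \<Omega>" "u\<^sub>\<Gamma> = bdry_trace_vec \<Omega> v0"
    using assms by (auto simp: H_half_vec_def)
  have v0u: "v0 \<in> u\<^sub>\<Gamma>" using v0 zero_H10 by (simp add: bdry_trace_vec_def)
  define v where "v = (SOME v. v \<in> u\<^sub>\<Gamma>)"
  have v: "v \<in> u\<^sub>\<Gamma>" unfolding v_def using v0u by (rule someI[of "\<lambda>v. v \<in> u\<^sub>\<Gamma>"])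
  have sub: "w \<in> H1_vec \<Omega>" if "w \<in> u\<^sub>\<Gamma>" for w using that v0 by (simp add: bdry_trace_vec_def)
  have H: "H_fun \<Omega> u\<^sub>\<Gamma> \<tau> = - green \<tau> v" for \<tau>
    by (simp add: H_fun_def normal_trace_def green_def v_def L2_ip_def Let_def)
  \<comment> \<open>Green's formula does not depend on the lifting.\<close>
  have eq0: "green \<tau> w = green \<tau> v0" if \<tau>: "\<tau> \<in> Y_space \<Omega>" and w: "w \<in> u\<^sub>\<Gamma>" for \<tau> w
  proof -
    have "green_row \<tau> i (\<lambda>x. w x $ i) = green_row \<tau> i (\<lambda>x. v0 x $ i)" for i
    proof -
      have m: "(\<lambda>x. w x $ i) \<in> H1 \<Omega>" "(\<lambda>x. v0 x $ i) \<in> H1 \<Omega>"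
        using sub[OF w] v0 by (auto simp: H1_vec_def)
      have "(\<lambda>x. w x $ i) - (\<lambda>x. v0 x $ i) \<in> H10 \<Omega>"
        using w v0 by (simp add: bdry_trace_vec_def fun_diff_def)
      from green_row_H10[OF \<tau> this, of i] show ?thesis
        using linear_form_on_diff[OF green_row_linear[OF \<tau>] H1.sub m] by simp
    qed
    then show ?thesis using green_eq_sum[OF \<tau>] sub[OF w] v0 by simp
  qed
  have N: "H1_vec_norm \<Omega> w \<ge> 0" for w by (simp add: H1_vec_norm_def)
  have "\<bar>H_fun \<Omega> u\<^sub>\<Gamma> \<tau>\<bar> \<le> H_half_vec_norm \<Omega> u\<^sub>\<Gamma> * Y_norm \<Omega> \<tau>" if \<tau>: "\<tau> \<in> Y_space \<Omega>" for \<tau>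
  proof -
    have le: "\<bar>H_fun \<Omega> u\<^sub>\<Gamma> \<tau>\<bar> \<le> Y_norm \<Omega> \<tau> * H1_vec_norm \<Omega> w" if "w \<in> u\<^sub>\<Gamma>" for w
      using green_bound[OF \<tau> sub[OF that]] eq0[OF \<tau> that] eq0[OF \<tau> v] H by simp
    show ?thesis
    proof (cases "Y_norm \<Omega> \<tau> = 0")
      case True
      then show ?thesis using le[OF v] by simp
    next
      case False
      then have pos: "Y_norm \<Omega> \<tau> > 0" using Y.snorm_nonneg[OF \<tau>] by (simp add: Y_norm_eq)
      have "\<bar>H_fun \<Omega> u\<^sub>\<Gamma> \<tau>\<bar> / Y_norm \<Omega> \<tau> \<le> Inf (H1_vec_norm \<Omega> ` u\<^sub>\<Gamma>)"
        using v le pos by (intro cInf_greatest) (auto simp: field_simps)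
      then show ?thesis using pos by (simp add: H_half_vec_norm_def field_simps)
    qed
  qed
  moreover have "H_half_vec_norm \<Omega> u\<^sub>\<Gamma> \<ge> 0"
    unfolding H_half_vec_norm_def using v N by (intro cInf_greatest) auto
  ultimately show thesis using that[of v] H sub[OF v] by blast
qed

lemma H_fun_linear:
  assumes "u\<^sub>\<Gamma> \<in> H_half_vec \<Omega>" shows "linear_form_on (Y_space \<Omega>) (H_fun \<Omega> u\<^sub>\<Gamma>)"
proof -
  obtain v where v: "v \<in> H1_vec \<Omega>" "\<And>\<tau>. H_fun \<Omega> u\<^sub>\<Gamma> \<tau> = - green \<tau> v"
    using H_fun_representation[OF assms] by metis
  have "linear_form_on (Y_space \<Omega>) (\<lambda>\<tau>. - green \<tau> v)"
    unfolding green_def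
    by (intro linear_form_on_uminus linear_form_on_plus div_linear(2) H1_vec_L2 v
        linear_form_on_sub[OF L2.lin[OF H1_vec_L2(2)[OF v(1)]]]) (auto simp: Y_L2)
  then show ?thesis unfolding v(2)[abs_def] .
qed

text \<open>Normalising \<open>q\<close> reduces the bound to the definition of the dual norm; if \<open>q\<close> has norm zero, the
  boundedness of the functional is used instead.\<close>

lemma H_mhalf_bound:
  assumes r: "r \<in> H_mhalf \<Omega>"
  shows "linear_form_on (H1 \<Omega>) (\<lambda>q. r (bdry_trace \<Omega> q))"
    and "\<And>q. q \<in> H1 \<Omega> \<Longrightarrow> \<bar>r (bdry_trace \<Omega> q)\<bar> \<le> H_mhalf_norm \<Omega> r * H1_norm \<Omega> q"
    and "H_mhalf_norm \<Omega> r \<ge> 0"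
proof -
  have lin: "r (bdry_trace \<Omega> (a *\<^sub>R v + w)) = a * r (bdry_trace \<Omega> v) + r (bdry_trace \<Omega> w)"
    if "v \<in> H1 \<Omega>" "w \<in> H1 \<Omega>" for a v w
    using r that by (simp add: H_mhalf_def plus_fun_def scaleR_fun_def)
  have r0: "r (bdry_trace \<Omega> 0) = 0" using lin[of 0 0 1] by simp
  have scale: "r (bdry_trace \<Omega> (a *\<^sub>R v)) = a * r (bdry_trace \<Omega> v)" if "v \<in> H1 \<Omega>" for a v
    using lin[OF that, of 0 a] r0 by simp
  show linf: "linear_form_on (H1 \<Omega>) (\<lambda>q. r (bdry_trace \<Omega> q))"
    using lin[of _ _ 1] scale by (intro linear_form_onI) auto
  have N: "H1_norm \<Omega> w \<ge> 0" for w by (simp add: H1_norm_def)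
  have self: "q \<in> bdry_trace \<Omega> q" if "q \<in> H1 \<Omega>" for q
    using that zero_H10 by (simp add: bdry_trace_def)
  have half: "0 \<le> H_half_norm \<Omega> (bdry_trace \<Omega> q)" "H_half_norm \<Omega> (bdry_trace \<Omega> q) \<le> H1_norm \<Omega> q"
    if "q \<in> H1 \<Omega>" for q
    unfolding H_half_norm_def using self[OF that] N
    by (auto intro!: cInf_greatest cInf_lower bdd_belowI2[of _ 0])
  obtain c where c: "\<And>\<Phi>. \<Phi> \<in> H_half \<Omega> \<Longrightarrow> \<bar>r \<Phi>\<bar> \<le> c * H_half_norm \<Omega> \<Phi>"
    using r unfolding H_mhalf_def by blast
  let ?S = "{\<bar>r \<Phi>\<bar> | \<Phi>. \<Phi> \<in> H_half \<Omega> \<and> H_half_norm \<Omega> \<Phi> \<le> 1}"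
  have bdd: "bdd_above ?S"
  proof (rule bdd_aboveI[of _ "\<bar>c\<bar>"])
    fix x assume "x \<in> ?S"
    then obtain \<Phi> where \<Phi>: "x = \<bar>r \<Phi>\<bar>" "\<Phi> \<in> H_half \<Omega>" "H_half_norm \<Omega> \<Phi> \<le> 1" by blast
    then have "0 \<le> H_half_norm \<Omega> \<Phi>" using half(1) by (auto simp: H_half_def)
    then have "c * H_half_norm \<Omega> \<Phi> \<le> \<bar>c\<bar> * 1"
      using \<Phi>(3) by (intro mult_mono) auto
    then show "x \<le> \<bar>c\<bar>" using c[OF \<Phi>(2)] \<Phi>(1) by simp
  qed
  have sup: "\<bar>r (bdry_trace \<Omega> q)\<bar> \<le> H_mhalf_norm \<Omega> r" if "q \<in> H1 \<Omega>" "H1_norm \<Omega> q \<le> 1" for q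
    unfolding H_mhalf_norm_def using that half(2)[OF that(1)]
    by (intro cSup_upper[OF _ bdd]) (auto simp: H_half_def)
  show "H_mhalf_norm \<Omega> r \<ge> 0"
    using sup[of 0] H1.snorm_zero by (simp add: H1_norm_eq r0)
  fix q assume q: "q \<in> H1 \<Omega>"
  show "\<bar>r (bdry_trace \<Omega> q)\<bar> \<le> H_mhalf_norm \<Omega> r * H1_norm \<Omega> q"
  proof (cases "H1_norm \<Omega> q = 0")
    case True
    then have "H_half_norm \<Omega> (bdry_trace \<Omega> q) = 0" using half[OF q] by simp
    then show ?thesis using c[of "bdry_trace \<Omega> q"] q True by (simp add: H_half_def)
  next
    case False
    then have pos: "H1_norm \<Omega> q > 0" using N[of q] by simp
    have "\<bar>r (bdry_trace \<Omega> ((1 / H1_norm \<Omega> q) *\<^sub>R q))\<bar> \<le> H_mhalf_norm \<Omega> r"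
    proof (rule sup)
      show "H1_norm \<Omega> ((1 / H1_norm \<Omega> q) *\<^sub>R q) \<le> 1"
        using H1.snorm_scale[OF q, of "1 / H1_norm \<Omega> q"] pos by (simp add: H1_norm_eq)
    qed (use q in simp)
    then show ?thesis using pos by (simp add: scale[OF q] abs_mult field_simps)
  qed
qed

lemma G_fun_bound:
  assumes g: "g \<in> L2 \<Omega>" and r: "r \<in> H_mhalf \<Omega>"
  shows "linear_form_on (X_space \<Omega>) (G_fun \<Omega> g r)"
    and "\<And>e. e \<in> X_space \<Omega> \<Longrightarrow> \<bar>G_fun \<Omega> g r e\<bar> \<le> (L2_norm \<Omega> g + H_mhalf_norm \<Omega> r) * X_norm \<Omega> e"
proof -
  have G: "G_fun \<Omega> g r e = L2_ip \<Omega> g (snd e) + r (bdry_trace \<Omega> (snd e))" for e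
    by (simp add: G_fun_def L2_ip_def)
  have "linear_form_on (H1 \<Omega>) (\<lambda>q. L2_ip \<Omega> g q + r (bdry_trace \<Omega> q))"
    by (intro linear_form_on_plus linear_form_on_sub[OF L2.lin_right[OF g]] H_mhalf_bound(1)[OF r])
      (auto simp: H1_L2)
  then show "linear_form_on (X_space \<Omega>) (G_fun \<Omega> g r)"
    by (auto simp: linear_form_on_def X_space_def G)
  fix e assume "e \<in> X_space \<Omega>"
  then have q: "snd e \<in> H1 \<Omega>" by (auto simp: X_space_def)
  have "\<bar>G_fun \<Omega> g r e\<bar> \<le> L2_norm \<Omega> g * H1_norm \<Omega> (snd e) + H_mhalf_norm \<Omega> r * H1_norm \<Omega> (snd e)"
    using L2_Cauchy_Schwarz[OF g H1_L2[OF q]] H_mhalf_bound(2)[OF r q]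
      mult_left_mono[OF H1_norm_ge(1)[OF q] L2_norm_nonneg, of \<Omega> g] by (simp add: G)
  also have "\<dots> = (L2_norm \<Omega> g + H_mhalf_norm \<Omega> r) * H1_norm \<Omega> (snd e)" by (simp add: algebra_simps)
  also have "\<dots> \<le> (L2_norm \<Omega> g + H_mhalf_norm \<Omega> r) * X_norm \<Omega> e"
    using H_mhalf_bound(3)[OF r] by (intro mult_left_mono) (cases e, auto intro: real_le_rsqrt)
  finally show "\<bar>G_fun \<Omega> g r e\<bar> \<le> (L2_norm \<Omega> g + H_mhalf_norm \<Omega> r) * X_norm \<Omega> e" .
qed

lemma F_fun_bound:
  assumes f: "f \<in> L2 \<Omega>"
  shows "linear_form_on (Z_space \<Omega>) (F_fun \<Omega> f)"
    and "\<And>v. v \<in> Z_space \<Omega> \<Longrightarrow> \<bar>F_fun \<Omega> f v\<bar> \<le> L2_norm \<Omega> f * Z_norm \<Omega> v"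
proof -
  have F: "F_fun \<Omega> f v = L2_ip \<Omega> f (fst v)" for v by (simp add: F_fun_def L2_ip_def)
  show "linear_form_on (Z_space \<Omega>) (F_fun \<Omega> f)"
    using L2.lin_right[OF f] by (auto simp: linear_form_on_def Z_space_def F)
  fix v assume "v \<in> Z_space \<Omega>"
  then have v: "fst v \<in> L2 \<Omega>" by (auto simp: Z_space_def)
  have "\<bar>F_fun \<Omega> f v\<bar> \<le> L2_norm \<Omega> f * L2_norm \<Omega> (fst v)"
    using L2_Cauchy_Schwarz[OF f v] by (simp add: F)
  also have "\<dots> \<le> L2_norm \<Omega> f * Z_norm \<Omega> v"
    by (intro mult_left_mono) (cases v, auto intro: real_le_rsqrt)
  finally show "\<bar>F_fun \<Omega> f v\<bar> \<le> L2_norm \<Omega> f * Z_norm \<Omega> v" .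
qed

end
section \<open>The forms of the problem\<close>

text \<open>Let \<open>D\<close> be the sum of the data and \<open>M = \<gamma>2 / \<beta>\<^sup>2\<close>. If \<open>x\<close> exceeded \<open>M D\<close>, then \<open>D\<close> would be less than \<open>x\<close>, the inequality would give
  \<open>c x \<le> (2 C + 2) D / \<beta>\<close>, and the right-hand side is at most \<open>c M D\<close>. Finally \<open>M \<le> \<gamma>1\<close>, as the square in the numerator of \<open>\<gamma>1\<close>
  is at least \<open>\<gamma>2\<^sup>2\<close>.\<close>

lemma energy_estimate:
  fixes c C \<beta> x Kg Kh Kf :: real
  assumes c: "0 < c" "c \<le> C" and \<beta>: "0 < \<beta>" "\<beta> \<le> 1"
    and nn: "0 \<le> x" "0 \<le> Kg" "0 \<le> Kh" "0 \<le> Kf"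
    and energy: "c * x\<^sup>2 \<le> Kg * x + Kh * (2 * C * x + Kf / \<beta>) + Kf / \<beta> * x"
  shows "x \<le> gamma1 C c \<beta> * (Kg + Kh + Kf)"
proof -
  define D where "D = Kg + Kh + Kf"
  define g where "g = gamma2 C c"
  define M where "M = g / \<beta>\<^sup>2"
  have D: "0 \<le> D" "Kg \<le> D" "Kh \<le> D" "Kf \<le> D" using nn by (auto simp: D_def)
  have cg: "c * g = (C + 2) * (c + 1 + C)" using c by (simp add: g_def gamma2_def)
  have "c * g \<ge> c * 1"
    unfolding cg using c mult_mono[of 1 "C + 2" c "c + 1 + C"] by simp
  then have g1: "g \<ge> 1" using c by simp
  have \<beta>2: "0 < \<beta>\<^sup>2" "\<beta>\<^sup>2 \<le> \<beta>" "\<beta>\<^sup>2 \<le> 1" using \<beta> by (simp_all add: power2_eq_square mult_le_one)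
  have M1: "M \<ge> 1" using g1 \<beta>2 by (simp add: M_def)
  have "M \<le> gamma1 C c \<beta>"
  proof -
    have "g\<^sup>2 \<le> (C + 1 + \<beta> + g)\<^sup>2" using c \<beta> g1 by (intro power_mono) auto
    then have "g\<^sup>2 / (\<beta>\<^sup>2 * g) \<le> (C + 1 + \<beta> + g)\<^sup>2 / (\<beta>\<^sup>2 * g)"
      using \<beta>2 g1 by (intro divide_right_mono) auto
    then show ?thesis using g1 by (simp add: M_def gamma1_def g_def[symmetric] power2_eq_square)
  qed
  moreover have "x \<le> M * D"
  proof (rule ccontr)
    assume "\<not> x \<le> M * D"
    then have x: "M * D < x" by simp
    moreover have "D \<le> M * D" using M1 D mult_right_mono[of 1 M D] by simp
    ultimately have Dx: "D < x" "0 < x" using D by linarith+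
    have b1: "1 \<le> 1 / \<beta>" using \<beta> by simp
    have "Kg * x \<le> Kg * (1 / \<beta>) * x"
      using nn b1 mult_left_mono[OF b1, of Kg] by (intro mult_right_mono) auto
    moreover have "Kh * (2 * C * x) \<le> (2 * C) * (Kh * (1 / \<beta>)) * x"
      using nn c b1 mult_left_mono[OF b1, of Kh] mult_left_mono[of Kh "Kh * (1 / \<beta>)" "2 * C"]
        mult_right_mono[of "2 * C * Kh" "2 * C * (Kh * (1 / \<beta>))" x] by (simp add: mult_ac)
    moreover have "Kh * Kf \<le> D * x" using D Dx nn by (intro mult_mono) auto
    then have "Kh * Kf / \<beta> \<le> D * x / \<beta>" using \<beta> by (intro divide_right_mono) auto
    moreover have "Kg * (1 / \<beta>) * x + Kf / \<beta> * x \<le> D * (1 / \<beta>) * x"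
    proof -
      have "(Kg + Kf) * (x / \<beta>) \<le> D * (x / \<beta>)"
        using nn \<beta> by (intro mult_right_mono) (auto simp: D_def)
      then show ?thesis by (simp add: algebra_simps add_divide_distrib)
    qed
    moreover have "(2 * C) * (Kh * (1 / \<beta>)) * x \<le> (2 * C) * (D * (1 / \<beta>)) * x"
      using D c \<beta> nn by (intro mult_right_mono mult_left_mono) auto
    ultimately have "c * x\<^sup>2 \<le> D * (1 / \<beta>) * x + (2 * C) * (D * (1 / \<beta>)) * x + D * x / \<beta>"
      using energy by (simp add: distrib_left)
    also have "\<dots> = (2 * C + 2) * D / \<beta> * x" by (simp add: algebra_simps add_divide_distrib)
    finally have "c * x \<le> (2 * C + 2) * D / \<beta>"
      using Dx(2) mult_right_le_imp_le[of "c * x" x "(2 * C + 2) * D / \<beta>"]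
      by (simp add: power2_eq_square mult.assoc)
    also have "\<dots> \<le> c * M * D"
    proof -
      have "2 * C + 2 \<le> (C + 2) * (c + 1 + C)"
        using c mult_mono[of 2 "C + 2" "C + 1" "c + 1 + C"] by simp
      also have "\<dots> = c * g" by (rule cg[symmetric])
      finally have "(2 * C + 2) / \<beta> \<le> c * g / \<beta>\<^sup>2"
        using \<beta>2 \<beta> c by (intro frac_le) auto
      then have "(2 * C + 2) / \<beta> * D \<le> c * g / \<beta>\<^sup>2 * D" using D by (intro mult_right_mono)
      then show ?thesis by (simp add: M_def)
    qed
    finally show False using x c by (simp add: mult.assoc)
  qed
  ultimately show ?thesis
    using D(1) mult_right_mono[of M "gamma1 C c \<beta>" D] by (simp add: D_def)
qed

lemma trace_eq_inner: "trace (A :: real ^ 'n ^ 'n) = mat 1 \<bullet> A"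
  by (simp add: trace_def inner_vec_def mat_def if_distrib[of "\<lambda>x. x * _"] cong: if_cong)

lemma norm_mat_1: "norm (mat 1 :: real ^ 'n ^ 'n) = sqrt (real CARD('n))"
  unfolding norm_eq_sqrt_inner trace_eq_inner[symmetric] by (simp add: trace_def mat_def)

lemma abs_trace_le: "\<bar>trace (A :: real ^ 'n ^ 'n)\<bar> \<le> sqrt (real CARD('n)) * norm A"
  unfolding trace_eq_inner using Cauchy_Schwarz_ineq2[of "mat 1" A] by (simp add: norm_mat_1)

lemma norm_matrix_vector_le:
  "norm (A *v x) \<le> norm A * norm x" for A :: "real ^ 'n ^ 'm"
proof -
  have "norm (A *v x) = L2_set (\<lambda>i. norm ((A *v x) $ i)) UNIV" by (simp add: norm_vec_def)
  also have "\<dots> \<le> L2_set (\<lambda>i. norm (A $ i) * norm x) UNIV"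
    by (intro L2_set_mono) (auto simp: matrix_vector_mul_component Cauchy_Schwarz_ineq2)
  also have "\<dots> = norm A * norm x" by (simp add: norm_vec_def[of A] L2_set_left_distrib)
  finally show ?thesis .
qed

lemma hooke_bounded_linear: "bounded_linear (hooke lam \<mu>)"
  unfolding hooke_def[abs_def] trace_eq_inner
  by (intro bounded_linear_add bounded_linear_scaleR_right bounded_linear_scaleR_const
      bounded_linear_const_mult bounded_linear_inner_right)

lemma norm_hooke_le:
  assumes "lam \<ge> 0" "\<mu> \<ge> 0"
  shows "norm (hooke lam \<mu> (A :: real ^ 'n ^ 'n)) \<le> (2 * \<mu> + real CARD('n) * lam) * norm A"
proof -
  have "norm (hooke lam \<mu> A) \<le> lam * \<bar>trace A\<bar> * sqrt (real CARD('n)) + 2 * \<mu> * norm A"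
    using norm_triangle_ineq[of "(lam * trace A) *\<^sub>R mat 1" "(2 * \<mu>) *\<^sub>R A"] assms
    by (simp add: hooke_def norm_mat_1 abs_mult)
  also have "lam * \<bar>trace A\<bar> * sqrt (real CARD('n)) \<le> lam * (sqrt (real CARD('n)) * norm A) * sqrt (real CARD('n))"
    using assms abs_trace_le by (intro mult_right_mono mult_left_mono) auto
  also have "\<dots> = real CARD('n) * lam * norm A" by simp
  finally show ?thesis by (simp add: algebra_simps)
qed

context bounded_open
begin

lemma not_AE_False: "\<not> (AE x in lebesgue_on \<Omega>. False)"
proof
  assume "AE x in lebesgue_on \<Omega>. False"
  then have "AE x in lebesgue. x \<notin> \<Omega>" using Omega_sets by (simp add: AE_restrict_space_iff)
  then have "\<Omega> \<in> null_sets lebesgue" using Omega_sets by (simp add: AE_iff_null_sets)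
  then show False using open_not_negligible[OF open_Omega nonempty_Omega] by (simp add: negligible_iff_null_sets)
qed

lemma L2_norm_const_pos: "c \<noteq> 0 \<Longrightarrow> L2_norm \<Omega> (\<lambda>x. c) > 0"
  using L2_norm_eq_0_iff[OF L2_const, of c] not_AE_False L2_norm_nonneg[of \<Omega> "\<lambda>x. c"]
  by (simp add: order.strict_iff_order del: L2_norm_nonneg)

lemma Linf_norm_bound:
  assumes "f \<in> Linf \<Omega>"
  shows "AE x in lebesgue_on \<Omega>. norm (f x) \<le> Linf_norm \<Omega> f" "0 \<le> Linf_norm \<Omega> f"
proof -
  let ?s = "esssup (lebesgue_on \<Omega>) (\<lambda>x. ereal (norm (f x)))"
  obtain c where c: "f \<in> borel_measurable (lebesgue_on \<Omega>)" "AE x in lebesgue_on \<Omega>. norm (f x) \<le> c"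
    using assms by (auto simp: Linf_def)
  have "(\<lambda>x. ereal (norm (f x))) \<in> borel_measurable (lebesgue_on \<Omega>)" using c(1) by measurable
  then have "?s \<le> ereal c" using c(2) by (intro esssup_I) auto
  then have fin: "?s \<noteq> \<infinity>" by auto
  have "AE x in lebesgue_on \<Omega>. ereal (norm (f x)) \<le> ?s" by (rule esssup_AE)
  then show *: "AE x in lebesgue_on \<Omega>. norm (f x) \<le> Linf_norm \<Omega> f"
  proof eventually_elim
    case (elim x)
    then show ?case using fin unfolding Linf_norm_def by (cases ?s) auto
  qed
  show "0 \<le> Linf_norm \<Omega> f"
  proof (rule ccontr)
    assume neg: "\<not> 0 \<le> Linf_norm \<Omega> f"
    have "AE x in lebesgue_on \<Omega>. False"
      using * by eventually_elim (use neg norm_ge_zero order_trans in blast)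
    then show False using not_AE_False by blast
  qed
qed

lemma Linf_matrix_vector:
  fixes A :: "'n tensor_fld" and G :: "'n vector_fld"
  assumes A: "A \<in> Linf \<Omega>" and G: "G \<in> L2 \<Omega>"
  shows "(\<lambda>x. A x *v G x) \<in> L2 \<Omega>"
    and "L2_norm \<Omega> (\<lambda>x. A x *v G x) \<le> Linf_norm \<Omega> A * L2_norm \<Omega> G"
proof -
  have Am: "A \<in> borel_measurable (lebesgue_on \<Omega>)" using A by (simp add: Linf_def)
  have m: "(\<lambda>x. A x *v G x) \<in> borel_measurable (lebesgue_on \<Omega>)"
  proof (rule borel_measurable_continuous_Pair[OF Am L2_measurable[OF G]])
    show "continuous_on UNIV (\<lambda>x :: (real ^ 'n ^ 'n) \<times> (real ^ 'n). fst x *v snd x)"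
      unfolding matrix_vector_mult_def
      by (intro continuous_on_vec_lambda continuous_intros)
  qed
  have ae: "AE x in lebesgue_on \<Omega>. norm (A x *v G x) \<le> Linf_norm \<Omega> A * norm (G x)"
    using Linf_norm_bound(1)[OF A]
    by eventually_elim (rule order_trans[OF norm_matrix_vector_le mult_right_mono], auto)
  show "(\<lambda>x. A x *v G x) \<in> L2 \<Omega>" by (rule L2_dominated[OF G m ae])
  show "L2_norm \<Omega> (\<lambda>x. A x *v G x) \<le> Linf_norm \<Omega> A * L2_norm \<Omega> G"
    by (rule L2_norm_mono[OF G m Linf_norm_bound(2)[OF A] ae])
qed

definition b2 :: "'n tensor_fld \<Rightarrow> 'n Z_elem \<Rightarrow> real" where
  "b2 \<tau> v = - L2_ip \<Omega> (fst v) (tensor_div \<Omega> \<tau>) - L2_ip \<Omega> \<tau> (snd v)"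

lemma b1_form_eq: "b1_form \<Omega> e \<tau> = - L2_ip \<Omega> \<tau> (fst e)"
  by (simp add: b1_form_def L2_ip_def)

lemma b2_form_eq: "b2_form \<Omega> et v = b2 (snd et) v"
  by (simp add: b2_form_def b2_def L2_ip_def)

lemma Z_L2: "v \<in> Z_space \<Omega> \<Longrightarrow> fst v \<in> L2 \<Omega>" "v \<in> Z_space \<Omega> \<Longrightarrow> snd v \<in> L2 \<Omega>"
  by (auto simp: Z_space_def L2_skew_def)

lemma X_L2: "e \<in> X_space \<Omega> \<Longrightarrow> fst e \<in> L2 \<Omega>" "e \<in> X_space \<Omega> \<Longrightarrow> snd e \<in> H1 \<Omega>"
  by (auto simp: X_space_def)

lemma X_norm_ge: "L2_norm \<Omega> (fst e) \<le> X_norm \<Omega> e" "H1_norm \<Omega> (snd e) \<le> X_norm \<Omega> e"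
  by (cases e; simp add: real_le_rsqrt)+

lemma b2_linear1:
  assumes "v \<in> Z_space \<Omega>" shows "linear_form_on (Y_space \<Omega>) (\<lambda>\<tau>. b2 \<tau> v)"
  unfolding b2_def
  by (intro linear_form_on_minus linear_form_on_uminus div_linear(2) Z_L2 assms
      linear_form_on_sub[OF L2.lin]) (auto simp: Y_L2)

lemma b2_linear2:
  assumes "\<tau> \<in> Y_space \<Omega>" shows "linear_form_on (Z_space \<Omega>) (b2 \<tau>)"
  using Z_L2 L2.lin[OF div_L2[OF assms]] L2.lin_right[OF Y_L2[OF assms]]
  by (auto simp: b2_def linear_form_on_def right_diff_distrib)

lemma b2_bound:
  assumes \<tau>: "\<tau> \<in> Y_space \<Omega>" and v: "v \<in> Z_space \<Omega>"
  shows "\<bar>b2 \<tau> v\<bar> \<le> Y_norm \<Omega> \<tau> * Z_norm \<Omega> v"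
proof -
  have "\<bar>b2 \<tau> v\<bar> \<le> L2_norm \<Omega> (tensor_div \<Omega> \<tau>) * L2_norm \<Omega> (fst v) + L2_norm \<Omega> \<tau> * L2_norm \<Omega> (snd v)"
    using L2_Cauchy_Schwarz[OF Z_L2(1)[OF v] div_L2[OF \<tau>]] L2_Cauchy_Schwarz[OF Y_L2[OF \<tau>] Z_L2(2)[OF v]]
    by (simp add: b2_def mult.commute)
  also have "\<dots> \<le> Y_norm \<Omega> \<tau> * Z_norm \<Omega> v"
    using Cauchy_Schwarz_2[of "L2_norm \<Omega> (tensor_div \<Omega> \<tau>)" "L2_norm \<Omega> (fst v)" "L2_norm \<Omega> \<tau>" "L2_norm \<Omega> (snd v)"]
    by (cases v) (simp add: Y_norm_def add.commute)
  finally show ?thesis .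
qed

text \<open>The stresses that are symmetric and divergence free in the weak sense.\<close>

definition Y0 :: "'n tensor_fld set" where
  "Y0 = {\<tau> \<in> Y_space \<Omega>. \<forall>v\<in>Z_space \<Omega>. b2 \<tau> v = 0}"

lemma Y0_Y: "\<tau> \<in> Y0 \<Longrightarrow> \<tau> \<in> Y_space \<Omega>" and Y0_b2: "\<tau> \<in> Y0 \<Longrightarrow> v \<in> Z_space \<Omega> \<Longrightarrow> b2 \<tau> v = 0"
  by (simp_all add: Y0_def)

lemma div_test_Z: "\<tau> \<in> Y_space \<Omega> \<Longrightarrow> (tensor_div \<Omega> \<tau>, 0) \<in> Z_space \<Omega>"
  using semi_inner.mem(1)[OF semi_hilbert.axioms(1)[OF L2_skew_semi_hilbert]] by (simp add: Z_space_def div_L2)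

lemma L2_ip_zero_right: "f \<in> L2 \<Omega> \<Longrightarrow> L2_ip \<Omega> f 0 = 0"
  by (simp add: L2_ip_def)

lemma Y0_div:
  assumes "\<tau> \<in> Y0" shows "L2_norm \<Omega> (tensor_div \<Omega> \<tau>) = 0"
  using Y0_b2[OF assms div_test_Z[OF Y0_Y[OF assms]]] L2_ip_zero_right[OF Y_L2[OF Y0_Y[OF assms]]]
  by (simp add: b2_def L2_norm_eq_snorm snorm_def)

lemma Y0_norm: "\<tau> \<in> Y0 \<Longrightarrow> Y_norm \<Omega> \<tau> = L2_norm \<Omega> \<tau>"
  by (simp add: Y_norm_def Y0_div)

lemma Y0_semi_hilbert: "semi_hilbert Y0 (Y_ip \<Omega>)"
  unfolding Y0_def
  by (rule Y.kernel_semi_hilbert[OF b2_linear1])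
    (use b2_bound in \<open>auto simp: Y_norm_eq mult.commute intro!: exI[of _ "Z_norm \<Omega> _"]\<close>)

text \<open>The total stress of a strain and a pressure. Pairing it with the test strain collects all terms of the first
  form that contain the test strain; \<open>flow\<close> collects those that contain the test pressure.\<close>

definition stress :: "real \<Rightarrow> real \<Rightarrow> real \<Rightarrow> 'n X_elem \<Rightarrow> 'n tensor_fld" where
  "stress lam \<mu> \<alpha> e = (\<lambda>x. hooke lam \<mu> (fst e x) - (\<alpha> * snd e x) *\<^sub>R mat 1)"

definition flow :: "real \<Rightarrow> real \<Rightarrow> 'n tensor_fld \<Rightarrow> 'n X_elem \<Rightarrow> 'n scalar_fld \<Rightarrow> real" where
  "flow \<alpha> c0 A d q = L2_ip \<Omega> (\<lambda>x. A x *v grad \<Omega> (snd d) x) (grad \<Omega> q) + c0 * L2_ip \<Omega> (snd d) q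
     + \<alpha> * L2_ip \<Omega> (\<lambda>x. trace (fst d x)) q"

lemma stress_L2: "d \<in> X_space \<Omega> \<Longrightarrow> stress lam \<mu> \<alpha> d \<in> L2 \<Omega>"
proof -
  assume d: "d \<in> X_space \<Omega>"
  have "(\<lambda>x. hooke lam \<mu> (fst d x)) - (\<lambda>x. (\<alpha> * snd d x) *\<^sub>R (mat 1 :: real ^ 'n ^ 'n)) \<in> L2 \<Omega>"
    using L2_bounded_linear[OF hooke_bounded_linear X_L2(1)[OF d]]
      L2_bounded_linear[OF bounded_linear_scaleR_const[OF bounded_linear_const_mult[OF bounded_linear_ident]]
        H1_L2[OF X_L2(2)[OF d]], of \<alpha> "mat 1 :: real ^ 'n ^ 'n"]
    by (intro L2.mem)
  then show ?thesis by (simp add: stress_def fun_diff_def)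
qed

lemma trace_L2: "d \<in> X_space \<Omega> \<Longrightarrow> (\<lambda>x. trace (fst d x)) \<in> L2 \<Omega>"
  unfolding trace_eq_inner by (intro L2_bounded_linear[OF bounded_linear_inner_right] X_L2)

lemma stress_linear:
  "stress lam \<mu> \<alpha> (d + e) = stress lam \<mu> \<alpha> d + stress lam \<mu> \<alpha> e"
  "stress lam \<mu> \<alpha> (c *\<^sub>R d) = c *\<^sub>R stress lam \<mu> \<alpha> d"
  by (simp_all add: stress_def fun_eq_iff algebra_simps
      linear_add[OF bounded_linear.linear[OF hooke_bounded_linear]]
      linear_scale[OF bounded_linear.linear[OF hooke_bounded_linear]])

end

text \<open>The constant \<open>Ca\<close> is a parameter, determined by the last assumption, so that formulas stay
  short.\<close>

locale poroelasticity = bounded_open \<Omega> for \<Omega> :: "(real ^ 'n::finite) set" +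
  fixes lam \<mu> \<alpha> c0 \<kappa>1 \<kappa>2 \<beta>2 r Ca :: real and \<kappa> :: "'n X_elem \<Rightarrow> 'n tensor_fld"
  assumes params: "lam > 0" "\<mu> > 0" "0 \<le> \<alpha>" "c0 > 0"
    and perm: "\<kappa>1 > 0" "\<kappa>2 > 0" "permeability \<Omega> \<kappa>1 \<kappa>2 \<kappa>"
    and beta: "\<beta>2 > 0" "inf_sup_b2 \<Omega> \<beta>2"
    and radius: "r > 0"
    and Ca_eq: "Ca = Ca_const (CARD('n)) lam \<mu> \<alpha> c0 \<kappa>2 r"
begin

abbreviation "a \<equiv> a_form \<Omega> lam \<mu> \<alpha> c0 \<kappa>"
abbreviation "strs \<equiv> stress lam \<mu> \<alpha>"
abbreviation "flw w \<equiv> flow \<alpha> c0 (\<kappa> w)"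
abbreviation "ca \<equiv> ca_const \<mu> c0 \<kappa>1"
abbreviation "\<gamma>1 \<equiv> gamma1 Ca ca \<beta>2"

lemma Ca_ge: "2 * \<mu> + real CARD('n) * lam \<le> Ca" "c0 \<le> Ca" "real CARD('n) * \<alpha> \<le> Ca"
  by (simp_all add: Ca_eq Ca_const_def)

lemma ca_le: "ca \<le> \<kappa>1" "ca \<le> 2 * \<mu>" "ca \<le> c0" and ca_pos: "0 < ca"
  using params perm by (simp_all add: ca_const_def)

lemma ca_le_Ca: "ca \<le> Ca" and Ca_pos: "0 < Ca"
  using ca_le Ca_ge ca_pos by linarith+

lemma \<kappa>_Linf: "w \<in> X_space \<Omega> \<Longrightarrow> \<kappa> w \<in> Linf \<Omega>"
  using perm(3) by (simp add: permeability_def)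

lemma kgrad_L2: "w \<in> X_space \<Omega> \<Longrightarrow> p \<in> H1 \<Omega> \<Longrightarrow> (\<lambda>x. \<kappa> w x *v grad \<Omega> p x) \<in> L2 \<Omega>"
  by (intro Linf_matrix_vector \<kappa>_Linf grad_L2)

lemma a_eq:
  assumes "w \<in> X_space \<Omega>" "d \<in> X_space \<Omega>" "e \<in> X_space \<Omega>"
  shows "a w d e = L2_ip \<Omega> (strs d) (fst e) + flw w d (snd e)"
proof -
  obtain dd p ee q where de: "d = (dd, p)" "e = (ee, q)" by fastforce
  have m: "dd \<in> L2 \<Omega>" "ee \<in> L2 \<Omega>" "p \<in> L2 \<Omega>" "q \<in> L2 \<Omega>"
    using assms de H1_L2 by (auto simp: X_space_def)
  have i1: "integrable (lebesgue_on \<Omega>) (\<lambda>x. hooke lam \<mu> (dd x) \<bullet> ee x)"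
    by (intro L2_integrable_inner L2_bounded_linear[OF hooke_bounded_linear] m)
  have i2: "integrable (lebesgue_on \<Omega>) (\<lambda>x. p x * trace (ee x))"
    using L2_integrable_inner[OF m(3) trace_L2[OF assms(3)]] de by simp
  have "L2_ip \<Omega> (strs d) ee = (LINT x|lebesgue_on \<Omega>. hooke lam \<mu> (dd x) \<bullet> ee x) - \<alpha> * (LINT x|lebesgue_on \<Omega>. p x * trace (ee x))"
    using i1 i2 by (simp add: L2_ip_def stress_def de inner_diff_left trace_eq_inner[symmetric] mult.assoc)
  then show ?thesis by (simp add: de flow_def L2_ip_def mult.commute)
qed

lemma flow_linear: "w \<in> X_space \<Omega> \<Longrightarrow> d \<in> X_space \<Omega> \<Longrightarrow> linear_form_on (H1 \<Omega>) (flw w d)"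
proof -
  assume w: "w \<in> X_space \<Omega>" and d: "d \<in> X_space \<Omega>"
  note l = linear_form_on_sub[OF L2.lin_right, of _ "H1 \<Omega>"]
  have s: "linear_form_on S f \<Longrightarrow> linear_form_on S (\<lambda>x. c * f x)" for S f and c :: real
    by (simp add: linear_form_on_def algebra_simps)
  show ?thesis
    unfolding flow_def[abs_def] using w d
    by (intro linear_form_on_plus grad_linear(2) kgrad_L2 X_L2 s l H1_L2 trace_L2) (auto simp: H1_L2)
qed

text \<open>Transposing the permeability moves it to the gradient of the test pressure, and linearity of the weak gradient
  against a fixed field applies.\<close>

lemma flow_linear1:
  assumes w: "w \<in> X_space \<Omega>" and q: "q \<in> H1 \<Omega>"
  shows "linear_form_on (X_space \<Omega>) (\<lambda>d. flw w d q)"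
proof (rule linear_form_onI)
  have kq: "L2_ip \<Omega> (\<lambda>x. \<kappa> w x *v G x) (grad \<Omega> q) = L2_ip \<Omega> G (\<lambda>x. transpose (\<kappa> w x) *v grad \<Omega> q x)" for G
    by (simp add: L2_ip_def dot_lmul_matrix[symmetric] inner_commute)
  have tL: "(\<lambda>x. transpose (\<kappa> w x) *v grad \<Omega> q x) \<in> L2 \<Omega>"
  proof -
    have tm: "(\<lambda>x. transpose (\<kappa> w x)) \<in> borel_measurable (lebesgue_on \<Omega>)"
      using \<kappa>_Linf[OF w] measurable_compose[OF _ borel_measurable_continuous_onI[OF linear_continuous_on[OF bounded_linear_transpose]]]
      by (auto simp: Linf_def)
    obtain K where K: "K \<ge> 0" "\<And>A :: real ^ 'n ^ 'n. norm (transpose A) \<le> K * norm A"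
      using bounded_linear.nonneg_bounded[OF bounded_linear_transpose] by (auto simp: mult.commute)
    obtain c where "AE x in lebesgue_on \<Omega>. norm (\<kappa> w x) \<le> c" using \<kappa>_Linf[OF w] by (auto simp: Linf_def)
    then have "AE x in lebesgue_on \<Omega>. norm (transpose (\<kappa> w x)) \<le> K * c"
      by eventually_elim (use K order_trans mult_left_mono in metis)
    then have "(\<lambda>x. transpose (\<kappa> w x)) \<in> Linf \<Omega>" using tm by (auto simp: Linf_def)
    then show ?thesis using Linf_matrix_vector grad_L2[OF q] by blast
  qed
  note g = grad_linear(1)[OF tL]
  show "flw w (d + d') q = flw w d q + flw w d' q" if "d \<in> X_space \<Omega>" "d' \<in> X_space \<Omega>" for d d'
  proof -
    have t: "(\<lambda>x. trace (fst (d + d') x)) = (\<lambda>x. trace (fst d x)) + (\<lambda>x. trace (fst d' x))"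
      by (simp add: fun_eq_iff trace_eq_inner inner_add_right)
    have "L2_ip \<Omega> (\<lambda>x. trace (fst (d + d') x)) q = L2_ip \<Omega> (\<lambda>x. trace (fst d x)) q + L2_ip \<Omega> (\<lambda>x. trace (fst d' x)) q"
      unfolding t using that by (intro L2.add_left trace_L2 H1_L2 q)
    then show ?thesis
      using linear_form_on_add[OF g X_L2(2) X_L2(2), of d d'] that H1_L2[OF q]
        H1_L2[OF X_L2(2)[OF that(1)]] H1_L2[OF X_L2(2)[OF that(2)]]
      by (simp add: flow_def kq L2.add_left algebra_simps)
  qed
  show "flw w (c *\<^sub>R d) q = c * flw w d q" if "d \<in> X_space \<Omega>" for c d
  proof -
    have t: "(\<lambda>x. trace (fst (c *\<^sub>R d) x)) = c *\<^sub>R (\<lambda>x. trace (fst d x))"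
      by (simp add: fun_eq_iff trace_eq_inner)
    have "L2_ip \<Omega> (\<lambda>x. trace (fst (c *\<^sub>R d) x)) q = c * L2_ip \<Omega> (\<lambda>x. trace (fst d x)) q"
      unfolding t using that by (intro L2.scale_left trace_L2 H1_L2 q)
    then show ?thesis
      using linear_form_on_scale[OF g X_L2(2), of d c] that H1_L2[OF q] H1_L2[OF X_L2(2)[OF that]]
      by (simp add: flow_def kq L2.scale_left algebra_simps)
  qed
qed

lemma a_linear:
  assumes w: "w \<in> X_space \<Omega>"
  shows "d \<in> X_space \<Omega> \<Longrightarrow> linear_form_on (X_space \<Omega>) (a w d)"
    and "e \<in> X_space \<Omega> \<Longrightarrow> linear_form_on (X_space \<Omega>) (\<lambda>d. a w d e)"
proof -
  show "linear_form_on (X_space \<Omega>) (a w d)" if d: "d \<in> X_space \<Omega>"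
    using linear_form_on_add[OF flow_linear[OF w d] X_L2(2) X_L2(2)] linear_form_on_scale[OF flow_linear[OF w d] X_L2(2)]
      L2.add_right[OF X_L2(1) X_L2(1) stress_L2[OF d]] L2.scale_right[OF X_L2(1) stress_L2[OF d]]
    by (intro linear_form_onI) (simp_all add: a_eq[OF w d] algebra_simps)
  show "linear_form_on (X_space \<Omega>) (\<lambda>d. a w d e)" if e: "e \<in> X_space \<Omega>"
    using linear_form_on_add[OF flow_linear1[OF w X_L2(2)[OF e]]] linear_form_on_scale[OF flow_linear1[OF w X_L2(2)[OF e]]]
      L2.add_left[OF stress_L2 stress_L2 X_L2(1)[OF e]] L2.scale_left[OF stress_L2 X_L2(1)[OF e]]
    by (intro linear_form_onI) (simp_all add: a_eq[OF w _ e] stress_linear algebra_simps)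
qed

lemma stress_bound:
  assumes d: "d \<in> X_space \<Omega>" shows "L2_norm \<Omega> (strs d) \<le> 2 * Ca * X_norm \<Omega> d"
proof -
  let ?h = "\<lambda>x. hooke lam \<mu> (fst d x)" and ?p = "\<lambda>x. (\<alpha> * snd d x) *\<^sub>R (mat 1 :: real ^ 'n ^ 'n)"
  have h: "?h \<in> L2 \<Omega>" by (intro L2_bounded_linear[OF hooke_bounded_linear] X_L2 d)
  have p: "?p \<in> L2 \<Omega>"
    by (rule L2_bounded_linear[OF bounded_linear_scaleR_const[OF bounded_linear_const_mult[OF bounded_linear_ident]]
        H1_L2[OF X_L2(2)[OF d]]])
  have "L2_norm \<Omega> ?h \<le> Ca * L2_norm \<Omega> (fst d)"
    using params Ca_pos
    by (intro L2_norm_mono[OF X_L2(1)[OF d] L2_measurable[OF h]] AE_I2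
        order_trans[OF norm_hooke_le mult_right_mono[OF Ca_ge(1)]]) auto
  moreover have "L2_norm \<Omega> ?p \<le> Ca * L2_norm \<Omega> (snd d)"
  proof (intro L2_norm_mono[OF H1_L2[OF X_L2(2)[OF d]] L2_measurable[OF p]] AE_I2)
    have "sqrt (real CARD('n)) \<le> real CARD('n)"
      by (rule real_le_lsqrt) (auto simp: power2_eq_square Suc_leI)
    then have "\<alpha> * sqrt (real CARD('n)) \<le> Ca"
      using mult_left_mono[of "sqrt (real CARD('n))" "real CARD('n)" \<alpha>] params Ca_ge(3) by (simp add: mult.commute)
    then show "norm (?p x) \<le> Ca * norm (snd d x)" for x
      using mult_right_mono[of "\<alpha> * sqrt (real CARD('n))" Ca "\<bar>snd d x\<bar>"] params
      by (simp add: norm_mat_1 abs_mult mult_ac)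
  qed (use Ca_pos in simp)
  moreover have "L2_norm \<Omega> (strs d) \<le> L2_norm \<Omega> ?h + L2_norm \<Omega> ?p"
    using L2.snorm_diff_triangle[OF h p] by (simp add: L2_norm_eq_snorm stress_def fun_diff_def)
  moreover have "Ca * L2_norm \<Omega> (fst d) \<le> Ca * X_norm \<Omega> d" "Ca * L2_norm \<Omega> (snd d) \<le> Ca * X_norm \<Omega> d"
    using X_norm_ge[of d] H1_norm_ge(1)[OF X_L2(2)[OF d]] Ca_pos by (auto intro!: mult_left_mono)
  ultimately show ?thesis by linarith
qed

lemma a_bounded:
  assumes w: "w \<in> X_space \<Omega>"
  shows "\<exists>M. \<forall>d\<in>X_space \<Omega>. \<forall>e\<in>X_space \<Omega>. \<bar>a w d e\<bar> \<le> M * X_norm \<Omega> d * X_norm \<Omega> e"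
proof (intro exI ballI)
  let ?K = "Linf_norm \<Omega> (\<kappa> w)" and ?s = "sqrt (real CARD('n))"
  fix d e assume d: "d \<in> X_space \<Omega>" and e: "e \<in> X_space \<Omega>"
  note nd = X_norm_ge[of d] H1_norm_ge[OF X_L2(2)[OF d]]
  note ne = X_norm_ge[of e] H1_norm_ge[OF X_L2(2)[OF e]]
  have N: "0 \<le> X_norm \<Omega> d" "0 \<le> X_norm \<Omega> e" using X.snorm_nonneg d e by (simp_all add: X_norm_eq)
  have "\<bar>L2_ip \<Omega> (strs d) (fst e)\<bar> \<le> (2 * Ca * X_norm \<Omega> d) * X_norm \<Omega> e"
    using N ne Ca_pos
    by (intro order_trans[OF L2_Cauchy_Schwarz[OF stress_L2[OF d] X_L2(1)[OF e]]] mult_mono stress_bound[OF d]) auto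
  moreover have "\<bar>L2_ip \<Omega> (\<lambda>x. \<kappa> w x *v grad \<Omega> (snd d) x) (grad \<Omega> (snd e))\<bar> \<le> (?K * X_norm \<Omega> d) * X_norm \<Omega> e"
    using N ne nd Linf_norm_bound(2)[OF \<kappa>_Linf[OF w]]
    by (intro order_trans[OF L2_Cauchy_Schwarz[OF kgrad_L2[OF w X_L2(2)[OF d]] grad_L2[OF X_L2(2)[OF e]]]] mult_mono
        order_trans[OF Linf_matrix_vector(2)[OF \<kappa>_Linf[OF w] grad_L2[OF X_L2(2)[OF d]]]] mult_left_mono) auto
  moreover have "\<bar>c0 * L2_ip \<Omega> (snd d) (snd e)\<bar> \<le> c0 * (X_norm \<Omega> d * X_norm \<Omega> e)"
    unfolding abs_mult using N ne nd params
    by (intro mult_mono order_trans[OF L2_Cauchy_Schwarz[OF H1_L2[OF X_L2(2)[OF d]] H1_L2[OF X_L2(2)[OF e]]]]) auto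
  moreover have "\<bar>\<alpha> * L2_ip \<Omega> (\<lambda>x. trace (fst d x)) (snd e)\<bar> \<le> \<alpha> * ((?s * X_norm \<Omega> d) * X_norm \<Omega> e)"
  proof -
    have "L2_norm \<Omega> (\<lambda>x. trace (fst d x)) \<le> ?s * L2_norm \<Omega> (fst d)"
      by (intro L2_norm_mono[OF X_L2(1)[OF d] L2_measurable[OF trace_L2[OF d]]] AE_I2) (auto simp: abs_trace_le)
    also have "\<dots> \<le> ?s * X_norm \<Omega> d" using nd by (intro mult_left_mono) auto
    finally show ?thesis
      unfolding abs_mult using N ne nd params
      by (intro mult_mono order_trans[OF L2_Cauchy_Schwarz[OF trace_L2[OF d] H1_L2[OF X_L2(2)[OF e]]]]) auto
  qed
  ultimately show "\<bar>a w d e\<bar> \<le> (2 * Ca + ?K + c0 + \<alpha> * ?s) * X_norm \<Omega> d * X_norm \<Omega> e"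
    unfolding a_eq[OF w d e] flow_def by (simp add: algebra_simps)
qed

text \<open>The two coupling terms are skew and cancel on the diagonal.\<close>

lemma a_coercive:
  assumes w: "w \<in> X_space \<Omega>" and d: "d \<in> X_space \<Omega>"
  shows "ca * (X_norm \<Omega> d)\<^sup>2 \<le> a w d d"
proof -
  obtain dd p where dp: "d = (dd, p)" by fastforce
  have m: "dd \<in> L2 \<Omega>" "p \<in> H1 \<Omega>" using d dp by (auto simp: X_space_def)
  have "2 * \<mu> * (L2_norm \<Omega> dd)\<^sup>2 \<le> (LINT x|lebesgue_on \<Omega>. hooke lam \<mu> (dd x) \<bullet> dd x)"
  proof -
    have "(LINT x|lebesgue_on \<Omega>. 2 * \<mu> * (norm (dd x))\<^sup>2) \<le> (LINT x|lebesgue_on \<Omega>. hooke lam \<mu> (dd x) \<bullet> dd x)"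
    proof (rule integral_mono_AE)
      show "integrable (lebesgue_on \<Omega>) (\<lambda>x. hooke lam \<mu> (dd x) \<bullet> dd x)"
        by (intro L2_integrable_inner L2_bounded_linear[OF hooke_bounded_linear] m)
      have "hooke lam \<mu> A \<bullet> A = lam * (trace A)\<^sup>2 + 2 * \<mu> * (norm A)\<^sup>2" for A :: "real ^ 'n ^ 'n"
        by (simp add: hooke_def inner_add_left trace_eq_inner[symmetric] power2_norm_eq_inner power2_eq_square[of "trace A"])
      then show "AE x in lebesgue_on \<Omega>. 2 * \<mu> * (norm (dd x))\<^sup>2 \<le> hooke lam \<mu> (dd x) \<bullet> dd x"
        using params by simp
    qed (use L2_integrable_norm[OF m(1)] in simp)
    then show ?thesis by (simp add: L2_norm_def)
  qed
  moreover have "\<kappa>1 * (L2_norm \<Omega> (grad \<Omega> p))\<^sup>2 \<le> (LINT x|lebesgue_on \<Omega>. (\<kappa> w x *v grad \<Omega> p x) \<bullet> grad \<Omega> p x)"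
  proof -
    have "(LINT x|lebesgue_on \<Omega>. \<kappa>1 * (norm (grad \<Omega> p x))\<^sup>2) \<le> (LINT x|lebesgue_on \<Omega>. (\<kappa> w x *v grad \<Omega> p x) \<bullet> grad \<Omega> p x)"
    proof (rule integral_mono_AE)
      show "integrable (lebesgue_on \<Omega>) (\<lambda>x. (\<kappa> w x *v grad \<Omega> p x) \<bullet> grad \<Omega> p x)"
        by (intro L2_integrable_inner kgrad_L2 grad_L2 w m)
      have "AE x in lebesgue_on \<Omega>. \<forall>v. \<kappa>1 * (norm v)\<^sup>2 \<le> v \<bullet> (\<kappa> w x *v v)"
        using perm(3) w by (auto simp: permeability_def)
      then show "AE x in lebesgue_on \<Omega>. \<kappa>1 * (norm (grad \<Omega> p x))\<^sup>2 \<le> (\<kappa> w x *v grad \<Omega> p x) \<bullet> grad \<Omega> p x"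
        by eventually_elim (simp add: inner_commute)
    qed (use L2_integrable_norm[OF grad_L2[OF m(2)]] in simp)
    then show ?thesis by (simp add: L2_norm_def)
  qed
  moreover have "(LINT x|lebesgue_on \<Omega>. p x * p x) = (L2_norm \<Omega> p)\<^sup>2"
    by (simp add: L2_norm_def power2_eq_square)
  ultimately have low: "2 * \<mu> * (L2_norm \<Omega> dd)\<^sup>2 + \<kappa>1 * (L2_norm \<Omega> (grad \<Omega> p))\<^sup>2 + c0 * (L2_norm \<Omega> p)\<^sup>2 \<le> a w d d"
    by (simp add: dp)
  have "ca * (X_norm \<Omega> d)\<^sup>2 = ca * (L2_norm \<Omega> dd)\<^sup>2 + ca * (L2_norm \<Omega> (grad \<Omega> p))\<^sup>2 + ca * (L2_norm \<Omega> p)\<^sup>2"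
    by (simp add: dp H1_norm_def distrib_left)
  also have "\<dots> \<le> 2 * \<mu> * (L2_norm \<Omega> dd)\<^sup>2 + \<kappa>1 * (L2_norm \<Omega> (grad \<Omega> p))\<^sup>2 + c0 * (L2_norm \<Omega> p)\<^sup>2"
    by (intro add_mono mult_right_mono ca_le) auto
  finally show ?thesis using low by simp
qed

text \<open>The second form does not see the strain and the pressure, so the supremum is a supremum over stresses. The constant
  identity tensor shows that it is taken over a nonempty set.\<close>

lemma inf_sup_estimate:
  assumes v: "v \<in> Z_space \<Omega>" and K: "0 \<le> K" "\<And>\<tau>. \<tau> \<in> Y_space \<Omega> \<Longrightarrow> \<bar>b2 \<tau> v\<bar> \<le> K * Y_norm \<Omega> \<tau>"
  shows "\<beta>2 * Z_norm \<Omega> v \<le> K"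
proof -
  let ?S = "{et \<in> X_space \<Omega> \<times> Y_space \<Omega>. XY_norm \<Omega> et \<noteq> 0}"
  have "\<beta>2 * Z_norm \<Omega> v \<le> (SUP et\<in>?S. b2_form \<Omega> et v / XY_norm \<Omega> et)"
    using beta(2) v by (simp add: inf_sup_b2_def)
  also have "\<dots> \<le> K"
  proof (rule cSUP_least)
    let ?e = "((\<lambda>x. mat 1, 0), 0) :: ('n X_elem \<times> 'n tensor_fld)"
    have "X_norm \<Omega> (fst ?e) > 0"
      using L2_norm_const_pos[of "mat 1 :: real ^ 'n ^ 'n"] X_norm_ge(1)[of "fst ?e"] norm_mat_1[where 'n = 'n]
      by (force simp del: X_norm.simps)
    then have "XY_norm \<Omega> ?e \<noteq> 0" by (simp add: XY_norm_def add_pos_nonneg del: X_norm.simps)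
    moreover have "?e \<in> X_space \<Omega> \<times> Y_space \<Omega>"
      using L2_const[of "mat 1 :: real ^ 'n ^ 'n"] H1.mem(1) Y.mem(1) by (simp add: X_space_def)
    ultimately show "?S \<noteq> {}" by blast
    fix et assume et: "et \<in> ?S"
    have Y: "0 \<le> Y_norm \<Omega> (snd et)" "Y_norm \<Omega> (snd et) \<le> XY_norm \<Omega> et"
      by (simp_all add: Y_norm_def[of _ "snd et"] XY_norm_def real_le_rsqrt)
    have pos: "XY_norm \<Omega> et > 0" using et by (simp add: XY_norm_def order.strict_iff_order)
    have "b2_form \<Omega> et v \<le> K * Y_norm \<Omega> (snd et)"
      using K(2)[of "snd et"] et by (auto simp: b2_form_eq)
    also have "\<dots> \<le> K * XY_norm \<Omega> et" using Y K(1) by (intro mult_left_mono)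
    finally show "b2_form \<Omega> et v / XY_norm \<Omega> et \<le> K" using pos by (simp add: field_simps)
  qed
  finally show ?thesis .
qed

sublocale S: inf_sup_form "Y_space \<Omega>" "Y_ip \<Omega>" "Z_space \<Omega>" "Z_ip \<Omega>" b2 \<beta>2 1
  by unfold_locales
    (use b2_linear1 b2_linear2 b2_bound inf_sup_estimate beta in \<open>auto simp: Y_norm_eq Z_norm_eq\<close>)

text \<open>Since the form is bounded by one, so is its inf-sup constant; a constant displacement is the witness.\<close>

lemma beta_le_1: "\<beta>2 \<le> 1"
proof -
  let ?v = "(\<lambda>x. vec 1, 0) :: 'n Z_elem"
  have v: "?v \<in> Z_space \<Omega>"
    using semi_inner.mem(1)[OF semi_hilbert.axioms(1)[OF L2_skew_semi_hilbert]] L2_const[of "vec 1 :: real ^ 'n"]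
    by (simp add: Z_space_def)
  have "L2_norm \<Omega> (\<lambda>x. vec 1 :: real ^ 'n) > 0"
    by (rule L2_norm_const_pos) (simp add: vec_eq_iff)
  then have pos: "Z_norm \<Omega> ?v > 0" by (simp add: add_pos_nonneg)
  have "\<beta>2 * Z_norm \<Omega> ?v \<le> Z_norm \<Omega> ?v"
    using b2_bound[OF _ v] pos by (intro inf_sup_estimate[OF v]) (auto simp: mult.commute)
  then show ?thesis using pos by simp
qed

end
section \<open>Estimates for the linearised problem\<close>

context poroelasticity
begin

text \<open>Each of the three equations involves only one of the three test elements.\<close>

lemma saddle_iff:
  "saddle_point_solution \<Omega> (a w) G H F d \<sigma> u \<longleftrightarrow>
    d \<in> X_space \<Omega> \<and> \<sigma> \<in> Y_space \<Omega> \<and> u \<in> Z_space \<Omega> \<and>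
    (\<forall>e\<in>X_space \<Omega>. a w d e - L2_ip \<Omega> \<sigma> (fst e) = G e) \<and>
    (\<forall>\<tau>\<in>Y_space \<Omega>. - L2_ip \<Omega> \<tau> (fst d) + b2 \<tau> u = H \<tau>) \<and>
    (\<forall>v\<in>Z_space \<Omega>. b2 \<sigma> v = F v)"
  unfolding saddle_point_solution_def b1_form_eq b2_form_eq snd_conv
  using X.mem(1) Y.mem(1) Z.mem(1) by auto

text \<open>Testing with the solution itself cancels the coupling terms and leaves the work of the stress. The part of the
  stress in \<open>Y0\<close> sees the strain only through the boundary datum, and the remaining part balances
  the load, so its norm is controlled by the inf-sup constant. The permeability enters through its lower bound alone, which
  makes the constant the same for all \<open>w\<close>.\<close>

lemma a_priori_estimate:
  assumes w: "w \<in> X_space \<Omega>" and sol: "saddle_point_solution \<Omega> (a w) G H F d \<sigma> u"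
    and G: "\<And>e. e \<in> X_space \<Omega> \<Longrightarrow> \<bar>G e\<bar> \<le> Kg * X_norm \<Omega> e" "\<And>e. e \<in> L2 \<Omega> \<Longrightarrow> G (e, 0) = 0"
    and H: "\<And>\<tau>. \<tau> \<in> Y_space \<Omega> \<Longrightarrow> \<bar>H \<tau>\<bar> \<le> Kh * Y_norm \<Omega> \<tau>"
    and F: "linear_form_on (Z_space \<Omega>) F" "\<And>v. v \<in> Z_space \<Omega> \<Longrightarrow> \<bar>F v\<bar> \<le> Kf * Z_norm \<Omega> v"
    and nn: "0 \<le> Kg" "0 \<le> Kh" "0 \<le> Kf"
  shows "X_norm \<Omega> d \<le> \<gamma>1 * (Kg + Kh + Kf)"
    and "L2_norm \<Omega> (\<sigma> - strs d) = 0"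
    and "L2_norm \<Omega> (tensor_div \<Omega> \<sigma>) \<le> Kf"
    and "\<beta>2 * Z_norm \<Omega> u \<le> Kh + X_norm \<Omega> d"
proof -
  have d: "d \<in> X_space \<Omega>" and \<sigma>: "\<sigma> \<in> Y_space \<Omega>" and u: "u \<in> Z_space \<Omega>"
    and eq1: "\<And>e. e \<in> X_space \<Omega> \<Longrightarrow> a w d e - L2_ip \<Omega> \<sigma> (fst e) = G e"
    and eq2: "\<And>\<tau>. \<tau> \<in> Y_space \<Omega> \<Longrightarrow> - L2_ip \<Omega> \<tau> (fst d) + b2 \<tau> u = H \<tau>"
    and eq3: "\<And>v. v \<in> Z_space \<Omega> \<Longrightarrow> b2 \<sigma> v = F v"
    using sol unfolding saddle_iff by blast+
  have Nd: "0 \<le> X_norm \<Omega> d" using X.snorm_nonneg[OF d] by (simp add: X_norm_eq)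
  show stress0: "L2_norm \<Omega> (\<sigma> - strs d) = 0"
  proof -
    let ?e = "\<sigma> - strs d"
    have e: "?e \<in> L2 \<Omega>" "(?e, 0) \<in> X_space \<Omega>"
      using Y_L2[OF \<sigma>] stress_L2[OF d] H1.mem(1) by (auto simp: X_space_def)
    have "flw w d 0 = 0" using linear_form_on_zero[OF flow_linear[OF w d] H1.sub] .
    then have "L2_ip \<Omega> (strs d) ?e - L2_ip \<Omega> \<sigma> ?e = 0"
      using eq1[OF e(2)] G(2)[OF e(1)] a_eq[OF w d e(2)] by simp
    then have "L2_ip \<Omega> ?e ?e = 0"
      using L2.diff_left[OF Y_L2[OF \<sigma>] stress_L2[OF d] e(1)] by simp
    then show ?thesis by (simp add: L2_norm_eq_snorm snorm_def)
  qed
  have \<sigma>_le: "L2_norm \<Omega> \<sigma> \<le> 2 * Ca * X_norm \<Omega> d"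
    using L2.snorm_diff_le[OF Y_L2[OF \<sigma>] stress_L2[OF d, of lam \<mu> \<alpha>]] stress0 stress_bound[OF d]
    by (simp add: L2_norm_eq_snorm)
  obtain \<sigma>f where \<sigma>f: "\<sigma>f \<in> Y_space \<Omega>" "\<And>v. v \<in> Z_space \<Omega> \<Longrightarrow> b2 \<sigma>f v = F v" "Y_norm \<Omega> \<sigma>f \<le> Kf / \<beta>2"
  proof (rule S.lifted_solution[OF F(1), of Kf])
    show "\<bar>F v\<bar> \<le> Kf * snorm (Z_ip \<Omega>) v" if "v \<in> Z_space \<Omega>" for v using F(2)[OF that] by (simp add: Z_norm_eq)
  qed (use nn that in \<open>auto simp: Y_norm_eq\<close>)
  define \<sigma>0 where "\<sigma>0 = \<sigma> - \<sigma>f"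
  have \<sigma>0: "\<sigma>0 \<in> Y0"
    using \<sigma> \<sigma>f eq3 linear_form_on_diff[OF b2_linear1 Y.sub \<sigma> \<sigma>f(1)]
    by (simp add: Y0_def \<sigma>0_def)
  have \<sigma>f_le: "L2_norm \<Omega> \<sigma>f \<le> Kf / \<beta>2" using Y_norm_ge(1)[OF \<sigma>f(1)] \<sigma>f(3) by simp
  have "L2_norm \<Omega> \<sigma>0 \<le> L2_norm \<Omega> \<sigma> + L2_norm \<Omega> \<sigma>f"
    using L2.snorm_diff_triangle[OF Y_L2[OF \<sigma>] Y_L2[OF \<sigma>f(1)]] by (simp add: L2_norm_eq_snorm \<sigma>0_def)
  then have \<sigma>0_le: "Y_norm \<Omega> \<sigma>0 \<le> 2 * Ca * X_norm \<Omega> d + Kf / \<beta>2"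
    using \<sigma>_le \<sigma>f_le Y0_norm[OF \<sigma>0] by simp
  have "ca * (X_norm \<Omega> d)\<^sup>2 \<le> G d + L2_ip \<Omega> \<sigma> (fst d)"
    using a_coercive[OF w d] eq1[OF d] by simp
  also have "L2_ip \<Omega> \<sigma> (fst d) = L2_ip \<Omega> \<sigma>0 (fst d) + L2_ip \<Omega> \<sigma>f (fst d)"
    using L2.diff_left[OF Y_L2[OF \<sigma>] Y_L2[OF \<sigma>f(1)] X_L2(1)[OF d]] by (simp add: \<sigma>0_def)
  also have "L2_ip \<Omega> \<sigma>0 (fst d) = - H \<sigma>0"
    using eq2[OF Y0_Y[OF \<sigma>0]] Y0_b2[OF \<sigma>0 u] by simp
  also have "G d + (- H \<sigma>0 + L2_ip \<Omega> \<sigma>f (fst d))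
      \<le> Kg * X_norm \<Omega> d + (Kh * (2 * Ca * X_norm \<Omega> d + Kf / \<beta>2) + Kf / \<beta>2 * X_norm \<Omega> d)"
  proof (intro add_mono)
    show "G d \<le> Kg * X_norm \<Omega> d" using G(1)[OF d] by simp
    have "- H \<sigma>0 \<le> Kh * Y_norm \<Omega> \<sigma>0" using H[OF Y0_Y[OF \<sigma>0]] by simp
    also have "\<dots> \<le> Kh * (2 * Ca * X_norm \<Omega> d + Kf / \<beta>2)" using \<sigma>0_le nn by (intro mult_left_mono)
    finally show "- H \<sigma>0 \<le> Kh * (2 * Ca * X_norm \<Omega> d + Kf / \<beta>2)" .
    have "L2_ip \<Omega> \<sigma>f (fst d) \<le> L2_norm \<Omega> \<sigma>f * L2_norm \<Omega> (fst d)"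
      using L2_Cauchy_Schwarz[OF Y_L2[OF \<sigma>f(1)] X_L2(1)[OF d]] by simp
    also have "\<dots> \<le> Kf / \<beta>2 * X_norm \<Omega> d"
      using \<sigma>f_le X_norm_ge(1)[of d] nn beta by (intro mult_mono) auto
    finally show "L2_ip \<Omega> \<sigma>f (fst d) \<le> Kf / \<beta>2 * X_norm \<Omega> d" .
  qed
  finally show "X_norm \<Omega> d \<le> \<gamma>1 * (Kg + Kh + Kf)"
    by (intro energy_estimate ca_pos ca_le_Ca beta beta_le_1 Nd nn) simp
  show "L2_norm \<Omega> (tensor_div \<Omega> \<sigma>) \<le> Kf"
  proof -
    let ?v = "(tensor_div \<Omega> \<sigma>, 0 :: 'n tensor_fld)"
    have v: "?v \<in> Z_space \<Omega>" by (rule div_test_Z[OF \<sigma>])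
    have N: "Z_norm \<Omega> ?v = L2_norm \<Omega> (tensor_div \<Omega> \<sigma>)"
      by (simp add: L2_norm_eq_snorm[of _ 0])
    have "(L2_norm \<Omega> (tensor_div \<Omega> \<sigma>))\<^sup>2 = - F ?v"
      using eq3[OF v] L2.snorm_sq[OF div_L2[OF \<sigma>]] L2_ip_zero_right[OF Y_L2[OF \<sigma>]]
      by (simp add: b2_def L2_norm_eq_snorm)
    also have "\<dots> \<le> Kf * L2_norm \<Omega> (tensor_div \<Omega> \<sigma>)" using F(2)[OF v] N by simp
    finally show ?thesis
      using mult_right_le_imp_le[of "L2_norm \<Omega> (tensor_div \<Omega> \<sigma>)" "L2_norm \<Omega> (tensor_div \<Omega> \<sigma>)" Kf] nn
      by (cases "L2_norm \<Omega> (tensor_div \<Omega> \<sigma>) = 0") (auto simp: power2_eq_square order.strict_iff_order)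
  qed
  show "\<beta>2 * Z_norm \<Omega> u \<le> Kh + X_norm \<Omega> d"
  proof (rule inf_sup_estimate[OF u])
    show "\<bar>b2 \<tau> u\<bar> \<le> (Kh + X_norm \<Omega> d) * Y_norm \<Omega> \<tau>" if \<tau>: "\<tau> \<in> Y_space \<Omega>" for \<tau>
    proof -
      have "\<bar>b2 \<tau> u\<bar> \<le> \<bar>H \<tau>\<bar> + \<bar>L2_ip \<Omega> \<tau> (fst d)\<bar>" using eq2[OF \<tau>] by simp
      also have "\<bar>L2_ip \<Omega> \<tau> (fst d)\<bar> \<le> L2_norm \<Omega> \<tau> * L2_norm \<Omega> (fst d)"
        by (rule L2_Cauchy_Schwarz[OF Y_L2[OF \<tau>] X_L2(1)[OF d]])
      also have "\<dots> \<le> Y_norm \<Omega> \<tau> * X_norm \<Omega> d"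
        using Y_norm_ge(1)[OF \<tau>] X_norm_ge(1)[of d] order_trans[OF L2_norm_nonneg Y_norm_ge(1)[OF \<tau>]]
        by (intro mult_mono) auto
      finally show ?thesis using H[OF \<tau>] by (simp add: algebra_simps)
    qed
  qed (use nn Nd in simp)
qed

text \<open>Both problems have the same data; in the problem for \<open>w\<close>, the difference of the permeabilities acts as a
  source in the pressure equation.\<close>

lemma saddle_difference:
  assumes w: "w \<in> X_space \<Omega>" "w' \<in> X_space \<Omega>"
    and sol: "saddle_point_solution \<Omega> (a w) G H F d \<sigma> u"
    and sol': "saddle_point_solution \<Omega> (a w') G H F d' \<sigma>' u'"
  shows "saddle_point_solution \<Omega> (a w) (\<lambda>e. a w' d' e - a w d' e) (\<lambda>_. 0) (\<lambda>_. 0) (d - d') (\<sigma> - \<sigma>') (u - u')"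
proof -
  note s = sol[unfolded saddle_iff] sol'[unfolded saddle_iff]
  have m: "d \<in> X_space \<Omega>" "d' \<in> X_space \<Omega>" "\<sigma> \<in> Y_space \<Omega>" "\<sigma>' \<in> Y_space \<Omega>" "u \<in> Z_space \<Omega>" "u' \<in> Z_space \<Omega>"
    using s by blast+
  have "a w (d - d') e - L2_ip \<Omega> (\<sigma> - \<sigma>') (fst e) = a w' d' e - a w d' e" if e: "e \<in> X_space \<Omega>" for e
  proof -
    have "a w d e - L2_ip \<Omega> \<sigma> (fst e) = G e" "a w' d' e - L2_ip \<Omega> \<sigma>' (fst e) = G e" using s e by blast+
    then show ?thesis
      using linear_form_on_diff[OF a_linear(2)[OF w(1) e] X.sub m(1,2)] L2.diff_left[OF Y_L2[OF m(3)] Y_L2[OF m(4)] X_L2(1)[OF e]]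
      by simp
  qed
  moreover have "- L2_ip \<Omega> \<tau> (fst (d - d')) + b2 \<tau> (u - u') = 0" if \<tau>: "\<tau> \<in> Y_space \<Omega>" for \<tau>
  proof -
    have "- L2_ip \<Omega> \<tau> (fst d) + b2 \<tau> u = H \<tau>" "- L2_ip \<Omega> \<tau> (fst d') + b2 \<tau> u' = H \<tau>" using s \<tau> by blast+
    then show ?thesis
      using linear_form_on_diff[OF b2_linear2[OF \<tau>] Z.sub m(5,6)] L2.diff_right[OF X_L2(1)[OF m(1)] X_L2(1)[OF m(2)] Y_L2[OF \<tau>]]
      by (simp add: fst_diff)
  qed
  moreover have "b2 (\<sigma> - \<sigma>') v = 0" if v: "v \<in> Z_space \<Omega>" for v
  proof -
    have "b2 \<sigma> v = F v" "b2 \<sigma>' v = F v" using s v by blast+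
    then show ?thesis using linear_form_on_diff[OF b2_linear1[OF v] Y.sub m(3,4)] by simp
  qed
  ultimately show ?thesis unfolding saddle_iff using m by auto
qed

lemma permeability_perturbation:
  assumes w: "w \<in> X_space \<Omega>" "w' \<in> X_space \<Omega>" and d: "d \<in> X_space \<Omega>" and e: "e \<in> X_space \<Omega>"
  shows "\<bar>a w' d e - a w d e\<bar> \<le> \<kappa>2 * X_norm \<Omega> (w - w') * X_norm \<Omega> d * X_norm \<Omega> e"
proof -
  let ?A = "\<lambda>x. \<kappa> w' x - \<kappa> w x" and ?p = "grad \<Omega> (snd d)" and ?q = "grad \<Omega> (snd e)"
  have "?A \<in> Linf \<Omega>"
  proof -
    obtain c c' where "AE x in lebesgue_on \<Omega>. norm (\<kappa> w x) \<le> c" "AE x in lebesgue_on \<Omega>. norm (\<kappa> w' x) \<le> c'"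
      using \<kappa>_Linf[OF w(1)] \<kappa>_Linf[OF w(2)] unfolding Linf_def by blast
    then have "AE x in lebesgue_on \<Omega>. norm (?A x) \<le> c' + c"
      by eventually_elim (rule order_trans[OF norm_triangle_ineq4], simp)
    then show ?thesis using \<kappa>_Linf[OF w(1)] \<kappa>_Linf[OF w(2)] by (auto simp: Linf_def)
  qed
  note A = Linf_matrix_vector[OF this grad_L2[OF X_L2(2)[OF d]]]
  have eq: "(\<lambda>x. ?A x *v ?p x) = (\<lambda>x. \<kappa> w' x *v ?p x) - (\<lambda>x. \<kappa> w x *v ?p x)"
    by (simp add: fun_eq_iff matrix_vector_mult_diff_rdistrib)
  have "a w' d e - a w d e = L2_ip \<Omega> (\<lambda>x. ?A x *v ?p x) ?q"
    unfolding eq a_eq[OF w(1) d e] a_eq[OF w(2) d e] flow_def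
    using L2.diff_left[OF kgrad_L2[OF w(2) X_L2(2)[OF d]] kgrad_L2[OF w(1) X_L2(2)[OF d]] grad_L2[OF X_L2(2)[OF e]]]
    by simp
  also have "\<bar>\<dots>\<bar> \<le> L2_norm \<Omega> (\<lambda>x. ?A x *v ?p x) * L2_norm \<Omega> ?q"
    by (rule L2_Cauchy_Schwarz[OF A(1) grad_L2[OF X_L2(2)[OF e]]])
  also have "\<dots> \<le> (\<kappa>2 * X_norm \<Omega> (w - w') * X_norm \<Omega> d) * X_norm \<Omega> e"
  proof (rule mult_mono)
    have "Linf_norm \<Omega> ?A \<le> \<kappa>2 * H1_norm \<Omega> (snd w' - snd w)"
      using perm(3) w unfolding permeability_def X_space_def fun_diff_def by (cases w, cases w') auto
    also have "H1_norm \<Omega> (snd w' - snd w) = H1_norm \<Omega> (snd (w - w'))"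
      using H1.snorm_diff_commute[OF X_L2(2)[OF w(2)] X_L2(2)[OF w(1)]] by (simp add: H1_norm_eq snd_diff)
    also have "\<kappa>2 * \<dots> \<le> \<kappa>2 * X_norm \<Omega> (w - w')" using X_norm_ge(2)[of "w - w'"] perm by (intro mult_left_mono) auto
    finally have "Linf_norm \<Omega> ?A \<le> \<kappa>2 * X_norm \<Omega> (w - w')" .
    moreover have "L2_norm \<Omega> ?p \<le> X_norm \<Omega> d"
      using H1_norm_ge(2)[OF X_L2(2)[OF d]] X_norm_ge(2)[of d] by simp
    moreover have "0 \<le> X_norm \<Omega> (w - w')" using X.snorm_nonneg[of "w - w'"] w by (simp add: X_norm_eq)
    ultimately show "L2_norm \<Omega> (\<lambda>x. ?A x *v ?p x) \<le> \<kappa>2 * X_norm \<Omega> (w - w') * X_norm \<Omega> d"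
      using perm by (intro order_trans[OF A(2)] mult_mono) auto
    show "L2_norm \<Omega> ?q \<le> X_norm \<Omega> e"
      using H1_norm_ge(2)[OF X_L2(2)[OF e]] X_norm_ge(2)[of e] by simp
    show "0 \<le> \<kappa>2 * X_norm \<Omega> (w - w') * X_norm \<Omega> d"
      using perm \<open>0 \<le> X_norm \<Omega> (w - w')\<close> X.snorm_nonneg[OF d] by (simp add: X_norm_eq)
  qed simp
  finally show ?thesis .
qed

text \<open>The a priori estimate for the difference. Without a difference of the points of linearisation it
  yields uniqueness.\<close>

lemma stability:
  assumes w: "w \<in> X_space \<Omega>" "w' \<in> X_space \<Omega>"
    and sol: "saddle_point_solution \<Omega> (a w) G H F d \<sigma> u"
    and sol': "saddle_point_solution \<Omega> (a w') G H F d' \<sigma>' u'"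
  shows "X_norm \<Omega> (d - d') \<le> \<gamma>1 * (\<kappa>2 * X_norm \<Omega> (w - w') * X_norm \<Omega> d')"
    and "X_norm \<Omega> (w - w') = 0 \<Longrightarrow> X_norm \<Omega> (d - d') = 0 \<and> L2_norm \<Omega> (\<sigma> - \<sigma>') = 0 \<and> Z_norm \<Omega> (u - u') = 0"
proof -
  have d: "d \<in> X_space \<Omega>" "d' \<in> X_space \<Omega>" and u: "u - u' \<in> Z_space \<Omega>" and \<sigma>: "\<sigma> - \<sigma>' \<in> Y_space \<Omega>"
    using sol sol' unfolding saddle_iff by auto
  let ?K = "\<kappa>2 * X_norm \<Omega> (w - w') * X_norm \<Omega> d'"
  have N: "0 \<le> X_norm \<Omega> d'" "0 \<le> X_norm \<Omega> (w - w')" "0 \<le> X_norm \<Omega> (d - d')"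
    using X.snorm_nonneg d w by (simp_all add: X_norm_eq)
  note S = saddle_difference[OF w sol sol']
  have P0: "a w' d' (e, 0) - a w d' (e, 0) = 0" if "e \<in> L2 \<Omega>" for e
  proof -
    have e: "(e, 0) \<in> X_space \<Omega>" using that H1.mem(1) by (simp add: X_space_def)
    show ?thesis
      using linear_form_on_zero[OF flow_linear[OF w(1) d(2)] H1.sub] linear_form_on_zero[OF flow_linear[OF w(2) d(2)] H1.sub]
      by (simp add: a_eq[OF w(1) d(2) e] a_eq[OF w(2) d(2) e])
  qed
  note est = a_priori_estimate[OF w(1) S, of ?K 0 0, OF permeability_perturbation[OF w d(2)] P0]
  have nn: "0 \<le> ?K" using N perm by simp
  show le: "X_norm \<Omega> (d - d') \<le> \<gamma>1 * (\<kappa>2 * X_norm \<Omega> (w - w') * X_norm \<Omega> d')"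
    using est(1) nn by (simp add: linear_form_on_def)
  assume 0: "X_norm \<Omega> (w - w') = 0"
  then have d0: "X_norm \<Omega> (d - d') = 0" using le N by simp
  have "L2_norm \<Omega> (\<sigma> - \<sigma>' - strs (d - d')) = 0"
    using est(2) nn by (simp add: linear_form_on_def)
  moreover have "L2_norm \<Omega> (strs (d - d')) = 0"
    using stress_bound[of "d - d'"] d d0 L2_norm_nonneg[of \<Omega> "strs (d - d')"] by simp
  ultimately have "L2_norm \<Omega> (\<sigma> - \<sigma>') = 0"
    using L2.snorm_diff_le[OF Y_L2[OF \<sigma>] stress_L2[of "d - d'" lam \<mu> \<alpha>]] d by (simp add: L2_norm_eq_snorm)
  moreover have "\<beta>2 * Z_norm \<Omega> (u - u') \<le> 0 + X_norm \<Omega> (d - d')"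
    using est(4) nn by (simp add: linear_form_on_def)
  then have "Z_norm \<Omega> (u - u') = 0"
    using d0 beta Z.snorm_nonneg[OF u] by (simp add: Z_norm_eq mult_le_0_iff)
  ultimately show "X_norm \<Omega> (d - d') = 0 \<and> L2_norm \<Omega> (\<sigma> - \<sigma>') = 0 \<and> Z_norm \<Omega> (u - u') = 0"
    using d0 by simp
qed


section \<open>Solvability of the linearised problem\<close>

text \<open>Splitting off a stress \<open>\<sigma>f\<close> that balances the load and a strain \<open>dH\<close> that carries the boundary displacement leaves
  an equation for strains orthogonal to \<open>Y0\<close>, which is coercive. Its residual is then a stress in
  \<open>Y0\<close>, and the second equation holds on \<open>Y0\<close>, so that the closed range theorem gives the
  displacement and the rotation.\<close>

lemma linear_problem_solvable:
  assumes w: "w \<in> X_space \<Omega>"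
    and f: "f \<in> L2 \<Omega>" and g: "g \<in> L2 \<Omega>" and u\<Gamma>: "u\<^sub>\<Gamma> \<in> H_half_vec \<Omega>" and r\<Gamma>: "r\<^sub>\<Gamma> \<in> H_mhalf \<Omega>"
  shows "\<exists>d \<sigma> u. lin_solution \<Omega> lam \<mu> \<alpha> c0 \<kappa> f g u\<^sub>\<Gamma> r\<^sub>\<Gamma> w d \<sigma> u"
proof -
  let ?G = "G_fun \<Omega> g r\<^sub>\<Gamma>" and ?H = "H_fun \<Omega> u\<^sub>\<Gamma>" and ?F = "F_fun \<Omega> f"
  note G = G_fun_bound[OF g r\<Gamma>]
  note F = F_fun_bound[OF f]
  have Gsnd: "?G e = ?G (0, snd e)" for e by (simp add: G_fun_def)
  \<comment> \<open>A stress in equilibrium with the load.\<close>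
  obtain \<sigma>f where \<sigma>f: "\<sigma>f \<in> Y_space \<Omega>" "\<And>v. v \<in> Z_space \<Omega> \<Longrightarrow> b2 \<sigma>f v = ?F v"
  proof (rule S.lifted_solution[OF F(1), of "L2_norm \<Omega> f"])
    show "\<bar>?F v\<bar> \<le> L2_norm \<Omega> f * snorm (Z_ip \<Omega>) v" if "v \<in> Z_space \<Omega>" for v
      using F(2)[OF that] by (simp add: Z_norm_eq)
  qed (use that in auto)
  \<comment> \<open>A strain carrying the boundary displacement.\<close>
  obtain v where v: "v \<in> H1_vec \<Omega>" "\<And>\<tau>. ?H \<tau> = - green \<tau> v"
    and H_le: "\<And>\<tau>. \<tau> \<in> Y_space \<Omega> \<Longrightarrow> \<bar>?H \<tau>\<bar> \<le> H_half_vec_norm \<Omega> u\<^sub>\<Gamma> * Y_norm \<Omega> \<tau>"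
    using H_fun_representation[OF u\<Gamma>] by metis
  define dH :: "'n X_elem" where "dH = (grad_vec \<Omega> v, 0)"
  have dH: "dH \<in> X_space \<Omega>" using H1_vec_L2[OF v(1)] H1.mem(1) by (simp add: dH_def X_space_def)
  have H_Y0: "?H \<tau> = - L2_ip \<Omega> \<tau> (fst dH)" if "\<tau> \<in> Y0" for \<tau>
    using L2_Cauchy_Schwarz[OF H1_vec_L2(1)[OF v(1)] div_L2[OF Y0_Y[OF that]]] Y0_div[OF that]
    by (simp add: v(2) green_def dH_def)
  define V where "V = {e \<in> X_space \<Omega>. \<forall>\<tau>\<in>Y0. L2_ip \<Omega> \<tau> (fst e) = 0}"
  have lin_fst: "linear_form_on (X_space \<Omega>) (\<lambda>e. L2_ip \<Omega> \<tau> (fst e))" if "\<tau> \<in> L2 \<Omega>" for \<tau>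
    using L2.lin_right[OF that] by (auto simp: linear_form_on_def X_space_def)
  have fst_le: "\<bar>L2_ip \<Omega> \<tau> (fst e)\<bar> \<le> L2_norm \<Omega> \<tau> * X_norm \<Omega> e" if "\<tau> \<in> L2 \<Omega>" "e \<in> X_space \<Omega>" for \<tau> e
    using X_norm_ge(1)[of e]
    by (intro order_trans[OF L2_Cauchy_Schwarz[OF that(1) X_L2(1)[OF that(2)]]] mult_left_mono) auto
  have "semi_hilbert V (X_ip \<Omega>)"
    unfolding V_def
  proof (rule X.kernel_semi_hilbert)
    show "linear_form_on (X_space \<Omega>) (\<lambda>e. L2_ip \<Omega> \<tau> (fst e))" if "\<tau> \<in> Y0" for \<tau>
      using lin_fst Y_L2[OF Y0_Y[OF that]] by blast
    show "\<exists>K. \<forall>e\<in>X_space \<Omega>. \<bar>L2_ip \<Omega> \<tau> (fst e)\<bar> \<le> K * snorm (X_ip \<Omega>) e" if "\<tau> \<in> Y0" for \<tau>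
      using fst_le[OF Y_L2[OF Y0_Y[OF that]]] unfolding X_norm_eq by blast
  qed
  then interpret V: semi_hilbert V "X_ip \<Omega>" .
  have VX: "e \<in> X_space \<Omega>" if "e \<in> V" for e using that by (simp add: V_def)
  have VX': "V \<subseteq> X_space \<Omega>" by (auto simp: V_def)
  obtain M where M: "\<And>d e. d \<in> X_space \<Omega> \<Longrightarrow> e \<in> X_space \<Omega> \<Longrightarrow> \<bar>a w d e\<bar> \<le> M * X_norm \<Omega> d * X_norm \<Omega> e"
    using a_bounded[OF w] by blast
  have "\<exists>d0\<in>V. \<forall>e\<in>V. a w d0 e = ?G e + L2_ip \<Omega> \<sigma>f (fst e) - a w dH e"
  proof (rule V.Lax_Milgram)
    show "linear_form_on V (\<lambda>x. a w x y)" if "y \<in> V" for y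
      by (rule linear_form_on_sub[OF a_linear(2)[OF w VX[OF that]] VX'])
    show "linear_form_on V (a w x)" if "x \<in> V" for x
      by (rule linear_form_on_sub[OF a_linear(1)[OF w VX[OF that]] VX'])
    show "\<bar>a w x y\<bar> \<le> M * snorm (X_ip \<Omega>) x * snorm (X_ip \<Omega>) y" if "x \<in> V" "y \<in> V" for x y
      using M[OF VX VX] that by (simp add: X_norm_eq)
    show "ca * (snorm (X_ip \<Omega>) x)\<^sup>2 \<le> a w x x" if "x \<in> V" for x
      using a_coercive[OF w VX[OF that]] by (simp add: X_norm_eq)
    show "linear_form_on V (\<lambda>e. ?G e + L2_ip \<Omega> \<sigma>f (fst e) - a w dH e)"
      by (intro linear_form_on_sub[OF _ VX'] linear_form_on_minus linear_form_on_plus G lin_fst Y_L2 \<sigma>f a_linear(1) w dH)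
    show "\<bar>?G e + L2_ip \<Omega> \<sigma>f (fst e) - a w dH e\<bar>
        \<le> ((L2_norm \<Omega> g + H_mhalf_norm \<Omega> r\<^sub>\<Gamma>) + L2_norm \<Omega> \<sigma>f + M * X_norm \<Omega> dH) * snorm (X_ip \<Omega>) e" if "e \<in> V" for e
      using G(2)[OF VX[OF that]] fst_le[OF Y_L2[OF \<sigma>f(1)] VX[OF that]] M[OF dH VX[OF that]]
      by (simp add: X_norm_eq[of e, symmetric] distrib_right)
  qed (rule ca_pos)
  then obtain d0 where d0: "d0 \<in> V" "\<And>e. e \<in> V \<Longrightarrow> a w d0 e = ?G e + L2_ip \<Omega> \<sigma>f (fst e) - a w dH e" by blast
  define d where "d = d0 + dH"
  have d: "d \<in> X_space \<Omega>" using VX[OF d0(1)] dH by (simp add: d_def)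
  have eqV: "a w d e = ?G e + L2_ip \<Omega> \<sigma>f (fst e)" if "e \<in> V" for e
    using d0(2)[OF that] linear_form_on_add[OF a_linear(2)[OF w VX[OF that]] VX[OF d0(1)] dH] by (simp add: d_def)
  have flow_eq: "flw w d q = ?G (0, q)" if q: "q \<in> H1 \<Omega>" for q
  proof -
    have X: "(0, q) \<in> X_space \<Omega>" using q L2.mem(1) by (simp add: X_space_def)
    then have "(0, q) \<in> V" using Y_L2[OF Y0_Y] by (simp add: V_def L2_ip_zero_right)
    from eqV[OF this] show ?thesis
      using a_eq[OF w d X] stress_L2[OF d] Y_L2[OF \<sigma>f(1)] by (simp add: L2_ip_zero_right)
  qed
  \<comment> \<open>The residual stress is orthogonal to everything orthogonal to \<open>Y0\<close>, hence lies in \<open>Y0\<close>.\<close>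
  define \<rho> where "\<rho> = strs d - \<sigma>f"
  have \<rho>: "\<rho> \<in> L2 \<Omega>" using stress_L2[OF d] Y_L2[OF \<sigma>f(1)] by (simp add: \<rho>_def)
  interpret Y0: semi_hilbert Y0 "Y_ip \<Omega>" by (rule Y0_semi_hilbert)
  have "\<exists>\<rho>0\<in>Y0. \<forall>\<tau>\<in>Y0. Y_ip \<Omega> \<rho>0 \<tau> = L2_ip \<Omega> \<rho> \<tau>"
  proof (rule Y0.Riesz_representation[where K = "L2_norm \<Omega> \<rho>"])
    show "linear_form_on Y0 (L2_ip \<Omega> \<rho>)"
      by (rule linear_form_on_sub[OF L2.lin_right[OF \<rho>]]) (use Y_L2 Y0_Y in blast)
    show "\<bar>L2_ip \<Omega> \<rho> \<tau>\<bar> \<le> L2_norm \<Omega> \<rho> * snorm (Y_ip \<Omega>) \<tau>" if "\<tau> \<in> Y0" for \<tau>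
      using L2_Cauchy_Schwarz[OF \<rho> Y_L2[OF Y0_Y[OF that]]] Y0_norm[OF that] by (simp add: Y_norm_eq)
  qed
  then obtain \<rho>0 where \<rho>0: "\<rho>0 \<in> Y0" "\<And>\<tau>. \<tau> \<in> Y0 \<Longrightarrow> Y_ip \<Omega> \<rho>0 \<tau> = L2_ip \<Omega> \<rho> \<tau>" by blast
  have \<rho>0L: "\<rho>0 \<in> L2 \<Omega>" using \<rho>0 Y_L2 Y0_Y by blast
  define e0 where "e0 = \<rho> - \<rho>0"
  have e0: "e0 \<in> L2 \<Omega>" using \<rho> \<rho>0L by (simp add: e0_def)
  have orth: "L2_ip \<Omega> \<tau> e0 = 0" if \<tau>: "\<tau> \<in> Y0" for \<tau>
  proof -
    have "L2_ip \<Omega> (tensor_div \<Omega> \<rho>0) (tensor_div \<Omega> \<tau>) = 0"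
      using L2_Cauchy_Schwarz[OF div_L2[OF Y0_Y[OF \<rho>0(1)]] div_L2[OF Y0_Y[OF \<tau>]]] Y0_div[OF \<tau>] by simp
    then have "L2_ip \<Omega> \<rho>0 \<tau> = L2_ip \<Omega> \<rho> \<tau>" using \<rho>0(2)[OF \<tau>] by (simp add: Y_ip_def)
    then show ?thesis
      using \<rho> \<rho>0L Y_L2[OF Y0_Y[OF \<tau>]] by (simp add: e0_def L2.diff_right L2.sym[of \<tau>])
  qed
  have e0V: "(e0, 0) \<in> V" using e0 orth H1.mem(1) by (simp add: V_def X_space_def)
  have "flw w d 0 = ?G (0, 0)" by (rule flow_eq[OF H1.mem(1)])
  then have "L2_ip \<Omega> \<rho> e0 = 0"
    using eqV[OF e0V] Gsnd[of "(e0, 0)"] a_eq[OF w d VX[OF e0V]] stress_L2[OF d] Y_L2[OF \<sigma>f(1)] e0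
    by (simp add: \<rho>_def L2.diff_left)
  then have "L2_ip \<Omega> e0 e0 = 0"
    using orth[OF \<rho>0(1)] L2.diff_left[OF \<rho> \<rho>0L e0] by (simp add: e0_def)
  then have "snorm (L2_ip \<Omega>) e0 = 0" by (simp add: snorm_def)
  then have \<rho>_eq: "L2_ip \<Omega> \<rho> e = L2_ip \<Omega> \<rho>0 e" if "e \<in> L2 \<Omega>" for e
    using L2.null_left[OF e0 _ that] L2.diff_left[OF \<rho> \<rho>0L that] by (simp add: e0_def)
  define \<sigma> where "\<sigma> = \<sigma>f + \<rho>0"
  have \<sigma>: "\<sigma> \<in> Y_space \<Omega>" using \<sigma>f \<rho>0 Y0_Y by (simp add: \<sigma>_def)
  have eq1: "a w d e - L2_ip \<Omega> \<sigma> (fst e) = ?G e" if e: "e \<in> X_space \<Omega>" for e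
    using a_eq[OF w d e] flow_eq[OF X_L2(2)[OF e]] Gsnd[of e] \<rho>_eq[OF X_L2(1)[OF e]]
      L2.add_left[OF Y_L2[OF \<sigma>f(1)] \<rho>0L X_L2(1)[OF e]] L2.diff_left[OF stress_L2[OF d] Y_L2[OF \<sigma>f(1)] X_L2(1)[OF e]]
    by (simp add: \<sigma>_def \<rho>_def)
  have eq3: "b2 \<sigma> v = ?F v" if "v \<in> Z_space \<Omega>" for v
    using linear_form_on_add[OF b2_linear1[OF that] \<sigma>f(1) Y0_Y[OF \<rho>0(1)]] \<sigma>f(2)[OF that] Y0_b2[OF \<rho>0(1) that]
    by (simp add: \<sigma>_def)
  have lin_d: "linear_form_on (Y_space \<Omega>) (\<lambda>\<tau>. L2_ip \<Omega> \<tau> (fst d))"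
    by (rule linear_form_on_sub[OF L2.lin[OF X_L2(1)[OF d]]]) (auto simp: Y_L2)
  have "\<exists>u\<in>Z_space \<Omega>. \<forall>\<tau>\<in>Y_space \<Omega>. b2 \<tau> u = ?H \<tau> + L2_ip \<Omega> \<tau> (fst d)"
  proof (rule S.closed_range)
    show "linear_form_on (Y_space \<Omega>) (\<lambda>\<tau>. ?H \<tau> + L2_ip \<Omega> \<tau> (fst d))"
      by (intro linear_form_on_plus H_fun_linear[OF u\<Gamma>] lin_d)
    show "\<bar>?H \<tau> + L2_ip \<Omega> \<tau> (fst d)\<bar> \<le> (H_half_vec_norm \<Omega> u\<^sub>\<Gamma> + L2_norm \<Omega> (fst d)) * snorm (Y_ip \<Omega>) \<tau>"
      if \<tau>: "\<tau> \<in> Y_space \<Omega>" for \<tau>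
      using H_le[OF \<tau>] L2_Cauchy_Schwarz[OF Y_L2[OF \<tau>] X_L2(1)[OF d]]
        mult_right_mono[OF Y_norm_ge(1)[OF \<tau>] L2_norm_nonneg, of \<Omega> "fst d"]
      by (simp add: Y_norm_eq[symmetric] algebra_simps)
    fix \<tau> assume "\<tau> \<in> Y_space \<Omega>" "\<And>v. v \<in> Z_space \<Omega> \<Longrightarrow> b2 \<tau> v = 0"
    then have \<tau>: "\<tau> \<in> Y0" by (simp add: Y0_def)
    then have "L2_ip \<Omega> \<tau> (fst d0) = 0" using d0(1) by (simp add: V_def)
    then show "?H \<tau> + L2_ip \<Omega> \<tau> (fst d) = 0"
      using H_Y0[OF \<tau>] L2.add_right[OF X_L2(1)[OF VX[OF d0(1)]] X_L2(1)[OF dH] Y_L2[OF Y0_Y[OF \<tau>]]]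
      by (simp add: d_def)
  qed
  then obtain u where u: "u \<in> Z_space \<Omega>" "\<And>\<tau>. \<tau> \<in> Y_space \<Omega> \<Longrightarrow> b2 \<tau> u = ?H \<tau> + L2_ip \<Omega> \<tau> (fst d)" by blast
  have "saddle_point_solution \<Omega> (a w) ?G ?H ?F d \<sigma> u"
    unfolding saddle_iff using d \<sigma> u eq1 eq3 by simp
  then show ?thesis unfolding lin_solution_def by blast
qed

end
section \<open>The fixed point\<close>

context bounded_open
begin

text \<open>Zero is a weak gradient of a function that vanishes almost everywhere.\<close>

lemma H1_null:
  assumes q: "q \<in> H1 \<Omega>" and 0: "L2_norm \<Omega> q = 0" shows "H1_norm \<Omega> q = 0"
proof -
  have "grad.weak q 0"
    unfolding grad.weak_def using L2.null_left[OF H1_L2[OF q]] 0 grad.A grad.E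
    by (auto simp: L2_norm_eq_snorm L2_ip_def)
  then have "L2_norm \<Omega> (grad \<Omega> q - 0) = 0"
    using grad_unique[of 0 q] H1_L2[OF q] L2.mem(1) by (simp add: has_weak_grad_iff)
  then show ?thesis using 0 by (simp add: H1_norm_def)
qed

lemma pair_ae_eq_X:
  assumes "d \<in> X_space \<Omega>" "d' \<in> X_space \<Omega>"
  shows "pair_ae_eq \<Omega> d d' \<longleftrightarrow> X_norm \<Omega> (d - d') = 0"
proof -
  have m: "fst d \<in> L2 \<Omega>" "fst d' \<in> L2 \<Omega>" "snd d \<in> H1 \<Omega>" "snd d' \<in> H1 \<Omega>" using assms by (simp_all add: X_L2)
  have "X_norm \<Omega> (d - d') = 0 \<longleftrightarrow> L2_norm \<Omega> (fst d - fst d') = 0 \<and> H1_norm \<Omega> (snd d - snd d') = 0"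
    by (cases d; cases d') (simp add: sum_power2_eq_zero_iff)
  moreover have "H1_norm \<Omega> (snd d - snd d') = 0 \<longleftrightarrow> L2_norm \<Omega> (snd d - snd d') = 0"
    using H1_null[of "snd d - snd d'"] H1_norm_ge(1)[of "snd d - snd d'"] m L2_norm_nonneg[of \<Omega> "snd d - snd d'"]
    by (auto simp del: L2_norm_nonneg)
  ultimately show ?thesis
    using m by (simp add: pair_ae_eq_def ae_eq_iff_snorm H1_L2 L2_norm_eq_snorm)
qed

lemma pair_ae_eq_Z:
  assumes "u \<in> Z_space \<Omega>" "u' \<in> Z_space \<Omega>"
  shows "pair_ae_eq \<Omega> u u' \<longleftrightarrow> Z_norm \<Omega> (u - u') = 0"
  using assms by (cases u; cases u')
    (auto simp: pair_ae_eq_def ae_eq_iff_snorm Z_space_def L2_skew_def L2_norm_eq_snorm sum_power2_eq_zero_iff)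

end

locale poroelasticity_data = poroelasticity \<Omega> for \<Omega> :: "(real ^ 'n::finite) set" +
  fixes f :: "'n vector_fld" and g :: "'n scalar_fld"
    and u\<^sub>\<Gamma> :: "'n vector_fld set" and r\<^sub>\<Gamma> :: "'n scalar_fld set \<Rightarrow> real"
  assumes f: "f \<in> L2 \<Omega>" and g: "g \<in> L2 \<Omega>" and u\<Gamma>: "u\<^sub>\<Gamma> \<in> H_half_vec \<Omega>" and r\<Gamma>: "r\<^sub>\<Gamma> \<in> H_mhalf \<Omega>"
    and small: "gamma1 Ca (ca_const \<mu> c0 \<kappa>1) \<beta>2 / r * max (gamma1 Ca (ca_const \<mu> c0 \<kappa>1) \<beta>2 * \<kappa>2 * r) 1
        * data_norm \<Omega> f g u\<^sub>\<Gamma> r\<^sub>\<Gamma> < 1"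
begin

abbreviation "lin_sol \<equiv> lin_solution \<Omega> lam \<mu> \<alpha> c0 \<kappa> f g u\<^sub>\<Gamma> r\<^sub>\<Gamma>"
abbreviation "nonlin_sol \<equiv> nonlin_solution \<Omega> lam \<mu> \<alpha> c0 \<kappa> f g u\<^sub>\<Gamma> r\<^sub>\<Gamma>"
abbreviation "J \<equiv> J_op \<Omega> lam \<mu> \<alpha> c0 \<kappa> f g u\<^sub>\<Gamma> r\<^sub>\<Gamma>"
abbreviation "fixed_pt \<equiv> J_fixed_point \<Omega> lam \<mu> \<alpha> c0 \<kappa> f g u\<^sub>\<Gamma> r\<^sub>\<Gamma> r"
abbreviation "D \<equiv> data_norm \<Omega> f g u\<^sub>\<Gamma> r\<^sub>\<Gamma>"

lemma lin_solD:
  assumes "lin_sol w d \<sigma> u"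
  shows "saddle_point_solution \<Omega> (a w) (G_fun \<Omega> g r\<^sub>\<Gamma>) (H_fun \<Omega> u\<^sub>\<Gamma>) (F_fun \<Omega> f) d \<sigma> u"
    and "d \<in> X_space \<Omega>" "\<sigma> \<in> Y_space \<Omega>" "u \<in> Z_space \<Omega>"
  using assms by (simp_all add: lin_solution_def saddle_point_solution_def)

lemma nonlin_sol_iff: "nonlin_sol d \<sigma> u \<longleftrightarrow> lin_sol d d \<sigma> u"
  by (simp add: nonlin_solution_def lin_solution_def saddle_point_solution_def)

lemma H_half_nonneg: "0 \<le> H_half_vec_norm \<Omega> u\<^sub>\<Gamma>"
  and H_bound: "\<tau> \<in> Y_space \<Omega> \<Longrightarrow> \<bar>H_fun \<Omega> u\<^sub>\<Gamma> \<tau>\<bar> \<le> H_half_vec_norm \<Omega> u\<^sub>\<Gamma> * Y_norm \<Omega> \<tau>"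
  using H_fun_representation[OF u\<Gamma>] by metis+

lemma D_ge: "L2_norm \<Omega> f \<le> D" "H_half_vec_norm \<Omega> u\<^sub>\<Gamma> \<le> D" "0 \<le> D"
  using H_half_nonneg H_mhalf_bound(3)[OF r\<Gamma>] L2_norm_nonneg[of \<Omega> f] L2_norm_nonneg[of \<Omega> g]
  by (simp_all add: data_norm_def del: L2_norm_nonneg)

lemma gamma1_nonneg: "0 \<le> \<gamma>1"
  using ca_pos Ca_pos beta by (simp add: gamma1_def gamma2_def)

lemma lin_sol_bounds:
  assumes w: "w \<in> X_space \<Omega>" and sol: "lin_sol w d \<sigma> u"
  shows "X_norm \<Omega> d \<le> \<gamma>1 * D"
    and "XYZ_norm \<Omega> ((d, \<sigma>), u) \<le> ((1 + 2 * Ca) * \<gamma>1 + 1 + (1 + \<gamma>1) / \<beta>2) * D"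
proof -
  note m = lin_solD(2-4)[OF sol]
  have G0: "G_fun \<Omega> g r\<^sub>\<Gamma> (e, 0) = 0" if "e \<in> L2 \<Omega>" for e
    using linear_form_on_zero[OF G_fun_bound(1)[OF g r\<Gamma>] X.sub] by (simp add: G_fun_def)
  have nn: "0 \<le> L2_norm \<Omega> g + H_mhalf_norm \<Omega> r\<^sub>\<Gamma>" using H_mhalf_bound(3)[OF r\<Gamma>] by simp
  note est = a_priori_estimate[OF w lin_solD(1)[OF sol] G_fun_bound(2)[OF g r\<Gamma>] G0 H_bound F_fun_bound[OF f]
      nn H_half_nonneg L2_norm_nonneg]
  show d_le: "X_norm \<Omega> d \<le> \<gamma>1 * D" using est(1) by (simp add: data_norm_def add.assoc)
  have "L2_norm \<Omega> \<sigma> \<le> L2_norm \<Omega> (strs d)"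
    using est(2) L2.snorm_diff_le[OF Y_L2[OF m(2)] stress_L2[OF m(1), of lam \<mu> \<alpha>]] by (simp add: L2_norm_eq_snorm)
  also have "\<dots> \<le> 2 * Ca * X_norm \<Omega> d" by (rule stress_bound[OF m(1)])
  also have "\<dots> \<le> 2 * Ca * (\<gamma>1 * D)" using d_le Ca_pos by (intro mult_left_mono) auto
  finally have \<sigma>_le: "L2_norm \<Omega> \<sigma> \<le> 2 * Ca * (\<gamma>1 * D)" .
  have div_le: "L2_norm \<Omega> (tensor_div \<Omega> \<sigma>) \<le> D" using est(3) D_ge(1) by simp
  have "\<beta>2 * Z_norm \<Omega> u \<le> (1 + \<gamma>1) * D" using est(4) D_ge(2) d_le by (simp add: distrib_right)
  then have u_le: "Z_norm \<Omega> u \<le> (1 + \<gamma>1) / \<beta>2 * D" using beta by (simp add: field_simps)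
  have N: "0 \<le> X_norm \<Omega> d" "0 \<le> Y_norm \<Omega> \<sigma>" "0 \<le> Z_norm \<Omega> u"
    using X.snorm_nonneg Y.snorm_nonneg Z.snorm_nonneg m by (simp_all add: X_norm_eq Y_norm_eq Z_norm_eq)
  have "XYZ_norm \<Omega> ((d, \<sigma>), u) \<le> XY_norm \<Omega> (d, \<sigma>) + Z_norm \<Omega> u"
    unfolding XYZ_norm_def fst_conv snd_conv
    by (rule sqrt_sum_squares_le_sum) (simp_all add: XY_norm_def N)
  also have "XY_norm \<Omega> (d, \<sigma>) \<le> X_norm \<Omega> d + Y_norm \<Omega> \<sigma>"
    unfolding XY_norm_def using N by (simp add: sqrt_sum_squares_le_sum)
  also have "Y_norm \<Omega> \<sigma> \<le> L2_norm \<Omega> \<sigma> + L2_norm \<Omega> (tensor_div \<Omega> \<sigma>)"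
    unfolding Y_norm_def by (simp add: sqrt_sum_squares_le_sum)
  finally show "XYZ_norm \<Omega> ((d, \<sigma>), u) \<le> ((1 + 2 * Ca) * \<gamma>1 + 1 + (1 + \<gamma>1) / \<beta>2) * D"
    using d_le \<sigma>_le div_le u_le by (simp add: algebra_simps)
qed

lemma lin_sol_unique:
  assumes w: "w \<in> X_space \<Omega>" "w' \<in> X_space \<Omega>" "X_norm \<Omega> (w - w') = 0"
    and "lin_sol w d \<sigma> u" "lin_sol w' d' \<sigma>' u'"
  shows "sol_ae_eq \<Omega> (d, \<sigma>, u) (d', \<sigma>', u')"
  using stability(2)[OF w(1,2) lin_solD(1)[OF assms(4)] lin_solD(1)[OF assms(5)] w(3)]
    lin_solD(2-4)[OF assms(4)] lin_solD(2-4)[OF assms(5)]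
  by (simp add: sol_ae_eq_def pair_ae_eq_X pair_ae_eq_Z ae_eq_iff_snorm Y_L2 L2_norm_eq_snorm)

lemma J_sol: assumes "w \<in> X_space \<Omega>" shows "\<exists>\<sigma> u. lin_sol w (J w) \<sigma> u"
  unfolding J_op_def by (rule someI_ex) (rule linear_problem_solvable[OF assms f g u\<Gamma> r\<Gamma>])

lemma W_ball_X: "w \<in> W_ball \<Omega> r \<Longrightarrow> w \<in> X_space \<Omega>"
  by (simp add: W_ball_def)

text \<open>The two entries of the maximum in the smallness condition.\<close>

lemma invariant_ball: "\<gamma>1 * D \<le> r" and contraction_factor: "\<gamma>1 * \<kappa>2 * (\<gamma>1 * D) < 1"
proof -
  have nn: "0 \<le> \<gamma>1 / r" "0 \<le> D" using gamma1_nonneg radius D_ge by simp_all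
  have "\<gamma>1 / r * 1 * D \<le> \<gamma>1 / r * max (\<gamma>1 * \<kappa>2 * r) 1 * D"
    using nn by (intro mult_right_mono mult_left_mono) auto
  then have "\<gamma>1 / r * D < 1" using small by simp
  then show "\<gamma>1 * D \<le> r" using radius by (simp add: field_simps)
  have "\<gamma>1 / r * (\<gamma>1 * \<kappa>2 * r) * D \<le> \<gamma>1 / r * max (\<gamma>1 * \<kappa>2 * r) 1 * D"
    using nn by (intro mult_right_mono mult_left_mono) auto
  moreover have "\<gamma>1 / r * (\<gamma>1 * \<kappa>2 * r) * D = \<gamma>1 * \<kappa>2 * (\<gamma>1 * D)" using radius by simp
  ultimately show "\<gamma>1 * \<kappa>2 * (\<gamma>1 * D) < 1" using small by linarith
qed

lemma contraction:
  assumes w: "w \<in> X_space \<Omega>" "w' \<in> X_space \<Omega>" and sol: "lin_sol w d \<sigma> u" "lin_sol w' d' \<sigma>' u'"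
  shows "X_norm \<Omega> (d - d') \<le> \<gamma>1 * \<kappa>2 * (\<gamma>1 * D) * X_norm \<Omega> (w - w')"
proof -
  have N: "0 \<le> X_norm \<Omega> (w - w')" using X.snorm_nonneg w by (simp add: X_norm_eq)
  have "X_norm \<Omega> (d - d') \<le> \<gamma>1 * (\<kappa>2 * X_norm \<Omega> (w - w') * X_norm \<Omega> d')"
    by (rule stability(1)[OF w lin_solD(1)[OF sol(1)] lin_solD(1)[OF sol(2)]])
  also have "\<dots> \<le> \<gamma>1 * (\<kappa>2 * X_norm \<Omega> (w - w') * (\<gamma>1 * D))"
    using gamma1_nonneg perm N lin_sol_bounds(1)[OF w(2) sol(2)] by (intro mult_left_mono) auto
  finally show ?thesis by (simp add: mult_ac)
qed

lemma nonlin_sol_unique: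
  assumes "nonlin_sol d \<sigma> u" "nonlin_sol d' \<sigma>' u'"
  shows "sol_ae_eq \<Omega> (d, \<sigma>, u) (d', \<sigma>', u')"
proof -
  note sol = assms[unfolded nonlin_sol_iff]
  note d = lin_solD(2)[OF sol(1)] lin_solD(2)[OF sol(2)]
  let ?x = "X_norm \<Omega> (d - d')" and ?L = "\<gamma>1 * \<kappa>2 * (\<gamma>1 * D)"
  have N: "0 \<le> ?x" using X.snorm_nonneg d by (simp add: X_norm_eq)
  have "?x \<le> ?L * ?x" by (rule contraction[OF d sol])
  then have "(1 - ?L) * ?x \<le> 0" by (simp add: left_diff_distrib)
  then have "?x = 0" using contraction_factor N by (simp add: mult_le_0_iff)
  then show ?thesis using lin_sol_unique[OF d _ sol] by simp
qed

text \<open>The operator \<open>J\<close> picks a representative of the solution. A fixed point agrees with it only almost everywhere, and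
  the equations do not distinguish the two.\<close>

lemma fixed_point_iff:
  assumes d: "d \<in> W_ball \<Omega> r"
  shows "fixed_pt d \<longleftrightarrow> (\<exists>\<sigma> u. nonlin_sol d \<sigma> u)"
proof -
  have dX: "d \<in> X_space \<Omega>" using d by (rule W_ball_X)
  obtain \<sigma> u where sol: "lin_sol d (J d) \<sigma> u" using J_sol[OF dX] by blast
  note Jd = lin_solD(2)[OF sol]
  show ?thesis
  proof
    assume "fixed_pt d"
    then have 0: "X_norm \<Omega> (J d - d) = 0" using pair_ae_eq_X[OF Jd dX] by (simp add: J_fixed_point_def)
    have a_same: "a d (J d) e = a d d e" if e: "e \<in> X_space \<Omega>" for e
    proof -
      obtain M where "\<bar>a d (J d - d) e\<bar> \<le> M * X_norm \<Omega> (J d - d) * X_norm \<Omega> e"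
        using a_bounded[OF dX] Jd dX e X.mem(3) by blast
      then show ?thesis using linear_form_on_diff[OF a_linear(2)[OF dX e] X.sub Jd dX] 0 by simp
    qed
    have "L2_ip \<Omega> \<tau> (fst (J d)) = L2_ip \<Omega> \<tau> (fst d)" if \<tau>: "\<tau> \<in> Y_space \<Omega>" for \<tau>
    proof -
      have "L2_norm \<Omega> (fst (J d) - fst d) = 0"
        using X_norm_ge(1)[of "J d - d"] 0 L2_norm_nonneg[of \<Omega> "fst (J d) - fst d"]
        by (simp add: fst_diff del: L2_norm_nonneg)
      then show ?thesis
        using L2_Cauchy_Schwarz[OF Y_L2[OF \<tau>] L2.mem(3)[OF X_L2(1)[OF Jd] X_L2(1)[OF dX]]]
          L2.diff_right[OF X_L2(1)[OF Jd] X_L2(1)[OF dX] Y_L2[OF \<tau>]] by simp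
    qed
    then have "saddle_point_solution \<Omega> (a d) (G_fun \<Omega> g r\<^sub>\<Gamma>) (H_fun \<Omega> u\<^sub>\<Gamma>) (F_fun \<Omega> f) d \<sigma> u"
      using lin_solD(1)[OF sol] a_same dX unfolding saddle_iff by simp
    then show "\<exists>\<sigma> u. nonlin_sol d \<sigma> u"
      unfolding nonlin_sol_iff lin_solution_def by blast
  next
    assume "\<exists>\<sigma> u. nonlin_sol d \<sigma> u"
    then obtain \<sigma>' u' where "lin_sol d d \<sigma>' u'" unfolding nonlin_sol_iff by blast
    from lin_sol_unique[OF dX dX _ sol this] have "pair_ae_eq \<Omega> (J d) d"
      by (simp add: sol_ae_eq_def X_norm_eq)
    then show "fixed_pt d" using d by (simp add: J_fixed_point_def)
  qed
qed

lemma fixed_point_exists: "\<exists>d. fixed_pt d"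
proof -
  have J: "J w \<in> W_ball \<Omega> r" if w: "w \<in> W_ball \<Omega> r" for w
  proof -
    obtain \<sigma> u where sol: "lin_sol w (J w) \<sigma> u" using J_sol[OF W_ball_X[OF w]] by blast
    then show ?thesis
      using lin_sol_bounds(1)[OF W_ball_X[OF w] sol] lin_solD(2)[OF sol] invariant_ball
      by (simp add: W_ball_def)
  qed
  have "\<exists>d\<in>W_ball \<Omega> r. snorm (X_ip \<Omega>) (J d - d) = 0"
  proof (rule X.contraction_fixed_point)
    show "W_ball \<Omega> r \<subseteq> X_space \<Omega>" using W_ball_X by blast
    show "0 \<in> W_ball \<Omega> r" using radius X.mem(1) by (simp add: W_ball_def X_norm_eq)
    show "0 \<le> \<gamma>1 * \<kappa>2 * (\<gamma>1 * D)" using gamma1_nonneg perm D_ge by simp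
    show "\<gamma>1 * \<kappa>2 * (\<gamma>1 * D) < 1" by (rule contraction_factor)
    show "snorm (X_ip \<Omega>) (J w - J w') \<le> \<gamma>1 * \<kappa>2 * (\<gamma>1 * D) * snorm (X_ip \<Omega>) (w - w')"
      if w: "w \<in> W_ball \<Omega> r" "w' \<in> W_ball \<Omega> r" for w w'
    proof -
      obtain \<sigma> u \<sigma>' u' where "lin_sol w (J w) \<sigma> u" "lin_sol w' (J w') \<sigma>' u'"
        using J_sol[OF W_ball_X[OF w(1)]] J_sol[OF W_ball_X[OF w(2)]] by blast
      from contraction[OF W_ball_X[OF w(1)] W_ball_X[OF w(2)] this] show ?thesis by (simp add: X_norm_eq)
    qed
    fix X d assume X: "\<And>n. X n \<in> W_ball \<Omega> r" and d: "d \<in> X_space \<Omega>"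
      and lim: "(\<lambda>n. snorm (X_ip \<Omega>) (X n - d)) \<longlonglongrightarrow> 0"
    have "(\<lambda>n. snorm (X_ip \<Omega>) (X n)) \<longlonglongrightarrow> snorm (X_ip \<Omega>) d"
      using X.tendsto_snorm[OF W_ball_X[OF X] d lim] .
    moreover have "snorm (X_ip \<Omega>) (X n) \<le> r" for n using X[of n] by (simp add: W_ball_def X_norm_eq)
    ultimately have "snorm (X_ip \<Omega>) d \<le> r" by (intro LIMSEQ_le_const2) auto
    then show "d \<in> W_ball \<Omega> r" using d by (simp add: W_ball_def X_norm_eq)
  qed (rule J)
  then obtain d where d: "d \<in> W_ball \<Omega> r" "X_norm \<Omega> (J d - d) = 0" by (auto simp: X_norm_eq)
  then have "pair_ae_eq \<Omega> (J d) d" using pair_ae_eq_X[of "J d" d] J[OF d(1)] W_ball_X by blast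
  then show ?thesis using d(1) unfolding J_fixed_point_def by blast
qed

end

theorem theorem3p2:
  fixes \<Omega> :: "(real ^ 'n::finite) set"
    and lam \<mu> \<alpha> c0 \<kappa>1 \<kappa>2 \<beta>2 r \<gamma>1 :: real
    and \<kappa> :: "'n X_elem \<Rightarrow> 'n tensor_fld"
  assumes dim: "CARD('n) \<in> {2, 3}"
    and dom: "lipschitz_domain \<Omega>"
    and params: "lam > 0" "\<mu> > 0" "0 \<le> \<alpha>" "\<alpha> \<le> 1" "c0 > 0"
    and perm: "\<kappa>1 > 0" "\<kappa>2 > 0" "permeability \<Omega> \<kappa>1 \<kappa>2 \<kappa>"
    and beta: "\<beta>2 > 0" "inf_sup_b2 \<Omega> \<beta>2"
    and radius: "r > 0"
    and gamma: "\<gamma>1 = gamma1 (Ca_const (CARD('n)) lam \<mu> \<alpha> c0 \<kappa>2 r) (ca_const \<mu> c0 \<kappa>1) \<beta>2"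
  shows "\<exists>C>0. \<forall>f \<in> L2 \<Omega>. \<forall>g \<in> L2 \<Omega>. \<forall>u\<^sub>\<Gamma> \<in> H_half_vec \<Omega>. \<forall>r\<^sub>\<Gamma> \<in> H_mhalf \<Omega>.
    \<gamma>1 / r * max (\<gamma>1 * \<kappa>2 * r) 1 * data_norm \<Omega> f g u\<^sub>\<Gamma> r\<^sub>\<Gamma> < 1 \<longrightarrow>
      (\<forall>w \<in> W_ball \<Omega> r. unique_upto (sol_ae_eq \<Omega>)
         (\<lambda>(d, \<sigma>, u). lin_solution \<Omega> lam \<mu> \<alpha> c0 \<kappa> f g u\<^sub>\<Gamma> r\<^sub>\<Gamma> w d \<sigma> u)) \<and>
      unique_upto (pair_ae_eq \<Omega>)
         (\<lambda>d. J_fixed_point \<Omega> lam \<mu> \<alpha> c0 \<kappa> f g u\<^sub>\<Gamma> r\<^sub>\<Gamma> r d) \<and>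
      unique_upto (sol_ae_eq \<Omega>)
         (\<lambda>(d, \<sigma>, u). nonlin_solution \<Omega> lam \<mu> \<alpha> c0 \<kappa> f g u\<^sub>\<Gamma> r\<^sub>\<Gamma> d \<sigma> u \<and> d \<in> W_ball \<Omega> r) \<and>
      (\<forall>d \<in> W_ball \<Omega> r. J_fixed_point \<Omega> lam \<mu> \<alpha> c0 \<kappa> f g u\<^sub>\<Gamma> r\<^sub>\<Gamma> r d \<longleftrightarrow>
         (\<exists>\<sigma> u. nonlin_solution \<Omega> lam \<mu> \<alpha> c0 \<kappa> f g u\<^sub>\<Gamma> r\<^sub>\<Gamma> d \<sigma> u)) \<and>
      (\<forall>d \<sigma> u. nonlin_solution \<Omega> lam \<mu> \<alpha> c0 \<kappa> f g u\<^sub>\<Gamma> r\<^sub>\<Gamma> d \<sigma> u \<and> d \<in> W_ball \<Omega> r \<longrightarrow>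
         XYZ_norm \<Omega> ((d, \<sigma>), u) \<le> C * data_norm \<Omega> f g u\<^sub>\<Gamma> r\<^sub>\<Gamma>)"
proof -
  define Ca where "Ca = Ca_const (CARD('n)) lam \<mu> \<alpha> c0 \<kappa>2 r"
  interpret poroelasticity \<Omega> lam \<mu> \<alpha> c0 \<kappa>1 \<kappa>2 \<beta>2 r Ca \<kappa>
    by unfold_locales (use dom params perm beta radius in \<open>auto simp: lipschitz_domain_def Ca_def\<close>)
  have g1: "\<gamma>1 = gamma1 Ca (ca_const \<mu> c0 \<kappa>1) \<beta>2" by (simp add: gamma Ca_def)
  \<comment> \<open>The bounds for strain and pressure, for the stress and its divergence, and for the multipliers, added up.\<close>
  define C where "C = (1 + 2 * Ca) * \<gamma>1 + 1 + (1 + \<gamma>1) / \<beta>2"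
  have "0 \<le> \<gamma>1" using ca_pos Ca_pos beta by (simp add: g1 gamma1_def gamma2_def)
  then have C: "C > 0" using Ca_pos beta by (simp add: C_def add_pos_nonneg add_nonneg_pos)
  show ?thesis
  proof (intro exI[of _ C] conjI[OF C] ballI impI)
    fix f g u\<^sub>\<Gamma> r\<^sub>\<Gamma>
    assume data: "f \<in> L2 \<Omega>" "g \<in> L2 \<Omega>" "u\<^sub>\<Gamma> \<in> H_half_vec \<Omega>" "r\<^sub>\<Gamma> \<in> H_mhalf \<Omega>"
      and small: "\<gamma>1 / r * max (\<gamma>1 * \<kappa>2 * r) 1 * data_norm \<Omega> f g u\<^sub>\<Gamma> r\<^sub>\<Gamma> < 1"
    interpret poroelasticity_data lam \<mu> \<alpha> c0 \<kappa>1 \<kappa>2 \<beta>2 r Ca \<kappa> \<Omega> f g u\<^sub>\<Gamma> r\<^sub>\<Gamma>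
      by unfold_locales (use data small g1 in auto)
    have lin: "unique_upto (sol_ae_eq \<Omega>) (\<lambda>(d, \<sigma>, u). lin_sol w d \<sigma> u)" if w: "w \<in> W_ball \<Omega> r" for w
      unfolding unique_upto_def
      using linear_problem_solvable[OF W_ball_X[OF w] data] lin_sol_unique[OF W_ball_X[OF w] W_ball_X[OF w]]
      by (auto simp: X_norm_eq)
    obtain d0 where d0: "fixed_pt d0" using fixed_point_exists by blast
    then have d0W: "d0 \<in> W_ball \<Omega> r" by (simp add: J_fixed_point_def)
    obtain \<sigma>0 u0 where s0: "nonlin_sol d0 \<sigma>0 u0" using fixed_point_iff[OF d0W] d0 by blast
    have fixed: "unique_upto (pair_ae_eq \<Omega>) fixed_pt"
      unfolding unique_upto_def
    proof (intro conjI allI impI)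
      show "\<exists>d. fixed_pt d" using d0 by blast
      fix d d' assume "fixed_pt d" "fixed_pt d'"
      then obtain \<sigma> u \<sigma>' u' where "nonlin_sol d \<sigma> u" "nonlin_sol d' \<sigma>' u'"
        using fixed_point_iff unfolding J_fixed_point_def by meson
      from nonlin_sol_unique[OF this] show "pair_ae_eq \<Omega> d d'" by (simp add: sol_ae_eq_def)
    qed
    have nonlin: "unique_upto (sol_ae_eq \<Omega>) (\<lambda>(d, \<sigma>, u). nonlin_sol d \<sigma> u \<and> d \<in> W_ball \<Omega> r)"
      unfolding unique_upto_def
    proof (intro conjI allI impI)
      show "\<exists>x. case x of (d, \<sigma>, u) \<Rightarrow> nonlin_sol d \<sigma> u \<and> d \<in> W_ball \<Omega> r"
        by (rule exI[of _ "(d0, \<sigma>0, u0)"]) (simp add: s0 d0W)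
    qed (use nonlin_sol_unique in auto)
    have bound: "XYZ_norm \<Omega> ((d, \<sigma>), u) \<le> C * D" if "nonlin_sol d \<sigma> u" "d \<in> W_ball \<Omega> r" for d \<sigma> u
      using lin_sol_bounds(2)[OF W_ball_X[OF that(2)]] that(1) by (simp add: nonlin_sol_iff C_def g1)
    show "(\<forall>w\<in>W_ball \<Omega> r. unique_upto (sol_ae_eq \<Omega>) (\<lambda>(d, \<sigma>, u). lin_sol w d \<sigma> u)) \<and>
        unique_upto (pair_ae_eq \<Omega>) (\<lambda>d. fixed_pt d) \<and>
        unique_upto (sol_ae_eq \<Omega>) (\<lambda>(d, \<sigma>, u). nonlin_sol d \<sigma> u \<and> d \<in> W_ball \<Omega> r) \<and>
        (\<forall>d\<in>W_ball \<Omega> r. fixed_pt d \<longleftrightarrow> (\<exists>\<sigma> u. nonlin_sol d \<sigma> u)) \<and>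
        (\<forall>d \<sigma> u. nonlin_sol d \<sigma> u \<and> d \<in> W_ball \<Omega> r \<longrightarrow> XYZ_norm \<Omega> ((d, \<sigma>), u) \<le> C * D)"
      using lin fixed nonlin fixed_point_iff bound by blast
  qed
qed
end
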